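(* Let $0=t_0<t_1<\dots<t_N=T$ be a partition of $[0,T]$ with time steps $k_n:=t_n-t_{n-1}$. Let $f^1,\dots,f^N\in L^2(\Omega)$ and $u_h^0\in L^2(\Omega)$ be given, and for each $n=1,\dots,N$ let $U_h^n\subseteq U$ be a closed subspace. Then for all $n=1,\dots,N$ the problem of finding $\mathbf{u}_h^n=(u_h^n,\boldsymbol\sigma_h^n)\in U_h^n$ such that $$B_{k_n}(\mathbf{u}_h^n,\mathbf{v}_h)=F_n(\mathbf{v}_h;f^n,u_h^{n-1})\quad\text{for all }\mathbf{v}_h\in U_h^n$$ (where $u_h^{n-1}$ is the first component of the solution of the previous step) admits a unique solution $\mathbf{u}_h^n\in U_h^n$.
   Context: $\Omega\subset\mathbb{R}^d$ is a bounded Lipschitz domain with polygonal boundary; $(\cdot,\cdot)$ and $\|\cdot\|$ denote the $L^2(\Omega)$ inner product and norm. The coefficients satisfy $\mathbf{A}\in L^\infty(\Omega)^{d\times d}$ symmetric with $\lambda_{\min}(\mathbf{A})\ge\alpha_0>0$ a.e., $\boldsymbol\beta\in L^\infty(\Omega)^d$, $\gamma\in L^\infty(\Omega)$, and $\tfrac12\operatorname{div}\boldsymbol\beta+\gamma\in L^\infty(\Omega)$ with $\tfrac12\operatorname{div}\boldsymbol\beta+\gamma\ge0$ a.e. Let $U:=H^1_0(\Omega)\times H(\operatorname{div},\Omega)$. For $k>0$ and $\mathbf{u}=(u,\boldsymbol\sigma),\mathbf{v}=(v,\boldsymbol\tau)\in U$ define $\tilde b_k(\mathbf u,\mathbf v):=(-\operatorname{div}\boldsymbol\sigma-\boldsymbol\beta\cdot\nabla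 u+\gamma u,v)+k(-\operatorname{div}\boldsymbol\sigma-\boldsymbol\beta\cdot\nabla u+\gamma u,-\operatorname{div}\boldsymbol\tau-\boldsymbol\beta\cdot\nabla v+\gamma v)+(\mathbf A^{1/2}\nabla u-\mathbf A^{-1/2}\boldsymbol\sigma,\mathbf A^{1/2}\nabla v-\mathbf A^{-1/2}\boldsymbol\tau)$, $b_k(\mathbf u,\mathbf v):=(u,-\operatorname{div}\boldsymbol\tau-\boldsymbol\beta\cdot\nabla v+\gamma v)+\tilde b_k(\mathbf u,\mathbf v)$, and $B_k(\mathbf u,\mathbf v):=\frac1k(u,v)+b_k(\mathbf u,\mathbf v)$. For $g,w\in L^2(\Omega)$ let $F_n(\mathbf v;g,w):=k_n\big(g+\tfrac{w}{k_n},\tfrac{v}{k_n}-\operatorname{div}\boldsymbol\tau-\boldsymbol\beta\cdot\nabla v+\gamma v\big)$. *)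

theory Defs
  imports "HOL-Analysis.Analysis"
begin

definition lipschitz_domain :: "(real^'d) set \<Rightarrow> bool" where
  "lipschitz_domain \<Omega> \<longleftrightarrow> open \<Omega> \<and> connected \<Omega> \<and> \<Omega> \<noteq> {} \<and>
     (\<forall>p \<in> frontier \<Omega>. \<exists>V e g C. open V \<and> p \<in> V \<and> norm e = 1 \<and>
        C-lipschitz_on {y. inner e y = 0} g \<and>
        \<Omega> \<inter> V = {x \<in> V. inner e x < g (x - inner e x *\<^sub>R e)})"

definition polygonal_boundary :: "(real^'d) set \<Rightarrow> bool" where
  "polygonal_boundary \<Omega> \<longleftrightarrow> (\<exists>H :: ((real^'d) \<times> real) set. finite H \<and>
     (\<forall>(a,b) \<in> H. a \<noteq> 0) \<and> frontier \<Omega> \<subseteq> (\<Union>(a,b) \<in> H. {x. inner a x = b}))"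

definition pd :: "'d::finite \<Rightarrow> (real^'d \<Rightarrow> real) \<Rightarrow> real^'d \<Rightarrow> real" where
  "pd i \<phi> x = frechet_derivative \<phi> (at x) (axis i 1)"

definition smooth_fun :: "(real^'d::finite \<Rightarrow> real) \<Rightarrow> bool" where
  "smooth_fun \<phi> \<longleftrightarrow> (\<forall>is :: 'd list. \<forall>x. (foldr pd is \<phi>) differentiable (at x))"

definition test_fun :: "(real^'d) set \<Rightarrow> (real^'d::finite \<Rightarrow> real) \<Rightarrow> bool" where
  "test_fun \<Omega> \<phi> \<longleftrightarrow> smooth_fun \<phi> \<and> compact (closure {x. \<phi> x \<noteq> 0})
      \<and> closure {x. \<phi> x \<noteq> 0} \<subseteq> \<Omega>"

definition cgrad :: "(real^'d::finite \<Rightarrow> real) \<Rightarrow> real^'d \<Rightarrow> real^'d" where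
  "cgrad \<phi> x = (\<chi> i. pd i \<phi> x)"

definition L2 :: "(real^'d) set \<Rightarrow> (real^'d::finite \<Rightarrow> 'b::euclidean_space) \<Rightarrow> bool" where
  "L2 \<Omega> f \<longleftrightarrow> f \<in> borel_measurable (lebesgue_on \<Omega>) \<and>
     integrable (lebesgue_on \<Omega>) (\<lambda>x. (norm (f x))\<^sup>2)"

definition Linf :: "(real^'d) set \<Rightarrow> (real^'d::finite \<Rightarrow> 'b::euclidean_space) \<Rightarrow> bool" where
  "Linf \<Omega> f \<longleftrightarrow> f \<in> borel_measurable (lebesgue_on \<Omega>) \<and>
     (\<exists>C. AE x in lebesgue_on \<Omega>. norm (f x) \<le> C)"

definition l2ip :: "(real^'d) set \<Rightarrow> (real^'d::finite \<Rightarrow> 'b::euclidean_space) \<Rightarrow> (real^'d \<Rightarrow> 'b) \<Rightarrow> real" where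
  "l2ip \<Omega> u v = (LINT x|lebesgue_on \<Omega>. inner (u x) (v x))"

definition is_weak_grad :: "(real^'d) set \<Rightarrow> (real^'d::finite \<Rightarrow> real) \<Rightarrow> (real^'d \<Rightarrow> real^'d) \<Rightarrow> bool" where
  "is_weak_grad \<Omega> u G \<longleftrightarrow> (\<forall>\<phi>. test_fun \<Omega> \<phi> \<longrightarrow> (\<forall>i.
      (LINT x|lebesgue_on \<Omega>. u x * pd i \<phi> x) = - (LINT x|lebesgue_on \<Omega>. G x $ i * \<phi> x)))"

definition is_weak_div :: "(real^'d) set \<Rightarrow> (real^'d::finite \<Rightarrow> real^'d) \<Rightarrow> (real^'d \<Rightarrow> real) \<Rightarrow> bool" where
  "is_weak_div \<Omega> \<sigma> q \<longleftrightarrow> (\<forall>\<phi>. test_fun \<Omega> \<phi> \<longrightarrow>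
      (LINT x|lebesgue_on \<Omega>. inner (\<sigma> x) (cgrad \<phi> x)) = - (LINT x|lebesgue_on \<Omega>. q x * \<phi> x))"

definition H1 :: "(real^'d) set \<Rightarrow> (real^'d::finite \<Rightarrow> real) \<Rightarrow> bool" where
  "H1 \<Omega> u \<longleftrightarrow> L2 \<Omega> u \<and> (\<exists>G. L2 \<Omega> G \<and> is_weak_grad \<Omega> u G)"

definition wgrad :: "(real^'d) set \<Rightarrow> (real^'d::finite \<Rightarrow> real) \<Rightarrow> real^'d \<Rightarrow> real^'d" where
  "wgrad \<Omega> u = (SOME G. L2 \<Omega> G \<and> is_weak_grad \<Omega> u G)"

definition Hdiv :: "(real^'d) set \<Rightarrow> (real^'d::finite \<Rightarrow> real^'d) \<Rightarrow> bool" where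
  "Hdiv \<Omega> \<sigma> \<longleftrightarrow> L2 \<Omega> \<sigma> \<and> (\<exists>q. L2 \<Omega> q \<and> is_weak_div \<Omega> \<sigma> q)"

definition wdiv :: "(real^'d) set \<Rightarrow> (real^'d::finite \<Rightarrow> real^'d) \<Rightarrow> real^'d \<Rightarrow> real" where
  "wdiv \<Omega> \<sigma> = (SOME q. L2 \<Omega> q \<and> is_weak_div \<Omega> \<sigma> q)"

definition H1_norm :: "(real^'d) set \<Rightarrow> (real^'d::finite \<Rightarrow> real) \<Rightarrow> real" where
  "H1_norm \<Omega> u = sqrt (l2ip \<Omega> u u + l2ip \<Omega> (wgrad \<Omega> u) (wgrad \<Omega> u))"

definition H10 :: "(real^'d) set \<Rightarrow> (real^'d::finite \<Rightarrow> real) \<Rightarrow> bool" where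
  "H10 \<Omega> u \<longleftrightarrow> H1 \<Omega> u \<and> (\<exists>\<phi>s. (\<forall>j. test_fun \<Omega> (\<phi>s j)) \<and>
      (\<lambda>j. H1_norm \<Omega> (\<lambda>x. u x - \<phi>s j x)) \<longlonglongrightarrow> 0)"

type_synonym 'd Uelem = "(real^'d \<Rightarrow> real) \<times> (real^'d \<Rightarrow> real^'d)"

definition U_space :: "(real^'d) set \<Rightarrow> ('d::finite) Uelem set" where
  "U_space \<Omega> = {(u, \<sigma>). H10 \<Omega> u \<and> Hdiv \<Omega> \<sigma>}"

definition U_norm :: "(real^'d) set \<Rightarrow> ('d::finite) Uelem \<Rightarrow> real" where
  "U_norm \<Omega> w = sqrt (l2ip \<Omega> (fst w) (fst w) + l2ip \<Omega> (wgrad \<Omega> (fst w)) (wgrad \<Omega> (fst w))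
      + l2ip \<Omega> (snd w) (snd w) + l2ip \<Omega> (wdiv \<Omega> (snd w)) (wdiv \<Omega> (snd w)))"

definition U_diff :: "('d::finite) Uelem \<Rightarrow> 'd Uelem \<Rightarrow> 'd Uelem" where
  "U_diff v w = ((\<lambda>x. fst v x - fst w x), (\<lambda>x. snd v x - snd w x))"

definition closed_subspace_U :: "(real^'d) set \<Rightarrow> ('d::finite) Uelem set \<Rightarrow> bool" where
  "closed_subspace_U \<Omega> V \<longleftrightarrow> V \<subseteq> U_space \<Omega> \<and> ((\<lambda>x. 0), (\<lambda>x. 0)) \<in> V \<and>
     (\<forall>v\<in>V. \<forall>w\<in>V. ((\<lambda>x. fst v x + fst w x), (\<lambda>x. snd v x + snd w x)) \<in> V) \<and>
     (\<forall>c::real. \<forall>v\<in>V. ((\<lambda>x. c * fst v x), (\<lambda>x. c *\<^sub>R snd v x)) \<in> V) \<and>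
     (\<forall>vs w. (\<forall>j. vs j \<in> V) \<and> w \<in> U_space \<Omega> \<and> (\<lambda>j. U_norm \<Omega> (U_diff (vs j) w)) \<longlonglongrightarrow> 0
        \<longrightarrow> w \<in> V)"

definition U_eq :: "(real^'d) set \<Rightarrow> ('d::finite) Uelem \<Rightarrow> 'd Uelem \<Rightarrow> bool" where
  "U_eq \<Omega> v w \<longleftrightarrow> (AE x in lebesgue_on \<Omega>. fst v x = fst w x \<and> snd v x = snd w x)"

definition mat_eigenvalues :: "real^'d^'d \<Rightarrow> real set" where
  "mat_eigenvalues M = {c. \<exists>v. v \<noteq> 0 \<and> M *v v = c *\<^sub>R v}"

definition mat_sqrt :: "real^'d^'d \<Rightarrow> real^'d^'d" where
  "mat_sqrt M = (THE S. transpose S = S \<and> (\<forall>c \<in> mat_eigenvalues S. c > 0) \<and> S ** S = M)"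

definition Lop :: "(real^'d) set \<Rightarrow> (real^'d \<Rightarrow> real^'d) \<Rightarrow> (real^'d \<Rightarrow> real) \<Rightarrow> ('d::finite) Uelem \<Rightarrow> real^'d \<Rightarrow> real" where
  "Lop \<Omega> \<beta> \<gamma> w = (\<lambda>x. - wdiv \<Omega> (snd w) x - inner (\<beta> x) (wgrad \<Omega> (fst w) x) + \<gamma> x * fst w x)"

definition flux :: "(real^'d) set \<Rightarrow> (real^'d \<Rightarrow> real^'d^'d) \<Rightarrow> ('d::finite) Uelem \<Rightarrow> real^'d \<Rightarrow> real^'d" where
  "flux \<Omega> A w = (\<lambda>x. mat_sqrt (A x) *v wgrad \<Omega> (fst w) x - matrix_inv (mat_sqrt (A x)) *v snd w x)"

definition b_tilde :: "(real^'d) set \<Rightarrow> (real^'d \<Rightarrow> real^'d^'d) \<Rightarrow> (real^'d \<Rightarrow> real^'d) \<Rightarrow> (real^'d \<Rightarrow> real)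
    \<Rightarrow> real \<Rightarrow> ('d::finite) Uelem \<Rightarrow> 'd Uelem \<Rightarrow> real" where
  "b_tilde \<Omega> A \<beta> \<gamma> k w v = l2ip \<Omega> (Lop \<Omega> \<beta> \<gamma> w) (fst v)
      + k * l2ip \<Omega> (Lop \<Omega> \<beta> \<gamma> w) (Lop \<Omega> \<beta> \<gamma> v) + l2ip \<Omega> (flux \<Omega> A w) (flux \<Omega> A v)"

definition b_form :: "(real^'d) set \<Rightarrow> (real^'d \<Rightarrow> real^'d^'d) \<Rightarrow> (real^'d \<Rightarrow> real^'d) \<Rightarrow> (real^'d \<Rightarrow> real)
    \<Rightarrow> real \<Rightarrow> ('d::finite) Uelem \<Rightarrow> 'd Uelem \<Rightarrow> real" where
  "b_form \<Omega> A \<beta> \<gamma> k w v = l2ip \<Omega> (fst w) (Lop \<Omega> \<beta> \<gamma> v) + b_tilde \<Omega> A \<beta> \<gamma> k w v"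

definition B_form :: "(real^'d) set \<Rightarrow> (real^'d \<Rightarrow> real^'d^'d) \<Rightarrow> (real^'d \<Rightarrow> real^'d) \<Rightarrow> (real^'d \<Rightarrow> real)
    \<Rightarrow> real \<Rightarrow> ('d::finite) Uelem \<Rightarrow> 'd Uelem \<Rightarrow> real" where
  "B_form \<Omega> A \<beta> \<gamma> k w v = (1 / k) * l2ip \<Omega> (fst w) (fst v) + b_form \<Omega> A \<beta> \<gamma> k w v"

definition F_form :: "(real^'d) set \<Rightarrow> (real^'d \<Rightarrow> real^'d) \<Rightarrow> (real^'d \<Rightarrow> real)
    \<Rightarrow> real \<Rightarrow> ('d::finite) Uelem \<Rightarrow> (real^'d \<Rightarrow> real) \<Rightarrow> (real^'d \<Rightarrow> real) \<Rightarrow> real" where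
  "F_form \<Omega> \<beta> \<gamma> k v g w = k * l2ip \<Omega> (\<lambda>x. g x + w x / k) (\<lambda>x. fst v x / k + Lop \<Omega> \<beta> \<gamma> v x)"

end

theory Submission
  imports Defs "HOL-Computational_Algebra.Polynomial"
begin

text \<open>
  Completing the square gives
  \<open>B\<^sub>k(u, v) = k (u/k + L u, v/k + L v) + (flux u, flux v)\<close> with \<open>L u = - div \<sigma> - \<beta> \<cdot> \<nabla>u + \<gamma> u\<close>, so each
  time step is a least-squares problem: project \<open>(\<surd>k (f + w/k), 0)\<close> onto the image of \<open>U\<^sub>h\<close> under the
  residual map \<open>R\<close> into \<open>L\<^sup>2\<close>. That image is closed because \<open>R\<close> is bounded below in the norm of \<open>U\<close>: testing
  \<open>u/k + L u\<close> with \<open>u \<in> H\<^sup>1\<^sub>0\<close> and using \<open>-(\<beta> \<cdot> \<nabla>u, u) = (div \<beta> u, u)/2\<close> bounds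
  \<open>\<parallel>u\<parallel>\<^sup>2/k + \<parallel>A\<^sup>1\<^sup>/\<^sup>2\<nabla>u\<parallel>\<^sup>2\<close> by the residual, and then \<open>\<sigma>\<close> and \<open>div \<sigma>\<close> are recovered from it.
\<close>

text \<open>Two obstacles shape the proof. Elements of U are functions, not classes modulo null
  sets, and \<open>wgrad\<close> and \<open>wdiv\<close> are values of a choice operator. Hence R is
  linear only almost everywhere, and even that presupposes uniqueness of weak derivatives, which
  rests on a supply of test functions built here from exp(-1/t). The image of R is therefore
  enlarged to all functions that agree almost everywhere with some R v; this makes it a genuine
  linear set. The second obstacle is \<open>mat_sqrt\<close>, a definite description applied
  pointwise to a coefficient that is merely measurable. Besides existence and uniqueness of the
  root, its continuous dependence on the matrix is proved, and the measurability of the flux is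
  derived from that. The time steps are coupled only through the first component of the previous
  solution, of which nothing but square integrability is passed on.\<close>

lemma quadratic_nonneg_imp_linear_coeff_zero:
  fixes b c :: real
  assumes "\<And>s. 0 \<le> 2 * s * c + s\<^sup>2 * b"
  shows "c = 0"
proof (rule ccontr)
  assume c: "c \<noteq> 0"
  \<comment> \<open>The minimiser of \<open>2 * s * c + s\<^sup>2 * (\<bar>b\<bar> + 1)\<close>.
    Replacing \<open>b\<close> by the larger and positive \<open>\<bar>b\<bar> + 1\<close> spares a
    case distinction on its sign.\<close>
  define s where "s = - c / (\<bar>b\<bar> + 1)"
  have b: "\<bar>b\<bar> + 1 > 0" by simp
  have "2 * s * c + s\<^sup>2 * b \<le> 2 * s * c + s\<^sup>2 * (\<bar>b\<bar> + 1)"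
    by (intro add_left_mono mult_left_mono) auto
  also have "\<dots> = s * (2 * c + s * (\<bar>b\<bar> + 1))" by (simp add: power2_eq_square algebra_simps)
  also have "s * (\<bar>b\<bar> + 1) = - c" using b by (simp add: s_def)
  also have "s * (2 * c + - c) = - (c\<^sup>2 / (\<bar>b\<bar> + 1))" by (simp add: s_def power2_eq_square)
  also have "\<dots> < 0" using b c by simp
  finally show False using assms[of s] by simp
qed

section \<open>The space of square-integrable functions\<close>

text \<open>On functions this is only a seminorm, so conclusions drawn from the value 0 hold almost
  everywhere (\<open>l2n_eq_0_AE\<close>). Outside L2 the integral defaults to 0, which is why most
  estimates carry \<open>L2\<close> hypotheses.\<close>

definition l2n :: "(real^'d) set \<Rightarrow> (real^'d::finite \<Rightarrow> 'b::euclidean_space) \<Rightarrow> real" where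
  "l2n \<Omega> f = sqrt (l2ip \<Omega> f f)"

lemma L2_measurable: "L2 \<Omega> f \<Longrightarrow> f \<in> borel_measurable (lebesgue_on \<Omega>)"
  by (simp add: L2_def)

lemma L2_integrable_inner:
  assumes "L2 \<Omega> f" "L2 \<Omega> g"
  shows "integrable (lebesgue_on \<Omega>) (\<lambda>x. inner (f x) (g x))"
proof (rule Bochner_Integration.integrable_bound)
  show "integrable (lebesgue_on \<Omega>) (\<lambda>x. (norm (f x))\<^sup>2 + (norm (g x))\<^sup>2)"
    using assms by (auto simp: L2_def)
  show "(\<lambda>x. inner (f x) (g x)) \<in> borel_measurable (lebesgue_on \<Omega>)"
    using assms by (auto simp: L2_def)
  have "norm (inner (f x) (g x)) \<le> (norm (f x))\<^sup>2 + (norm (g x))\<^sup>2" for x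
  proof -
    have "0 \<le> norm (f x) * norm (g x)" by simp
    then have "norm (f x) * norm (g x) \<le> (norm (f x))\<^sup>2 + (norm (g x))\<^sup>2"
      using sum_squares_bound[of "norm (f x)" "norm (g x)"] by argo
    then show ?thesis using Cauchy_Schwarz_ineq2[of "f x" "g x"] by simp
  qed
  then show "AE x in lebesgue_on \<Omega>. norm (inner (f x) (g x)) \<le> norm ((norm (f x))\<^sup>2 + (norm (g x))\<^sup>2)"
    by (auto intro!: AE_I2 order_trans[OF _ abs_ge_self])
qed

text \<open>The codomains of \<open>f\<close> and \<open>g\<close> may differ, so that components,
  scalar products with a bounded field and images under bounded matrix fields are all
  covered.\<close>

lemma L2_dominated:
  fixes f :: "real^'d::finite \<Rightarrow> 'b::euclidean_space" and g :: "real^'d \<Rightarrow> 'c::euclidean_space"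
  assumes "L2 \<Omega> f" "g \<in> borel_measurable (lebesgue_on \<Omega>)"
    "AE x in lebesgue_on \<Omega>. norm (g x) \<le> C * norm (f x)"
  shows "L2 \<Omega> g"
  unfolding L2_def
proof
  show "integrable (lebesgue_on \<Omega>) (\<lambda>x. (norm (g x))\<^sup>2)"
  proof (rule Bochner_Integration.integrable_bound)
    show "integrable (lebesgue_on \<Omega>) (\<lambda>x. C\<^sup>2 * (norm (f x))\<^sup>2)"
      using assms by (auto simp: L2_def)
    show "AE x in lebesgue_on \<Omega>. norm ((norm (g x))\<^sup>2) \<le> norm (C\<^sup>2 * (norm (f x))\<^sup>2)"
      using assms(3)
    proof eventually_elim
      case (elim x)
      then have "(norm (g x))\<^sup>2 \<le> (C * norm (f x))\<^sup>2" by (intro power_mono) auto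
      then show ?case by (simp add: power_mult_distrib)
    qed
  qed (use assms in measurable)
qed (fact assms)

lemma L2_zero [simp]: "L2 \<Omega> (\<lambda>x. 0)"
  by (simp add: L2_def)

lemma L2_scaleR: "L2 \<Omega> f \<Longrightarrow> L2 \<Omega> (\<lambda>x. c *\<^sub>R f x)"
  by (rule L2_dominated[where C = "\<bar>c\<bar>"]) (auto simp: L2_def)

lemma L2_mult: "L2 \<Omega> f \<Longrightarrow> L2 \<Omega> (\<lambda>x. c * f x :: real)"
  using L2_scaleR[of \<Omega> f c] by simp

lemma L2_add:
  assumes "L2 \<Omega> f" "L2 \<Omega> g"
  shows "L2 \<Omega> (\<lambda>x. f x + g x)"
  unfolding L2_def
proof
  have "(norm (f x + g x))\<^sup>2 = (norm (f x))\<^sup>2 + 2 * inner (f x) (g x) + (norm (g x))\<^sup>2" for x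
    by (simp add: power2_norm_eq_inner inner_add inner_commute)
  then show "integrable (lebesgue_on \<Omega>) (\<lambda>x. (norm (f x + g x))\<^sup>2)"
    using assms L2_integrable_inner[OF assms] by (auto simp: L2_def)
qed (use assms in \<open>auto simp: L2_def\<close>)

lemma L2_diff:
  assumes "L2 \<Omega> f" "L2 \<Omega> g"
  shows "L2 \<Omega> (\<lambda>x. f x - g x)"
  using L2_add[OF assms(1) L2_scaleR[OF assms(2), of "-1"]] by simp

lemma L2_Pair:
  assumes "L2 \<Omega> f" "L2 \<Omega> g"
  shows "L2 \<Omega> (\<lambda>x. (f x, g x))"
  using assms by (auto simp: L2_def norm_Pair)

lemma L2_fst: "L2 \<Omega> f \<Longrightarrow> L2 \<Omega> (\<lambda>x. fst (f x))"
  by (rule L2_dominated[where C = 1])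
    (auto simp: L2_def intro!: AE_I2 norm_fst_le[of "fst (f x)" "snd (f x)" for x, simplified] intro: measurable_compose[OF _ borel_measurable_continuous_onI[OF continuous_on_fst[OF continuous_on_id]], simplified])

lemma L2_snd: "L2 \<Omega> f \<Longrightarrow> L2 \<Omega> (\<lambda>x. snd (f x))"
  by (rule L2_dominated[where C = 1])
    (auto simp: L2_def intro!: AE_I2 norm_snd_le[of "snd (f x)" "fst (f x)" for x, simplified] intro: measurable_compose[OF _ borel_measurable_continuous_onI[OF continuous_on_snd[OF continuous_on_id]], simplified])

lemma l2ip_commute: "l2ip \<Omega> f g = l2ip \<Omega> g f"
  by (simp add: l2ip_def inner_commute)

lemma l2ip_add_left:
  "L2 \<Omega> f \<Longrightarrow> L2 \<Omega> g \<Longrightarrow> L2 \<Omega> h \<Longrightarrow> l2ip \<Omega> (\<lambda>x. f x + g x) h = l2ip \<Omega> f h + l2ip \<Omega> g h"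
  by (simp add: l2ip_def inner_add_left L2_integrable_inner)

lemma l2ip_diff_left:
  "L2 \<Omega> f \<Longrightarrow> L2 \<Omega> g \<Longrightarrow> L2 \<Omega> h \<Longrightarrow> l2ip \<Omega> (\<lambda>x. f x - g x) h = l2ip \<Omega> f h - l2ip \<Omega> g h"
  by (simp add: l2ip_def inner_diff_left L2_integrable_inner)

lemma l2ip_add_right:
  "L2 \<Omega> f \<Longrightarrow> L2 \<Omega> g \<Longrightarrow> L2 \<Omega> h \<Longrightarrow> l2ip \<Omega> h (\<lambda>x. f x + g x) = l2ip \<Omega> h f + l2ip \<Omega> h g"
  by (simp add: l2ip_def inner_add_right L2_integrable_inner)

lemma l2ip_diff_right:
  "L2 \<Omega> f \<Longrightarrow> L2 \<Omega> g \<Longrightarrow> L2 \<Omega> h \<Longrightarrow> l2ip \<Omega> h (\<lambda>x. f x - g x) = l2ip \<Omega> h f - l2ip \<Omega> h g"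
  by (simp add: l2ip_def inner_diff_right L2_integrable_inner)

lemma l2ip_scaleR_left: "l2ip \<Omega> (\<lambda>x. c *\<^sub>R f x) h = c * l2ip \<Omega> f h"
  by (simp add: l2ip_def)

lemma l2ip_scaleR_right: "l2ip \<Omega> h (\<lambda>x. c *\<^sub>R f x) = c * l2ip \<Omega> h f"
  by (simp add: l2ip_def)

lemma l2ip_cong_AE:
  assumes "L2 \<Omega> f" "L2 \<Omega> f'" "L2 \<Omega> g" "L2 \<Omega> g'"
    and "AE x in lebesgue_on \<Omega>. f x = f' x" "AE x in lebesgue_on \<Omega>. g x = g' x"
  shows "l2ip \<Omega> f g = l2ip \<Omega> f' g'"
  unfolding l2ip_def
proof (rule integral_cong_AE)
  show "AE x in lebesgue_on \<Omega>. inner (f x) (g x) = inner (f' x) (g' x)"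
    using assms(5,6) by eventually_elim auto
qed (use assms L2_integrable_inner in blast)+

lemma l2ip_self: "l2ip \<Omega> f f = (LINT x|lebesgue_on \<Omega>. (norm (f x))\<^sup>2)"
  by (simp add: l2ip_def power2_norm_eq_inner)

lemma l2ip_nonneg [simp]: "0 \<le> l2ip \<Omega> f f"
  unfolding l2ip_self by simp

lemma l2n_nonneg [simp]: "0 \<le> l2n \<Omega> f"
  by (simp add: l2n_def)

lemma l2n_square: "(l2n \<Omega> f)\<^sup>2 = l2ip \<Omega> f f"
  by (simp add: l2n_def)

lemma l2n_cong_AE:
  assumes "L2 \<Omega> f" "L2 \<Omega> g" "AE x in lebesgue_on \<Omega>. f x = g x"
  shows "l2n \<Omega> f = l2n \<Omega> g"
  using l2ip_cong_AE[OF assms(1,2,1,2,3,3)] by (simp add: l2n_def)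

lemma l2n_eq_0_AE:
  assumes "L2 \<Omega> f" "l2n \<Omega> f = 0"
  shows "AE x in lebesgue_on \<Omega>. f x = 0"
proof -
  have "(LINT x|lebesgue_on \<Omega>. (norm (f x))\<^sup>2) = 0"
    using assms(2) by (simp add: l2n_def l2ip_self)
  then have "AE x in lebesgue_on \<Omega>. (norm (f x))\<^sup>2 = 0"
    using assms(1) by (subst (asm) integral_nonneg_eq_0_iff_AE) (auto simp: L2_def)
  then show ?thesis by eventually_elim simp
qed

lemma l2n_scaleR: "l2n \<Omega> (\<lambda>x. c *\<^sub>R f x) = \<bar>c\<bar> * l2n \<Omega> f"
  by (simp add: l2n_def l2ip_scaleR_left l2ip_scaleR_right real_sqrt_mult mult.assoc[symmetric])

lemma l2n_minus_commute: "l2n \<Omega> (\<lambda>x. f x - g x) = l2n \<Omega> (\<lambda>x. g x - f x)"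
  using l2n_scaleR[of \<Omega> "-1" "\<lambda>x. f x - g x"] by simp

lemma l2n_add_square:
  assumes "L2 \<Omega> f" "L2 \<Omega> g"
  shows "(l2n \<Omega> (\<lambda>x. f x + g x))\<^sup>2 = (l2n \<Omega> f)\<^sup>2 + 2 * l2ip \<Omega> f g + (l2n \<Omega> g)\<^sup>2"
  using assms
  by (simp add: l2n_square l2ip_add_left l2ip_add_right L2_add l2ip_commute[of \<Omega> g f])

text \<open>The square of the norm of f + s g is a nonnegative quadratic in s, evaluated at its
  minimiser s = -(f, g) / (g, g). If the seminorm of g vanishes, g is zero almost everywhere and so
  is the integrand.\<close>

lemma l2ip_Cauchy_Schwarz:
  assumes "L2 \<Omega> f" "L2 \<Omega> g"
  shows "\<bar>l2ip \<Omega> f g\<bar> \<le> l2n \<Omega> f * l2n \<Omega> g"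
proof -
  let ?a = "l2n \<Omega> f" and ?b = "l2n \<Omega> g" and ?p = "l2ip \<Omega> f g"
  have nn: "0 \<le> ?a\<^sup>2 + 2 * s * ?p + s\<^sup>2 * ?b\<^sup>2" for s
  proof -
    have "0 \<le> (l2n \<Omega> (\<lambda>x. f x + s *\<^sub>R g x))\<^sup>2" by simp
    also have "\<dots> = ?a\<^sup>2 + 2 * s * ?p + s\<^sup>2 * ?b\<^sup>2"
      by (simp add: l2n_add_square assms L2_scaleR l2ip_scaleR_right l2n_scaleR power_mult_distrib)
    finally show ?thesis .
  qed
  show ?thesis
  proof (cases "?b = 0")
    case True
    have "l2ip \<Omega> f g = l2ip \<Omega> f (\<lambda>x. 0)"
      using l2n_eq_0_AE[OF assms(2) True] by (intro l2ip_cong_AE assms) auto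
    then show ?thesis by (simp add: l2ip_def)
  next
    case False
    have "0 \<le> ?a\<^sup>2 - ?p\<^sup>2 / ?b\<^sup>2"
      using nn[of "- ?p / ?b\<^sup>2"] False by (simp add: field_simps power2_eq_square)
    then have "?p\<^sup>2 \<le> (?a * ?b)\<^sup>2"
      using False by (simp add: field_simps)
    then show ?thesis
      by (metis abs_of_nonneg abs_le_square_iff l2n_nonneg mult_nonneg_nonneg)
  qed
qed

lemma l2n_triangle:
  assumes "L2 \<Omega> f" "L2 \<Omega> g"
  shows "l2n \<Omega> (\<lambda>x. f x + g x) \<le> l2n \<Omega> f + l2n \<Omega> g"
proof (rule power2_le_imp_le)
  show "(l2n \<Omega> (\<lambda>x. f x + g x))\<^sup>2 \<le> (l2n \<Omega> f + l2n \<Omega> g)\<^sup>2"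
    using l2ip_Cauchy_Schwarz[OF assms] by (simp add: l2n_add_square[OF assms] power2_sum)
qed simp

lemma l2n_triangle_diff:
  assumes "L2 \<Omega> f" "L2 \<Omega> g"
  shows "l2n \<Omega> (\<lambda>x. f x - g x) \<le> l2n \<Omega> f + l2n \<Omega> g"
  using l2n_triangle[OF assms(1) L2_scaleR[OF assms(2), of "-1"]] l2n_scaleR[of \<Omega> "-1" g] by simp

lemma l2n_triangle_via:
  assumes "L2 \<Omega> f" "L2 \<Omega> g" "L2 \<Omega> h"
  shows "l2n \<Omega> (\<lambda>x. f x - h x) \<le> l2n \<Omega> (\<lambda>x. f x - g x) + l2n \<Omega> (\<lambda>x. g x - h x)"
  using l2n_triangle[OF L2_diff[OF assms(1,2)] L2_diff[OF assms(2,3)]] by simp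

lemma l2n_dominated:
  fixes f :: "real^'d::finite \<Rightarrow> 'b::euclidean_space" and g :: "real^'d \<Rightarrow> 'c::euclidean_space"
  assumes "L2 \<Omega> f" "L2 \<Omega> g" "0 \<le> C" "AE x in lebesgue_on \<Omega>. norm (g x) \<le> C * norm (f x)"
  shows "l2n \<Omega> g \<le> C * l2n \<Omega> f"
proof (rule power2_le_imp_le)
  have "l2ip \<Omega> g g \<le> (LINT x|lebesgue_on \<Omega>. C\<^sup>2 * (norm (f x))\<^sup>2)"
    unfolding l2ip_self
  proof (rule integral_mono_AE)
    show "AE x in lebesgue_on \<Omega>. (norm (g x))\<^sup>2 \<le> C\<^sup>2 * (norm (f x))\<^sup>2"
      using assms(4) by eventually_elim (metis norm_ge_zero power_mono power_mult_distrib)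
  qed (use assms in \<open>auto simp: L2_def\<close>)
  then show "(l2n \<Omega> g)\<^sup>2 \<le> (C * l2n \<Omega> f)\<^sup>2"
    by (simp add: power_mult_distrib l2n_square l2ip_self)
qed (use assms in simp)

text \<open>The difference of the inner products splits into three terms, each containing at least
  one of the increments f n - f' and g n - g'; Cauchy-Schwarz sends each of them to 0.\<close>

lemma l2ip_tendsto:
  assumes "\<And>n. L2 \<Omega> (f n)" "L2 \<Omega> f'" "\<And>n. L2 \<Omega> (g n)" "L2 \<Omega> g'"
    and f: "(\<lambda>n. l2n \<Omega> (\<lambda>x. f n x - f' x)) \<longlonglongrightarrow> 0"
    and g: "(\<lambda>n. l2n \<Omega> (\<lambda>x. g n x - g' x)) \<longlonglongrightarrow> 0"
  shows "(\<lambda>n. l2ip \<Omega> (f n) (g n)) \<longlonglongrightarrow> l2ip \<Omega> f' g'"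
proof -
  let ?df = "\<lambda>n x. f n x - f' x" and ?dg = "\<lambda>n x. g n x - g' x"
  have eq: "l2ip \<Omega> (f n) (g n) = l2ip \<Omega> (?df n) (?dg n) + l2ip \<Omega> (?df n) g'
      + l2ip \<Omega> f' (?dg n) + l2ip \<Omega> f' g'" for n
    using assms by (simp add: l2ip_diff_left l2ip_diff_right L2_diff)
  have 1: "(\<lambda>n. l2ip \<Omega> (?df n) (?dg n)) \<longlonglongrightarrow> 0"
  proof (rule Lim_null_comparison)
    show "\<forall>\<^sub>F n in sequentially. norm (l2ip \<Omega> (?df n) (?dg n)) \<le> l2n \<Omega> (?df n) * l2n \<Omega> (?dg n)"
      using assms by (auto intro!: always_eventually l2ip_Cauchy_Schwarz L2_diff)
    show "(\<lambda>n. l2n \<Omega> (?df n) * l2n \<Omega> (?dg n)) \<longlonglongrightarrow> 0"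
      using tendsto_mult[OF f g] by simp
  qed
  have 2: "(\<lambda>n. l2ip \<Omega> (?df n) g') \<longlonglongrightarrow> 0"
  proof (rule Lim_null_comparison)
    show "\<forall>\<^sub>F n in sequentially. norm (l2ip \<Omega> (?df n) g') \<le> l2n \<Omega> (?df n) * l2n \<Omega> g'"
      using assms by (auto intro!: always_eventually l2ip_Cauchy_Schwarz L2_diff)
    show "(\<lambda>n. l2n \<Omega> (?df n) * l2n \<Omega> g') \<longlonglongrightarrow> 0"
      using tendsto_mult[OF f tendsto_const] by simp
  qed
  have 3: "(\<lambda>n. l2ip \<Omega> f' (?dg n)) \<longlonglongrightarrow> 0"
  proof (rule Lim_null_comparison)
    show "\<forall>\<^sub>F n in sequentially. norm (l2ip \<Omega> f' (?dg n)) \<le> l2n \<Omega> f' * l2n \<Omega> (?dg n)"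
      using assms by (auto intro!: always_eventually l2ip_Cauchy_Schwarz L2_diff)
    show "(\<lambda>n. l2n \<Omega> f' * l2n \<Omega> (?dg n)) \<longlonglongrightarrow> 0"
      using tendsto_mult[OF tendsto_const g] by simp
  qed
  show ?thesis
    unfolding eq using tendsto_add[OF tendsto_add[OF tendsto_add[OF 1 2] 3] tendsto_const] by simp
qed

section \<open>Completeness and orthogonal projection\<close>

definition L2_Cauchy :: "(real^'d) set \<Rightarrow> (nat \<Rightarrow> real^'d::finite \<Rightarrow> 'b::euclidean_space) \<Rightarrow> bool" where
  "L2_Cauchy \<Omega> f \<longleftrightarrow> (\<forall>e>0. \<exists>N. \<forall>m\<ge>N. \<forall>n\<ge>N. l2n \<Omega> (\<lambda>x. f m x - f n x) < e)"

lemma l2n_nn_integral: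
  assumes "L2 \<Omega> f"
  shows "(\<integral>\<^sup>+x. ennreal ((norm (f x))\<^sup>2) \<partial>lebesgue_on \<Omega>) = ennreal ((l2n \<Omega> f)\<^sup>2)"
  using assms by (subst nn_integral_eq_integral) (auto simp: L2_def l2n_square l2ip_self)

text \<open>Riesz-Fischer: a rapidly converging subsequence \<open>h\<close> converges almost
  everywhere, and Fatou's lemma upgrades this to convergence of the whole sequence in L2.\<close>

lemma L2_complete:
  fixes f :: "nat \<Rightarrow> real^'d::finite \<Rightarrow> 'b::euclidean_space"
  assumes L2f: "\<And>n. L2 \<Omega> (f n)" and Cau: "L2_Cauchy \<Omega> f"
  shows "\<exists>g. L2 \<Omega> g \<and> (\<lambda>n. l2n \<Omega> (\<lambda>x. f n x - g x)) \<longlonglongrightarrow> 0"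
proof -
  let ?M = "lebesgue_on \<Omega>"
  note [measurable] = L2_measurable[OF L2f]
  have "\<exists>N. \<forall>m\<ge>N. \<forall>n\<ge>N. l2n \<Omega> (\<lambda>x. f m x - f n x) < (1/2)^j" for j :: nat
    using Cau by (auto simp: L2_Cauchy_def)
  then obtain N where N: "\<And>j m n. m \<ge> N j \<Longrightarrow> n \<ge> N j \<Longrightarrow> l2n \<Omega> (\<lambda>x. f m x - f n x) < (1/2)^j"
    by metis
  \<comment> \<open>The maximum puts both \<open>r j\<close> and \<open>r (Suc j)\<close> beyond
    \<open>N j\<close>. The summand \<open>j\<close> gives \<open>r j \<ge> j\<close>, so that every
    threshold is passed eventually.\<close>
  define r where "r j = Max (N ` {..Suc j}) + j" for j
  have rN: "r j \<ge> N j" "r (Suc j) \<ge> N j" "r j \<ge> j" for j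
    by (auto simp: r_def intro!: trans_le_add1 Max_ge simp del: add_Suc_right)
  define h where "h j = f (r j)" for j
  have [measurable]: "h j \<in> borel_measurable ?M" for j by (simp add: h_def)
  define d where "d j x = (norm (h (Suc j) x - h j x))\<^sup>2" for j x
  have d0: "0 \<le> d j x" for j x by (simp add: d_def)
  have [measurable]: "d j \<in> borel_measurable ?M" for j unfolding d_def by measurable
  \<comment> \<open>The increments have squared norm at most 4^(-j), so the weight 2^j still leaves
    a summable bound. The weight pays for the passage from squares to norms below.\<close>
  have dint: "(\<integral>\<^sup>+x. ennreal (2^j * d j x) \<partial>?M) \<le> ennreal ((1/2)^j)" for j
  proof -
    have "(\<integral>\<^sup>+x. ennreal (2^j * d j x) \<partial>?M) = ennreal (2^j) * (\<integral>\<^sup>+x. ennreal (d j x) \<partial>?M)"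
      by (simp add: ennreal_mult' d0 nn_integral_cmult)
    also have "(\<integral>\<^sup>+x. ennreal (d j x) \<partial>?M) = ennreal ((l2n \<Omega> (\<lambda>x. h (Suc j) x - h j x))\<^sup>2)"
      unfolding d_def h_def by (intro l2n_nn_integral L2_diff L2f)
    also have "ennreal (2^j) * \<dots> \<le> ennreal (2^j) * ennreal (((1/2)^j)\<^sup>2)"
      using N[OF rN(2) rN(1), of j] by (intro mult_left_mono ennreal_leI power_mono) (auto simp: h_def)
    also have "\<dots> = ennreal ((1/2)^j)"
      by (subst ennreal_mult'[symmetric]) (auto simp: power2_eq_square power_divide)
    finally show ?thesis .
  qed
  have "(\<integral>\<^sup>+x. (\<Sum>j. ennreal (2^j * d j x)) \<partial>?M) = (\<Sum>j. \<integral>\<^sup>+x. ennreal (2^j * d j x) \<partial>?M)"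
    by (rule nn_integral_suminf) measurable
  also have "\<dots> \<le> (\<Sum>j. ennreal ((1/2)^j))"
    by (rule suminf_le) (auto simp: dint)
  also have "\<dots> = ennreal (\<Sum>j. (1/2)^j)"
    by (rule suminf_ennreal2) (auto simp: summable_geometric)
  also have "\<dots> < \<infinity>" by simp
  finally have "AE x in ?M. (\<Sum>j. ennreal (2^j * d j x)) \<noteq> \<infinity>"
    by (intro nn_integral_noteq_infinite) auto
  then have conv: "AE x in ?M. convergent (\<lambda>j. h j x)"
  proof eventually_elim
    case (elim x)
    then have s: "summable (\<lambda>j. 2^j * d j x)"
      by (intro summable_suminf_not_top) (auto simp: d0)
    \<comment> \<open>Either the increment is at most 2^(-j), or 2^j times it is at least 1 and it
      is bounded by 2^j times its square. Both majorants are summable.\<close>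
    have "norm (h (Suc j) x - h j x) \<le> 2^j * d j x + (1/2)^j" for j
    proof (cases "norm (h (Suc j) x - h j x) \<le> (1/2)^j")
      case True
      then show ?thesis using d0[of j x] by (simp add: add_increasing)
    next
      case False
      let ?a = "norm (h (Suc j) x - h j x)"
      have "1 \<le> 2^j * ?a" using False by (simp add: field_simps power_divide)
      then have "?a * 1 \<le> ?a * (2^j * ?a)" by (intro mult_left_mono) auto
      also have "\<dots> = 2^j * d j x" by (simp add: d_def power2_eq_square mult_ac)
      finally show ?thesis by (simp add: add_increasing2)
    qed
    then have "summable (\<lambda>j. h (Suc j) x - h j x)"
      by (intro summable_norm_cancel[OF summable_comparison_test[OF _ summable_add[OF s summable_geometric]]])
        auto
    then have "convergent (\<lambda>n. h 0 x + (\<Sum>j<n. h (Suc j) x - h j x))"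
      by (intro convergent_add convergent_const) (simp add: summable_iff_convergent)
    moreover have "(\<lambda>n. h 0 x + (\<Sum>j<n. h (Suc j) x - h j x)) = (\<lambda>n. h n x)"
      by (simp add: fun_eq_iff sum_lessThan_telescope[of "\<lambda>j. h j x"])
    ultimately show ?case by (simp only:)
  qed
  define g where "g x = lim (\<lambda>j. h j x)" for x
  have gm [measurable]: "g \<in> borel_measurable ?M"
    unfolding g_def by measurable
  have lim: "AE x in ?M. (\<lambda>j. h j x) \<longlonglongrightarrow> g x"
    using conv by eventually_elim (simp add: g_def convergent_LIMSEQ_iff)
  \<comment> \<open>The index \<open>m\<close> is kept fixed while the subsequence runs, so the
    bound holds for every \<open>m \<ge> N j\<close> and not only along the subsequence.\<close>
  have fatou: "(\<integral>\<^sup>+x. ennreal ((norm (f m x - g x))\<^sup>2) \<partial>?M) \<le> ennreal (((1/2)^j)\<^sup>2)" if "m \<ge> N j" for m j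
  proof -
    have "(\<integral>\<^sup>+x. ennreal ((norm (f m x - g x))\<^sup>2) \<partial>?M)
        = (\<integral>\<^sup>+x. liminf (\<lambda>i. ennreal ((norm (f m x - h i x))\<^sup>2)) \<partial>?M)"
    proof (rule nn_integral_cong_AE)
      show "AE x in ?M. ennreal ((norm (f m x - g x))\<^sup>2) = liminf (\<lambda>i. ennreal ((norm (f m x - h i x))\<^sup>2))"
        using lim
      proof eventually_elim
        case (elim x)
        then have "(\<lambda>i. ennreal ((norm (f m x - h i x))\<^sup>2)) \<longlonglongrightarrow> ennreal ((norm (f m x - g x))\<^sup>2)"
          by (intro tendsto_intros)
        then show ?case using lim_imp_Liminf[OF sequentially_bot] by metis
      qed
    qed
    also have "\<dots> \<le> liminf (\<lambda>i. \<integral>\<^sup>+x. ennreal ((norm (f m x - h i x))\<^sup>2) \<partial>?M)"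
      by (rule nn_integral_liminf) measurable
    also have "\<dots> \<le> ennreal (((1/2)^j)\<^sup>2)"
    proof (rule Liminf_le[OF sequentially_bot])
      show "\<forall>\<^sub>F i in sequentially. (\<integral>\<^sup>+x. ennreal ((norm (f m x - h i x))\<^sup>2) \<partial>?M) \<le> ennreal (((1/2)^j)\<^sup>2)"
        using eventually_ge_at_top[of "N j"]
      proof eventually_elim
        case (elim i)
        then have "l2n \<Omega> (\<lambda>x. f m x - h i x) < (1/2)^j"
          unfolding h_def using rN(3)[of i] that by (intro N) auto
        then show ?case
          unfolding h_def by (subst l2n_nn_integral) (auto simp: h_def L2_diff L2f intro!: ennreal_leI power_mono)
      qed
    qed
    finally show ?thesis .
  qed
  have L2d: "L2 \<Omega> (\<lambda>x. f m x - g x)" if "m \<ge> N j" for m j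
    unfolding L2_def
  proof
    show "integrable ?M (\<lambda>x. (norm (f m x - g x))\<^sup>2)"
      using fatou[OF that] by (intro integrableI_bounded) (auto simp: less_top top_unique intro: order.strict_trans1)
  qed measurable
  have "L2 \<Omega> g"
    using L2_diff[OF L2f[of "N 0"] L2d[OF order_refl, of 0]] by simp
  moreover have "(\<lambda>n. l2n \<Omega> (\<lambda>x. f n x - g x)) \<longlonglongrightarrow> 0"
  proof (rule LIMSEQ_I)
    fix e :: real assume "e > 0"
    then obtain j where j: "(1/2)^j < e" using real_arch_pow_inv[of e "1/2"] by auto
    have "l2n \<Omega> (\<lambda>x. f n x - g x) \<le> (1/2)^j" if "n \<ge> N j" for n
      using fatou[OF that] by (subst (asm) l2n_nn_integral[OF L2d[OF that]])
        (auto intro: power2_le_imp_le simp: ennreal_le_iff)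
    then show "\<exists>n0. \<forall>n\<ge>n0. norm (l2n \<Omega> (\<lambda>x. f n x - g x) - 0) < e"
      using j by (intro exI[of _ "N j"]) (fastforce intro: order.strict_trans1)
  qed
  ultimately show ?thesis by blast
qed

lemma L2_Cauchy_if_convergent:
  assumes "\<And>n. L2 \<Omega> (f n)" "L2 \<Omega> g" "(\<lambda>n. l2n \<Omega> (\<lambda>x. f n x - g x)) \<longlonglongrightarrow> 0"
  shows "L2_Cauchy \<Omega> f"
  unfolding L2_Cauchy_def
proof (intro allI impI)
  fix e :: real assume "e > 0"
  then obtain N where N: "\<And>n. n \<ge> N \<Longrightarrow> l2n \<Omega> (\<lambda>x. f n x - g x) < e / 2"
    using LIMSEQ_D[OF assms(3), of "e/2"] by auto
  have "l2n \<Omega> (\<lambda>x. f m x - f n x) < e" if "m \<ge> N" "n \<ge> N" for m n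
    using l2n_triangle_via[of \<Omega> "f m" g "f n"] assms N[OF that(1)] N[OF that(2)]
      l2n_minus_commute[of \<Omega> g "f n"] by simp
  then show "\<exists>N. \<forall>m\<ge>N. \<forall>n\<ge>N. l2n \<Omega> (\<lambda>x. f m x - f n x) < e" by blast
qed

text \<open>A minimising sequence for the distance is Cauchy by the parallelogram law.\<close>

lemma L2_projection:
  fixes W :: "(real^'d::finite \<Rightarrow> 'b::euclidean_space) set"
  assumes L2W: "\<And>f. f \<in> W \<Longrightarrow> L2 \<Omega> f" and ne: "W \<noteq> {}"
    and lin: "\<And>f g c. f \<in> W \<Longrightarrow> g \<in> W \<Longrightarrow> (\<lambda>x. f x + c *\<^sub>R g x) \<in> W"
    and closed: "\<And>fs f. (\<And>n. fs n \<in> W) \<Longrightarrow> L2 \<Omega> f \<Longrightarrow> (\<lambda>n. l2n \<Omega> (\<lambda>x. fs n x - f x)) \<longlonglongrightarrow> 0 \<Longrightarrow> f \<in> W"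
    and G: "L2 \<Omega> G"
  shows "\<exists>p\<in>W. \<forall>w\<in>W. l2ip \<Omega> p w = l2ip \<Omega> G w"
proof -
  define J where "J f = (l2n \<Omega> (\<lambda>x. f x - G x))\<^sup>2" for f
  define m where "m = (INF f\<in>W. J f)"
  have bdd: "bdd_below (J ` W)" by (rule bdd_belowI2[of _ 0]) (simp add: J_def)
  have mJ: "m \<le> J f" if "f \<in> W" for f
    unfolding m_def by (rule cINF_lower[OF bdd that])
  have "\<exists>f\<in>W. J f < m + inverse (real (Suc n))" for n
    using cINF_less_iff[OF ne bdd, of "m + inverse (real (Suc n))"] by (simp add: m_def)
  then obtain fs where fsW: "\<And>n. fs n \<in> W" and fsJ: "\<And>n. J (fs n) < m + inverse (real (Suc n))"
    by metis
  have par: "(l2n \<Omega> (\<lambda>x. f x - g x))\<^sup>2 \<le> 2 * J f + 2 * J g - 4 * m" if "f \<in> W" "g \<in> W" for f g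
  proof -
    let ?a = "\<lambda>x. f x - G x" and ?b = "\<lambda>x. g x - G x"
    have ab: "L2 \<Omega> ?a" "L2 \<Omega> ?b" using that by (auto intro: L2_diff L2W G)
    have bneg: "L2 \<Omega> (\<lambda>x. (-1) *\<^sub>R ?b x)" by (rule L2_scaleR[OF ab(2)])
    \<comment> \<open>The midpoint of f and g in the only shape that \<open>lin\<close> provides, as
      f - (f - g) / 2; the summand with coefficient 0 brings f itself into that shape.\<close>
    have "(\<lambda>x. (f x + 0 *\<^sub>R f x) + (-1/2) *\<^sub>R (f x + (-1) *\<^sub>R g x)) \<in> W"
      using that by (intro lin)
    moreover have "(\<lambda>x. (f x + 0 *\<^sub>R f x) + (-1/2) *\<^sub>R (f x + (-1) *\<^sub>R g x)) = (\<lambda>x. (1/2) *\<^sub>R (f x + g x))"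
    proof
      fix x
      have "f x = (1/2) *\<^sub>R (f x + f x)" by (simp only: scaleR_half_double)
      then show "(f x + 0 *\<^sub>R f x) + (-1/2) *\<^sub>R (f x + (-1) *\<^sub>R g x) = (1/2) *\<^sub>R (f x + g x)"
        by (simp add: algebra_simps)
    qed
    ultimately have "m \<le> J (\<lambda>x. (1/2) *\<^sub>R (f x + g x))" using mJ by simp
    moreover have "(\<lambda>x. (1/2) *\<^sub>R (f x + g x) - G x) = (\<lambda>x. (1/2) *\<^sub>R (?a x + ?b x))"
    proof
      fix x
      have "G x = (1/2) *\<^sub>R (G x + G x)" by (simp add: scaleR_half_double)
      then show "(1/2) *\<^sub>R (f x + g x) - G x = (1/2) *\<^sub>R (?a x + ?b x)"
        by (simp add: algebra_simps)
    qed
    ultimately have 1: "4 * m \<le> (l2n \<Omega> (\<lambda>x. ?a x + ?b x))\<^sup>2"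
      unfolding J_def by (simp only: l2n_scaleR) (simp add: power_mult_distrib power_divide)
    have "(l2n \<Omega> (\<lambda>x. ?a x + (-1) *\<^sub>R ?b x))\<^sup>2 = (l2n \<Omega> ?a)\<^sup>2 - 2 * l2ip \<Omega> ?a ?b + (l2n \<Omega> ?b)\<^sup>2"
      by (subst l2n_add_square[OF ab(1) bneg], subst l2n_scaleR, subst l2ip_scaleR_right) simp
    moreover have "(\<lambda>x. ?a x + (-1) *\<^sub>R ?b x) = (\<lambda>x. f x - g x)" by auto
    ultimately show ?thesis
      using 1 l2n_add_square[OF ab] by (simp add: J_def)
  qed
  have Cau: "L2_Cauchy \<Omega> fs"
    unfolding L2_Cauchy_def
  proof (intro allI impI)
    fix e :: real assume "e > 0"
    \<comment> \<open>If both values of \<open>J\<close> are below m + d, then \<open>par\<close>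
      bounds the squared distance by 4 d; hence the quarter.\<close>
    then obtain N where N: "inverse (real (Suc N)) < e\<^sup>2 / 4"
      using reals_Archimedean[of "e\<^sup>2/4"] by auto
    have "l2n \<Omega> (\<lambda>x. fs i x - fs j x) < e" if "i \<ge> N" "j \<ge> N" for i j
    proof (rule power2_less_imp_less)
      have "inverse (real (Suc i)) \<le> inverse (real (Suc N))" "inverse (real (Suc j)) \<le> inverse (real (Suc N))"
        using that by (auto intro!: le_imp_inverse_le)
      then show "(l2n \<Omega> (\<lambda>x. fs i x - fs j x))\<^sup>2 < e\<^sup>2"
        using par[OF fsW fsW, of i j] fsJ[of i] fsJ[of j] N by argo
    qed (use \<open>e > 0\<close> in simp)
    then show "\<exists>N. \<forall>m\<ge>N. \<forall>n\<ge>N. l2n \<Omega> (\<lambda>x. fs m x - fs n x) < e" by blast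
  qed
  obtain p where p: "L2 \<Omega> p" "(\<lambda>n. l2n \<Omega> (\<lambda>x. fs n x - p x)) \<longlonglongrightarrow> 0"
    using L2_complete[OF L2W[OF fsW] Cau] by auto
  have pW: "p \<in> W" by (rule closed[OF fsW p])
  \<comment> \<open>The infimum is attained: the distance from p to G is at most that from
    \<open>fs n\<close> to G plus a term that tends to 0.\<close>
  have "l2n \<Omega> (\<lambda>x. p x - G x) \<le> sqrt m"
  proof (rule LIMSEQ_le_const)
    show "(\<lambda>n. sqrt (m + inverse (real (Suc n))) + l2n \<Omega> (\<lambda>x. fs n x - p x)) \<longlonglongrightarrow> sqrt m"
      using tendsto_add[OF tendsto_real_sqrt[OF tendsto_add[OF tendsto_const[of m] LIMSEQ_inverse_real_of_nat]] p(2)]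
      by simp
    have "l2n \<Omega> (\<lambda>x. p x - G x) \<le> sqrt (m + inverse (real (Suc n))) + l2n \<Omega> (\<lambda>x. fs n x - p x)" for n
    proof -
      have "l2n \<Omega> (\<lambda>x. fs n x - G x) \<le> sqrt (m + inverse (real (Suc n)))"
        using fsJ[of n] unfolding J_def by (intro real_le_rsqrt) auto
      then show ?thesis
        using l2n_triangle_via[OF p(1) L2W[OF fsW[of n]] G] l2n_minus_commute[of \<Omega> p "fs n"] by simp
    qed
    then show "\<exists>N. \<forall>n\<ge>N. l2n \<Omega> (\<lambda>x. p x - G x)
        \<le> sqrt (m + inverse (real (Suc n))) + l2n \<Omega> (\<lambda>x. fs n x - p x)" by blast
  qed
  moreover have m0: "0 \<le> m" unfolding m_def by (intro cINF_greatest ne) (simp add: J_def)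
  ultimately have Jp: "J p \<le> m"
    unfolding J_def using power_mono[of "l2n \<Omega> (\<lambda>x. p x - G x)" "sqrt m" 2] by simp
  have "l2ip \<Omega> p w = l2ip \<Omega> G w" if w: "w \<in> W" for w
  proof -
    let ?r = "\<lambda>x. p x - G x"
    have r: "L2 \<Omega> ?r" by (rule L2_diff[OF p(1) G])
    \<comment> \<open>The variation p + s w stays in W, so minimality of p makes this quadratic in s
      nonnegative. Its linear coefficient is the orthogonality sought.\<close>
    have q: "0 \<le> 2 * s * l2ip \<Omega> ?r w + s\<^sup>2 * (l2n \<Omega> w)\<^sup>2" for s
    proof -
      have "m \<le> J (\<lambda>x. p x + s *\<^sub>R w x)" by (intro mJ lin pW w)
      also have "\<dots> = (l2n \<Omega> (\<lambda>x. ?r x + s *\<^sub>R w x))\<^sup>2" by (simp add: J_def algebra_simps)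
      also have "\<dots> = J p + 2 * s * l2ip \<Omega> ?r w + s\<^sup>2 * (l2n \<Omega> w)\<^sup>2"
        by (subst l2n_add_square[OF r L2_scaleR[OF L2W[OF w]]])
          (simp add: J_def l2ip_scaleR_right l2n_scaleR power_mult_distrib)
      finally show ?thesis using Jp by simp
    qed
    have "l2ip \<Omega> ?r w = 0"
      by (rule quadratic_nonneg_imp_linear_coeff_zero[OF q])
    then show ?thesis using l2ip_diff_left[OF p(1) G L2W[OF w]] by simp
  qed
  then show ?thesis using pW by blast
qed

section \<open>Square roots of positive definite matrices\<close>

lemma symmetric_matrix_inner:
  fixes M :: "real^'d^'d"
  assumes "transpose M = M"
  shows "inner (M *v x) y = inner x (M *v y)"
  by (metis assms dot_lmul_matrix transpose_matrix_vector)

lemma symmetric_matrixI: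
  fixes M :: "real^'d^'d"
  assumes "\<And>x y. inner (M *v x) y = inner x (M *v y)"
  shows "transpose M = M"
proof -
  have "M $ i $ j = M $ j $ i" for i j
    using assms[of "axis j 1" "axis i 1"]
    by (simp add: matrix_vector_mul_component inner_axis inner_axis' inner_commute)
  then show ?thesis by (simp add: transpose_def vec_eq_iff)
qed

text \<open>Minimise the Rayleigh quotient over the compact unit sphere. The smallest eigenvalue is
  all that is used of the spectral theorem in what follows.\<close>

lemma symmetric_matrix_min_eigenvector:
  fixes M :: "real^'d^'d"
  assumes sym: "transpose M = M"
  shows "\<exists>v c. norm v = 1 \<and> M *v v = c *\<^sub>R v \<and> (\<forall>x. c * inner x x \<le> inner x (M *v x))"
proof -
  let ?S = "sphere (0::real^'d) 1"
  \<comment> \<open>Any coordinate direction will do; \<open>undefined\<close> names some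
    index.\<close>
  have "axis undefined 1 \<in> ?S" by (simp add: norm_axis_1)
  then have "?S \<noteq> {}" by blast
  moreover have "continuous_on ?S (\<lambda>x. inner x (M *v x))"
    by (intro continuous_on_inner continuous_on_id linear_continuous_on matrix_vector_mul_bounded_linear)
  ultimately have "\<exists>v\<in>?S. \<forall>x\<in>?S. inner v (M *v v) \<le> inner x (M *v x)"
    by (intro continuous_attains_inf compact_sphere)
  then obtain v where v: "v \<in> ?S" and vmin: "\<And>x. x \<in> ?S \<Longrightarrow> inner v (M *v v) \<le> inner x (M *v x)"
    by auto
  define c where "c = inner v (M *v v)"
  have vv: "inner v v = 1" using v by (simp add: dot_square_norm)
  have q: "c * inner x x \<le> inner x (M *v x)" for x
  proof (cases "x = 0")
    case False
    have "c \<le> inner (x /\<^sub>R norm x) (M *v (x /\<^sub>R norm x))"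
      unfolding c_def using False by (intro vmin) simp
    also have "\<dots> = inner x (M *v x) / inner x x"
      by (simp add: matrix_vector_mult_scaleR power2_norm_eq_inner[symmetric] power2_eq_square divide_inverse)
    finally show ?thesis using False by (simp add: field_simps)
  qed simp
  \<comment> \<open>Stationarity at \<open>v\<close>: in the inequality \<open>q\<close> at v + s w
    the terms of order 0 cancel, by the definition of \<open>c\<close> and since v is a unit vector.
    Taking the residual vector itself for \<open>w\<close> then shows that it vanishes.\<close>
  have "inner w (M *v v - c *\<^sub>R v) = 0" for w
  proof (rule quadratic_nonneg_imp_linear_coeff_zero)
    fix s :: real
    have q': "c * inner (v + s *\<^sub>R w) (v + s *\<^sub>R w) \<le> inner (v + s *\<^sub>R w) (M *v (v + s *\<^sub>R w))"
      by (rule q)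
    have vw: "inner v (M *v w) = inner w (M *v v)"
      using symmetric_matrix_inner[OF sym, of v w] by (simp add: inner_commute)
    have e1: "inner (v + s *\<^sub>R w) (v + s *\<^sub>R w) = 1 + 2 * s * inner w v + s\<^sup>2 * inner w w"
      using vv by (simp add: inner_add inner_commute[of v w] power2_eq_square algebra_simps)
    have e2: "inner (v + s *\<^sub>R w) (M *v (v + s *\<^sub>R w))
        = c + s * inner v (M *v w) + s * inner w (M *v v) + s\<^sup>2 * inner w (M *v w)"
      by (simp add: matrix_vector_right_distrib matrix_vector_mult_scaleR inner_add c_def power2_eq_square algebra_simps)
    show "0 \<le> 2 * s * inner w (M *v v - c *\<^sub>R v) + s\<^sup>2 * (inner w (M *v w) - c * inner w w)"
      using q' unfolding e1 e2 vw by (simp add: inner_diff_right algebra_simps)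
  qed
  from this[of "M *v v - c *\<^sub>R v"] have "M *v v = c *\<^sub>R v" by simp
  then show ?thesis using v q by auto
qed

text \<open>A lower bound on the quadratic form instead of a condition on eigenvalues: for fixed
  \<open>a\<close> the set of such matrices is closed, and estimates in terms of \<open>a\<close>
  are uniform over the domain.\<close>

definition spd :: "real \<Rightarrow> real^'d^'d \<Rightarrow> bool" where
  "spd a M \<longleftrightarrow> transpose M = M \<and> (\<forall>x. a * inner x x \<le> inner x (M *v x))"

lemma spd_if_eigenvalues_ge:
  fixes M :: "real^'d^'d"
  assumes "transpose M = M" "\<And>c. c \<in> mat_eigenvalues M \<Longrightarrow> a \<le> c"
  shows "spd a M"
proof -
  obtain v c where v: "norm v = 1" "M *v v = c *\<^sub>R v" and c: "\<And>x. c * inner x x \<le> inner x (M *v x)"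
    using symmetric_matrix_min_eigenvector[OF assms(1)] by auto
  have "a \<le> c" using v by (intro assms(2)) (auto simp: mat_eigenvalues_def intro!: exI[of _ v])
  then have "a * inner x x \<le> inner x (M *v x)" for x
    using c[of x] by (meson inner_ge_zero mult_right_mono order_trans)
  then show ?thesis using assms(1) by (simp add: spd_def)
qed

lemma spd_if_eigenvalues_pos:
  fixes M :: "real^'d^'d"
  assumes "transpose M = M" "\<And>c. c \<in> mat_eigenvalues M \<Longrightarrow> 0 < c"
  shows "\<exists>a>0. spd a M"
proof -
  obtain v c where v: "norm v = 1" "M *v v = c *\<^sub>R v" and c: "\<And>x. c * inner x x \<le> inner x (M *v x)"
    using symmetric_matrix_min_eigenvector[OF assms(1)] by auto
  have "0 < c" using v by (intro assms(2)) (auto simp: mat_eigenvalues_def intro!: exI[of _ v])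
  then show ?thesis using assms(1) c by (auto simp: spd_def)
qed

lemma spd_eigenvalue_ge:
  assumes "spd a M" "c \<in> mat_eigenvalues M"
  shows "a \<le> c"
proof -
  obtain v where v: "v \<noteq> 0" "M *v v = c *\<^sub>R v" using assms(2) by (auto simp: mat_eigenvalues_def)
  have "a * inner v v \<le> c * inner v v" using assms(1) v(2) by (metis inner_scaleR_right spd_def)
  then show ?thesis using v(1) by simp
qed

lemma spd_mono: "spd a M \<Longrightarrow> b \<le> a \<Longrightarrow> spd b M"
  unfolding spd_def by (meson inner_ge_zero mult_right_mono order_trans)

lemma spd_norm_ge:
  assumes "spd a M"
  shows "a * norm x \<le> norm (M *v x)"
proof (cases "x = 0")
  case False
  have "a * (norm x * norm x) \<le> norm x * norm (M *v x)"
    using order_trans[OF spd_def[THEN iffD1, OF assms, THEN conjunct2, rule_format] norm_cauchy_schwarz]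
    by (simp add: power2_norm_eq_inner[symmetric] power2_eq_square)
  then have "norm x * (a * norm x) \<le> norm x * norm (M *v x)" by (simp add: mult_ac)
  then show ?thesis using False by simp
qed simp

text \<open>Polarisation: apply the bound to x + w and x - w, where \<open>w\<close> is M x rescaled
  to the length of x. The difference of the two values is 4 |x| |M x|.\<close>

lemma symmetric_norm_le_quadratic_form:
  fixes M :: "real^'d^'d"
  assumes sym: "transpose M = M" and q: "\<And>x. \<bar>inner x (M *v x)\<bar> \<le> c * inner x x"
  shows "norm (M *v x) \<le> c * norm x"
proof (cases "x = 0 \<or> M *v x = 0")
  case True
  have "0 \<le> c * inner x x" using q[of x] by linarith
  then show ?thesis using True by (cases "x = 0") (auto simp: zero_le_mult_iff dest: antisym[OF _ inner_ge_zero])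
next
  case False
  define w where "w = (norm x / norm (M *v x)) *\<^sub>R (M *v x)"
  have nw: "inner w w = inner x x"
    using False by (simp add: w_def power2_norm_eq_inner[symmetric] power2_eq_square)
  have wM: "inner w (M *v x) = norm x * norm (M *v x)"
    using False by (simp add: w_def power2_norm_eq_inner[symmetric] power2_eq_square)
  have xM: "inner x (M *v w) = inner w (M *v x)"
    using symmetric_matrix_inner[OF sym, of x w] by (simp add: inner_commute)
  have "4 * inner w (M *v x) = inner (x + w) (M *v (x + w)) - inner (x - w) (M *v (x - w))"
    by (simp add: matrix_vector_right_distrib matrix_vector_mult_diff_distrib inner_add inner_diff xM algebra_simps)
  also have "\<dots> \<le> c * inner (x + w) (x + w) + c * inner (x - w) (x - w)"
    using q[of "x + w"] q[of "x - w"] by linarith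
  also have "\<dots> = 4 * (c * inner x x)"
    by (simp add: inner_add inner_diff nw algebra_simps)
  finally have "norm x * norm (M *v x) \<le> norm x * (c * norm x)"
    by (simp add: wM power2_norm_eq_inner[symmetric] power2_eq_square mult_ac)
  then show ?thesis using False by simp
qed

text \<open>The norm on matrices is Euclidean in the entries. This lemma and the next compare it
  with the operator norm up to a crude dimensional factor; only the finiteness of the constants
  matters later.\<close>

lemma matrix_mult_norm_le:
  fixes M :: "real^'d^'d"
  shows "norm (M *v x) \<le> (real CARD('d) * real CARD('d) * norm M) * norm x"
proof -
  have "\<bar>M $ i $ j\<bar> \<le> norm M" for i j
    by (meson component_le_norm_cart Finite_Cartesian_Product.norm_nth_le order_trans)
  then have "onorm ((*v) M) \<le> real CARD('d) * real CARD('d) * norm M"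
    by (rule onorm_le_matrix_component)
  then show ?thesis
    by (meson matrix_vector_mul_bounded_linear mult_right_mono norm_ge_zero onorm order_trans)
qed

lemma matrix_norm_le_onorm_bound:
  fixes M :: "real^'d^'d"
  assumes "\<And>x. norm (M *v x) \<le> c * norm x"
  shows "norm M \<le> real CARD('d) * real CARD('d) * c"
proof -
  have "\<bar>M $ i $ j\<bar> \<le> c" for i j
    using matrix_component_le_onorm[of M i j] onorm_le[of "(*v) M" c] assms by (meson order_trans)
  then have "norm (M $ i) \<le> real CARD('d) * c" for i
    by (intro order_trans[OF norm_le_l1_cart] order_trans[OF sum_bounded_above[where K = c]]) auto
  then have "(\<Sum>i\<in>UNIV. norm (M $ i)) \<le> real CARD('d) * (real CARD('d) * c)"
    by (intro order_trans[OF sum_bounded_above[where K = "real CARD('d) * c"]]) auto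
  moreover have "norm M \<le> (\<Sum>i\<in>UNIV. norm (M $ i))"
    unfolding norm_vec_def by (rule L2_set_le_sum) simp
  ultimately show ?thesis by (simp add: mult.assoc)
qed

text \<open>With \<open>M = m (I - B)\<close> and \<open>\<parallel>B\<parallel> < 1\<close>, the root is \<open>\<surd>m (I - Y)\<close> for the fixed point \<open>Y\<close> of the
  contraction \<open>Y \<mapsto> (B + Y\<^sup>2) / 2\<close>.\<close>

lemma spd_sqrt_exists:
  fixes M :: "real^'d^'d"
  assumes spd: "spd a M" and a: "0 < a"
  shows "\<exists>S b. 0 < b \<and> spd b S \<and> S ** S = M"
proof -
  have sym: "transpose M = M" using spd by (simp add: spd_def)
  \<comment> \<open>An upper bound for the quadratic form of M on unit vectors; the extra
    \<open>a\<close> makes it positive and at least \<open>a\<close>.\<close>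
  define m where "m = a + real CARD('d) * real CARD('d) * norm M"
  have m: "m > 0" "a \<le> m" using a by (auto simp: m_def intro: add_pos_nonneg)
  \<comment> \<open>The smaller root of 2 q - q^2 = 1 - a/m. As 1 - a/m bounds the norm of B, the
    ball of radius q is invariant: (2 q - q^2 + q^2) / 2 = q. The same q serves as contraction
    constant.\<close>
  define q where "q = 1 - sqrt (a / m)"
  have q: "0 \<le> q" "q < 1" using m a by (auto simp: q_def)
  have qq: "1 - a / m = 2 * q - q\<^sup>2"
    using m a by (simp add: q_def power2_eq_square algebra_simps)
  define B where "B = mat 1 - (1 / m) *\<^sub>R M"
  have Bv: "B *v x = x - (1 / m) *\<^sub>R (M *v x)" for x
    by (simp add: B_def matrix_vector_mult_diff_rdistrib scaleR_matrix_vector_assoc)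
  have symB: "inner (B *v x) y = inner x (B *v y)" for x y
    by (simp add: Bv inner_diff symmetric_matrix_inner[OF sym])
  have "norm (B *v x) \<le> (1 - a / m) * norm x" for x
  proof (rule symmetric_norm_le_quadratic_form)
    show "transpose B = B" by (rule symmetric_matrixI[OF symB])
    fix x
    have "norm x * norm (M *v x) \<le> norm x * (m * norm x)"
      using matrix_mult_norm_le[of M x] a
      by (intro mult_left_mono) (auto simp: m_def distrib_right intro: add_increasing)
    then have "inner x (M *v x) \<le> m * inner x x"
      using norm_cauchy_schwarz[of x "M *v x"]
      by (simp add: power2_norm_eq_inner[symmetric] power2_eq_square mult_ac)
    moreover have "a * inner x x \<le> inner x (M *v x)" using spd by (simp add: spd_def)
    ultimately show "\<bar>inner x (B *v x)\<bar> \<le> (1 - a / m) * inner x x"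
      using m by (simp add: Bv inner_diff field_simps abs_if)
  qed
  then have nb: "norm (B *v x) \<le> (2 * q - q\<^sup>2) * norm x" for x by (simp add: qq)
  \<comment> \<open>The iteration runs in the Banach algebra of bounded operators: their norm is
    submultiplicative and is controlled by the quadratic form, without dimensional factors.\<close>
  define b where "b = Blinfun ((*v) B)"
  have bx: "blinfun_apply b x = B *v x" for x
    unfolding b_def by (subst bounded_linear_Blinfun_apply) auto
  have q2: "0 \<le> 2 * q - q\<^sup>2" using q mult_left_le[of q q] by (simp add: power2_eq_square)
  have norm_b: "norm b \<le> 2 * q - q\<^sup>2"
    by (rule norm_blinfun_bound[OF q2]) (simp add: bx nb)
  define F where "F Y = (1/2) *\<^sub>R (b + (Y o\<^sub>L Y))" for Y :: "(real^'d) \<Rightarrow>\<^sub>L (real^'d)"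
  \<comment> \<open>Self-adjointness is a closed condition preserved by \<open>F\<close>; building
    it into the complete set makes the fixed point symmetric.\<close>
  define C where "C = cball 0 q \<inter> {Y :: (real^'d) \<Rightarrow>\<^sub>L (real^'d). \<forall>x y. inner (Y x) y = inner x (Y y)}"
  have "closed {Y :: (real^'d) \<Rightarrow>\<^sub>L (real^'d). \<forall>x y. inner (Y x) y = inner x (Y y)}"
    by (intro closed_Collect_all closed_Collect_eq continuous_intros)
  then have "complete C" unfolding C_def complete_eq_closed by blast
  moreover have "C \<noteq> {}" using q by (auto simp: C_def set_eq_iff intro!: exI[of _ 0])
  moreover have "F ` C \<subseteq> C"
  proof
    fix Z assume "Z \<in> F ` C"
    then obtain Y :: "(real^'d) \<Rightarrow>\<^sub>L (real^'d)"
      where Y: "norm Y \<le> q" "\<And>x y. inner (Y x) y = inner x (Y y)" and Z: "Z = F Y"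
      by (auto simp: C_def)
    have "norm (Y o\<^sub>L Y) \<le> q * q"
      using norm_blinfun_compose[of Y Y] mult_mono[OF Y(1) Y(1)] q by (meson norm_ge_zero order_trans)
    then have "norm (b + (Y o\<^sub>L Y)) \<le> 2 * q"
      using norm_triangle_ineq[of b "Y o\<^sub>L Y"] norm_b by (simp add: power2_eq_square)
    then have "norm Z \<le> q" by (simp add: Z F_def)
    moreover have "inner (Z x) y = inner x (Z y)" for x y
      by (simp add: Z F_def blinfun.bilinear_simps bx inner_add symB Y(2))
    ultimately show "Z \<in> C" by (simp add: C_def)
  qed
  moreover have "dist (F Y) (F Z) \<le> q * dist Y Z" if "Y \<in> C" "Z \<in> C" for Y Z
  proof -
    have YZ: "norm Y \<le> q" "norm Z \<le> q" using that by (auto simp: C_def)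
    have "F Y - F Z = (1/2) *\<^sub>R ((Y o\<^sub>L (Y - Z)) + ((Y - Z) o\<^sub>L Z))"
      by (rule blinfun_eqI) (simp add: F_def blinfun.bilinear_simps algebra_simps)
    moreover have "norm (Y o\<^sub>L (Y - Z)) \<le> q * norm (Y - Z)"
      using YZ by (intro order_trans[OF norm_blinfun_compose] mult_right_mono) auto
    moreover have "norm ((Y - Z) o\<^sub>L Z) \<le> q * norm (Y - Z)"
      using YZ by (subst mult.commute) (intro order_trans[OF norm_blinfun_compose] mult_left_mono, auto)
    ultimately show ?thesis
      using norm_triangle_ineq[of "Y o\<^sub>L (Y - Z)" "(Y - Z) o\<^sub>L Z"] by (simp add: dist_norm)
  qed
  ultimately have "\<exists>!Y. Y \<in> C \<and> F Y = Y"
    using q by (intro Banach_fix) auto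
  then obtain Y where "Y \<in> C" and FY: "F Y = Y" by auto
  then have nY: "norm Y \<le> q" and symY: "\<And>x y. inner (Y x) y = inner x (Y y)" by (auto simp: C_def)
  \<comment> \<open>The fixed point equation solved for Y^2. It yields (I - Y)^2 = I - 2 Y + Y^2 = I
    - B, which is M / m.\<close>
  have YY: "Y (Y x) = 2 *\<^sub>R Y x - B *v x" for x
  proof -
    have "Y x = (1/2) *\<^sub>R (B *v x + Y (Y x))"
      using arg_cong[OF FY, of "\<lambda>Y. blinfun_apply Y x"] by (simp add: F_def blinfun.bilinear_simps bx)
    then have "2 *\<^sub>R Y x = 2 *\<^sub>R ((1/2) *\<^sub>R (B *v x + Y (Y x)))" by (rule arg_cong)
    then show ?thesis by (simp add: algebra_simps)
  qed
  define S where "S = matrix (\<lambda>x. sqrt m *\<^sub>R (x - Y x))"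
  have Sx: "S *v x = sqrt m *\<^sub>R (x - Y x)" for x
    
  proof -
    have "linear (\<lambda>x. sqrt m *\<^sub>R (x - Y x))"
      by (rule linearI) (simp_all add: blinfun.bilinear_simps algebra_simps)
    then show ?thesis unfolding S_def using matrix_vector_mul(2)[of "\<lambda>x. sqrt m *\<^sub>R (x - Y x)"] by (simp add: fun_eq_iff)
  qed
  have "spd (sqrt m * (1 - q)) S"
    unfolding spd_def
  proof (intro conjI allI)
    show "transpose S = S"
      by (rule symmetric_matrixI) (simp add: Sx inner_diff symY)
    fix x
    have "inner x (Y x) \<le> norm x * (q * norm x)"
      using norm_cauchy_schwarz[of x "Y x"] norm_blinfun[of Y x] nY
      by (meson mult_left_mono mult_right_mono norm_ge_zero order_trans)
    then have "(1 - q) * inner x x \<le> inner x (x - Y x)"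
      by (simp add: inner_diff algebra_simps power2_norm_eq_inner[symmetric] power2_eq_square)
    then show "sqrt m * (1 - q) * inner x x \<le> inner x (S *v x)"
      using m by (simp add: Sx mult.assoc mult_left_mono)
  qed
  moreover have "S ** S = M"
  proof -
    have "(S ** S) *v x = M *v x" for x
    proof -
      have "(S ** S) *v x = m *\<^sub>R ((x - Y x) - Y (x - Y x))"
        using m by (simp add: matrix_vector_mul_assoc[symmetric] Sx blinfun.bilinear_simps scaleR_diff_right[symmetric])
      also have "\<dots> = m *\<^sub>R (x - B *v x)"
        by (simp add: blinfun.bilinear_simps YY algebra_simps scaleR_2)
      also have "\<dots> = M *v x" using m by (simp add: Bv)
      finally show ?thesis .
    qed
    then show ?thesis by (simp add: matrix_eq)
  qed
  moreover have "0 < sqrt m * (1 - q)" using m q by simp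
  ultimately show ?thesis by blast
qed

text \<open>For \<open>D = S - T\<close> one has \<open>S D + D T = S\<^sup>2 - T\<^sup>2\<close>; test this with an extremal eigenvector of \<open>D\<close>.\<close>

lemma spd_diff_norm_le:
  fixes S T :: "real^'d^'d"
  assumes S: "spd a S" and T: "spd a T" and a: "0 < a"
    and K: "\<And>x. norm ((S ** S - T ** T) *v x) \<le> K * norm x"
  shows "norm ((S - T) *v x) \<le> K / (2 * a) * norm x"
proof -
  \<comment> \<open>Stated for arbitrary S and T so that exchanging them gives the upper bound on
    the quadratic form of S - T.\<close>
  have lower: "- (K / (2 * a)) * inner x x \<le> inner x ((S - T) *v x)"
    if S: "spd a S" and T: "spd a T" and K: "\<And>x. norm ((S ** S - T ** T) *v x) \<le> K * norm x"
    for S T :: "real^'d^'d" and x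
  proof -
    have sym: "transpose S = S" "transpose T = T" using S T by (auto simp: spd_def)
    have "inner ((S - T) *v x) y = inner x ((S - T) *v y)" for x y
      by (simp add: matrix_vector_mult_diff_rdistrib inner_diff symmetric_matrix_inner sym)
    then obtain v c where v: "norm v = 1" "(S - T) *v v = c *\<^sub>R v"
      and c: "\<And>x. c * inner x x \<le> inner x ((S - T) *v x)"
      using symmetric_matrix_min_eigenvector[OF symmetric_matrixI, of "S - T"] by blast
    have vv: "inner v v = 1" using v by (simp add: dot_square_norm)
    have d: "S *v v = T *v v + c *\<^sub>R v"
      using v(2) by (simp add: matrix_vector_mult_diff_rdistrib algebra_simps)
    have "inner v ((S ** S - T ** T) *v v) = inner (S *v v) (S *v v) - inner (T *v v) (T *v v)"
      by (simp add: matrix_vector_mult_diff_rdistrib inner_diff matrix_vector_mul_assoc[symmetric]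
          symmetric_matrix_inner sym)
    also have "\<dots> = c * (inner v (S *v v) + inner v (T *v v))"
      by (simp add: d inner_add vv inner_commute[of "T *v v" v] algebra_simps)
    finally have e: "inner v ((S ** S - T ** T) *v v) = c * (inner v (S *v v) + inner v (T *v v))" .
    have ST: "inner v (S *v v) + inner v (T *v v) \<ge> 2 * a"
      using S[unfolded spd_def, THEN conjunct2, rule_format, of v]
        T[unfolded spd_def, THEN conjunct2, rule_format, of v] vv by simp
    have "\<bar>c\<bar> * (2 * a) \<le> \<bar>c\<bar> * (inner v (S *v v) + inner v (T *v v))"
      by (intro mult_left_mono ST) simp
    also have "\<dots> = \<bar>inner v ((S ** S - T ** T) *v v)\<bar>"
      using ST a by (simp add: e abs_mult)
    also have "\<dots> \<le> K"
      using Cauchy_Schwarz_ineq2[of v "(S ** S - T ** T) *v v"] K[of v] v(1) by simp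
    finally have "- (K / (2 * a)) \<le> c" using a abs_ge_minus_self[of c] mult_right_mono[of "-c" "\<bar>c\<bar>" "2 * a"]
      by (simp add: field_simps)
    then show ?thesis using c[of x] by (meson inner_ge_zero mult_right_mono order_trans)
  qed
  have neg: "(T - S) *v x = - ((S - T) *v x)" for x
    by (simp add: matrix_vector_mult_diff_rdistrib)
  have K': "norm ((T ** T - S ** S) *v x) \<le> K * norm x" for x
    using K[of x] by (simp add: matrix_vector_mult_diff_rdistrib norm_minus_commute)
  show ?thesis
  proof (rule symmetric_norm_le_quadratic_form)
    show "transpose (S - T) = S - T"
      using S T by (intro symmetric_matrixI)
        (simp add: spd_def matrix_vector_mult_diff_rdistrib inner_diff symmetric_matrix_inner)
    fix x show "\<bar>inner x ((S - T) *v x)\<bar> \<le> K / (2 * a) * inner x x"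
      using lower[OF S T K, of x] lower[OF T S K', of x] by (simp add: neg abs_le_iff)
  qed
qed

text \<open>The difference estimate with \<open>K = 0\<close>; lower bounds of different size are
  compared at the smaller one.\<close>

lemma spd_sqrt_unique:
  assumes "spd a S" "0 < a" "spd b T" "0 < b" "S ** S = T ** T"
  shows "S = T"
proof -
  let ?c = "min a b"
  have "norm ((S - T) *v x) \<le> 0 / (2 * ?c) * norm x" for x
    using assms by (intro spd_diff_norm_le spd_mono[of a S ?c] spd_mono[of b T ?c]) auto
  then have "S *v x = T *v x" for x by (simp add: matrix_vector_mult_diff_rdistrib)
  then show ?thesis by (simp add: matrix_eq)
qed

text \<open>\<open>mat_sqrt\<close> is a definite description, so nothing is known about it before
  existence and uniqueness are both available. The constant comes from squaring: an eigenvalue c of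
  the root yields the eigenvalue c^2 of M.\<close>

lemma mat_sqrt_spd:
  fixes M :: "real^'d^'d"
  assumes "spd a M" "0 < a"
  shows "mat_sqrt M ** mat_sqrt M = M" "spd (sqrt a) (mat_sqrt M)"
proof -
  let ?P = "\<lambda>S::real^'d^'d. transpose S = S \<and> (\<forall>c \<in> mat_eigenvalues S. c > 0) \<and> S ** S = M"
  obtain S b where S: "0 < b" "spd b S" "S ** S = M"
    using spd_sqrt_exists[OF assms] by auto
  have "?P S" using S spd_eigenvalue_ge[OF S(2)] by (force simp: spd_def)
  moreover have "T = S" if "?P T" for T
  proof -
    have "\<exists>c>0. spd c T" using that by (intro spd_if_eigenvalues_pos) auto
    then obtain c where "c > 0" "spd c T" by auto
    then show ?thesis using S that by (intro spd_sqrt_unique[of c T b S]) auto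
  qed
  ultimately have P: "?P (mat_sqrt M)"
    unfolding mat_sqrt_def by (rule theI)
  then show "mat_sqrt M ** mat_sqrt M = M" by simp
  have "sqrt a \<le> c" if c: "c \<in> mat_eigenvalues (mat_sqrt M)" for c
  proof -
    obtain v where v: "v \<noteq> 0" "mat_sqrt M *v v = c *\<^sub>R v" using c by (auto simp: mat_eigenvalues_def)
    have "M *v v = mat_sqrt M *v (mat_sqrt M *v v)"
      using P by (simp add: matrix_vector_mul_assoc)
    also have "\<dots> = c\<^sup>2 *\<^sub>R v" by (simp add: v matrix_vector_mult_scaleR power2_eq_square)
    finally have "c\<^sup>2 \<in> mat_eigenvalues M" using v(1) by (auto simp: mat_eigenvalues_def)
    then have "a \<le> c\<^sup>2" by (rule spd_eigenvalue_ge[OF assms(1)])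
    then show ?thesis using P c by (intro real_le_lsqrt) auto
  qed
  then show "spd (sqrt a) (mat_sqrt M)" using P by (intro spd_if_eigenvalues_ge) auto
qed

lemma spd_matrix_inv:
  fixes S :: "real^'d^'d"
  assumes "spd a S" "0 < a"
  shows "S *v (matrix_inv S *v x) = x" "matrix_inv S *v (S *v x) = x"
    "norm (matrix_inv S *v x) \<le> 1 / a * norm x"
proof -
  have "inj ((*v) S)"
  proof (rule injI)
    fix x y assume "S *v x = S *v y"
    then have "a * norm (x - y) \<le> 0"
      using spd_norm_ge[OF assms(1), of "x - y"] by (simp add: matrix_vector_mult_diff_distrib)
    then show "x = y" using assms(2) by (simp add: mult_le_0_iff)
  qed
  then have "invertible S"
    by (simp add: invertible_left_inverse matrix_left_invertible_injective)
  then have minv: "S ** matrix_inv S = mat 1" "matrix_inv S ** S = mat 1"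
    unfolding matrix_inv_def invertible_def by (metis (mono_tags, lifting) someI_ex)+
  show 1: "S *v (matrix_inv S *v x) = x" for x
    using minv(1) by (simp add: matrix_vector_mul_assoc)
  show "matrix_inv S *v (S *v x) = x"
    using minv(2) by (simp add: matrix_vector_mul_assoc)
  show "norm (matrix_inv S *v x) \<le> 1 / a * norm x"
    using spd_norm_ge[OF assms(1), of "matrix_inv S *v x"] assms(2) by (simp add: 1 field_simps)
qed

text \<open>By symmetry |S x|^2 = (x, M x) for the root S, so the constant is the square root of the
  one in \<open>matrix_mult_norm_le\<close>.\<close>

lemma mat_sqrt_norm_le:
  fixes M :: "real^'d^'d"
  assumes "spd a M" "0 < a" "norm M \<le> C"
  shows "norm (mat_sqrt M *v x) \<le> real CARD('d) * sqrt C * norm x"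
proof (rule power2_le_imp_le)
  have "transpose (mat_sqrt M) = mat_sqrt M" using mat_sqrt_spd[OF assms(1,2)] by (simp add: spd_def)
  then have "(norm (mat_sqrt M *v x))\<^sup>2 = inner x (M *v x)"
    using mat_sqrt_spd(1)[OF assms(1,2)]
    by (simp add: power2_norm_eq_inner symmetric_matrix_inner matrix_vector_mul_assoc)
  also have "\<dots> \<le> norm x * (real CARD('d) * real CARD('d) * norm M * norm x)"
    using norm_cauchy_schwarz[of x "M *v x"] matrix_mult_norm_le[of M x]
    by (meson mult_left_mono norm_ge_zero order_trans)
  also have "\<dots> \<le> norm x * (real CARD('d) * real CARD('d) * C * norm x)"
    using assms(3) by (intro mult_left_mono mult_right_mono) auto
  also have "\<dots> = (real CARD('d) * sqrt C * norm x)\<^sup>2"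
    using assms(3) order_trans[OF norm_ge_zero assms(3)]
    by (simp add: power_mult_distrib) (simp add: power2_eq_square)
  finally show "(norm (mat_sqrt M *v x))\<^sup>2 \<le> (real CARD('d) * sqrt C * norm x)\<^sup>2" .
qed (use order_trans[OF norm_ge_zero assms(3)] in simp)

lemma closed_spd: "closed {M :: real^'d^'d. spd a M}"
  unfolding spd_def transpose_def matrix_vector_mult_def inner_vec_def
  by (intro closed_Collect_conj closed_Collect_all closed_Collect_eq closed_Collect_le continuous_intros)

lemma mat_sqrt_lipschitz:
  fixes M M' :: "real^'d^'d"
  assumes "spd a M" "spd a M'" "0 < a"
  shows "norm ((mat_sqrt M - mat_sqrt M') *v x)
    \<le> real CARD('d) * real CARD('d) * norm (M - M') / (2 * sqrt a) * norm x"
proof (rule spd_diff_norm_le)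
  show "norm ((mat_sqrt M ** mat_sqrt M - mat_sqrt M' ** mat_sqrt M') *v x)
      \<le> real CARD('d) * real CARD('d) * norm (M - M') * norm x" for x
    using matrix_mult_norm_le[of "M - M'" x] mat_sqrt_spd(1) assms by metis
qed (use assms mat_sqrt_spd in auto)

text \<open>The Lipschitz constant of the root blows up at singular matrices, hence the restriction
  to a fixed lower bound \<open>a\<close>. Continuity on this closed set is the source of the
  measurability of \<open>mat_sqrt (A x)\<close> in x.\<close>

lemma continuous_on_mat_sqrt:
  assumes "0 < a"
  shows "continuous_on {M :: real^'d^'d. spd a M} mat_sqrt"
proof (rule lipschitz_on_continuous_on, rule lipschitz_onI)
  let ?n = "real CARD('d) * real CARD('d)"
  fix M M' :: "real^'d^'d" assume M: "M \<in> {M. spd a M}" "M' \<in> {M. spd a M}"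
  have "norm (mat_sqrt M - mat_sqrt M') \<le> ?n * (?n * norm (M - M') / (2 * sqrt a))"
    using M assms by (intro matrix_norm_le_onorm_bound mat_sqrt_lipschitz) auto
  then show "dist (mat_sqrt M) (mat_sqrt M') \<le> ?n * ?n / (2 * sqrt a) * dist M M'"
    by (simp add: dist_norm mult_ac)
qed (use assms in simp)

text \<open>From the identity S^(-1) - T^(-1) = - S^(-1) (S - T) T^(-1), with both inverses bounded
  by 1 / sqrt a and S - T by the Lipschitz estimate for roots.\<close>

lemma continuous_on_matrix_inv_mat_sqrt:
  assumes "0 < a"
  shows "continuous_on {M :: real^'d^'d. spd a M} (\<lambda>M. matrix_inv (mat_sqrt M))"
proof (rule lipschitz_on_continuous_on, rule lipschitz_onI)
  let ?n = "real CARD('d) * real CARD('d)"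
  fix M M' :: "real^'d^'d" assume "M \<in> {M. spd a M}" "M' \<in> {M. spd a M}"
  then have M: "spd a M" "spd a M'" by auto
  let ?S = "mat_sqrt M" and ?T = "mat_sqrt M'"
  note S = mat_sqrt_spd(2)[OF M(1) assms] and T = mat_sqrt_spd(2)[OF M(2) assms]
  have sa: "0 < sqrt a" using assms by simp
  let ?L = "1 / sqrt a * (?n * norm (M - M') / (2 * sqrt a) * (1 / sqrt a))"
  have "norm ((matrix_inv ?S - matrix_inv ?T) *v x) \<le> ?L * norm x" for x
  proof -
    let ?y = "matrix_inv ?T *v x"
    have "(matrix_inv ?S - matrix_inv ?T) *v x = matrix_inv ?S *v (x - ?S *v ?y)"
      by (simp add: matrix_vector_mult_diff_rdistrib matrix_vector_mult_diff_distrib spd_matrix_inv[OF S sa])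
    also have "x - ?S *v ?y = - ((?S - ?T) *v ?y)"
      by (simp add: matrix_vector_mult_diff_rdistrib spd_matrix_inv[OF T sa])
    finally have "norm ((matrix_inv ?S - matrix_inv ?T) *v x) \<le> 1 / sqrt a * norm ((?S - ?T) *v ?y)"
      using spd_matrix_inv(3)[OF S sa] by (metis norm_minus_cancel)
    also have "\<dots> \<le> 1 / sqrt a * (?n * norm (M - M') / (2 * sqrt a) * norm ?y)"
      using mat_sqrt_lipschitz[OF M assms] sa by (intro mult_left_mono) auto
    also have "\<dots> \<le> 1 / sqrt a * (?n * norm (M - M') / (2 * sqrt a) * (1 / sqrt a * norm x))"
      using spd_matrix_inv(3)[OF T sa] sa by (intro mult_left_mono) auto
    finally show ?thesis by (simp add: mult_ac)
  qed
  then have "norm (matrix_inv ?S - matrix_inv ?T) \<le> ?n * ?L"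
    by (rule matrix_norm_le_onorm_bound)
  then show "dist (matrix_inv ?S) (matrix_inv ?T) \<le> ?n * ?n / (2 * sqrt a * sqrt a * sqrt a) * dist M M'"
    by (simp add: dist_norm mult_ac)
qed (use assms in simp)

lemma borel_measurable_matrix_vector_mult:
  fixes A :: "'x \<Rightarrow> real^'d^'d" and f :: "'x \<Rightarrow> real^'d"
  assumes "A \<in> borel_measurable M" "f \<in> borel_measurable M"
  shows "(\<lambda>x. A x *v f x) \<in> borel_measurable M"
proof (rule borel_measurable_continuous_Pair[OF assms])
  show "continuous_on UNIV (\<lambda>p. fst p *v snd p :: real^'d)"
    unfolding matrix_vector_mult_def by (intro continuous_intros)
qed

section \<open>Test functions\<close>

lemma pd_eqI: "(\<phi> has_derivative D) (at x) \<Longrightarrow> pd i \<phi> x = D (axis i 1)"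
  by (simp add: pd_def frechet_derivative_at[symmetric])

lemma has_derivative_frechet: "\<phi> differentiable (at x) \<Longrightarrow> (\<phi> has_derivative frechet_derivative \<phi> (at x)) (at x)"
  by (simp add: frechet_derivative_works)

lemma pd_add:
  "f differentiable (at x) \<Longrightarrow> g differentiable (at x) \<Longrightarrow> pd i (\<lambda>x. f x + g x) x = pd i f x + pd i g x"
  by (subst pd_eqI[OF has_derivative_add[OF has_derivative_frechet has_derivative_frechet]]) (auto simp: pd_def)

lemma pd_mult:
  "f differentiable (at x) \<Longrightarrow> g differentiable (at x) \<Longrightarrow> pd i (\<lambda>x. f x * g x) x = f x * pd i g x + pd i f x * g x"
  by (subst pd_eqI[OF has_derivative_mult[OF has_derivative_frechet has_derivative_frechet]]) (auto simp: pd_def)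

text \<open>An invariant that implies differentiability and survives partial derivatives replaces
  formulas for derivatives of all orders; each use below only has to guess a class of
  functions.\<close>

lemma smooth_fun_coinduct:
  assumes "P \<phi>" and "\<And>\<psi> x. P \<psi> \<Longrightarrow> \<psi> differentiable (at x)" and "\<And>\<psi> i. P \<psi> \<Longrightarrow> P (pd i \<psi>)"
  shows "smooth_fun \<phi>"
proof -
  have "P (foldr pd is \<phi>)" for "is"
    by (induction "is") (auto simp: assms)
  then show ?thesis by (simp add: smooth_fun_def assms)
qed

lemma smooth_fun_differentiable: "smooth_fun \<phi> \<Longrightarrow> \<phi> differentiable (at x)"
  unfolding smooth_fun_def by (metis foldr_Nil id_apply)

lemma smooth_fun_pd:
  assumes "smooth_fun \<phi>"
  shows "smooth_fun (pd i \<phi>)"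
  unfolding smooth_fun_def
proof (intro allI)
  fix "is" x
  show "foldr pd is (pd i \<phi>) differentiable (at x)"
    using assms[unfolded smooth_fun_def, rule_format, of "is @ [i]" x] by simp
qed

lemma smooth_fun_continuous: "smooth_fun \<phi> \<Longrightarrow> continuous_on A \<phi>"
  by (meson continuous_at_imp_continuous_on differentiable_imp_continuous_within smooth_fun_differentiable)

text \<open>The invariant for the product rule: products alone are not preserved by
  \<open>pd\<close>, but finite sums of products are.\<close>

inductive sum_of_smooth_products :: "(real^'d::finite \<Rightarrow> real) \<Rightarrow> bool" where
  product: "smooth_fun f \<Longrightarrow> smooth_fun g \<Longrightarrow> sum_of_smooth_products (\<lambda>x. f x * g x)"
| sum: "sum_of_smooth_products f \<Longrightarrow> sum_of_smooth_products g \<Longrightarrow> sum_of_smooth_products (\<lambda>x. f x + g x)"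

lemma sum_of_smooth_products_differentiable:
  "sum_of_smooth_products f \<Longrightarrow> f differentiable (at x)"
  by (induction rule: sum_of_smooth_products.induct) (auto simp: smooth_fun_differentiable)

lemma sum_of_smooth_products_pd:
  "sum_of_smooth_products f \<Longrightarrow> sum_of_smooth_products (pd i f)"
proof (induction rule: sum_of_smooth_products.induct)
  case (product f g)
  then have "pd i (\<lambda>x. f x * g x) = (\<lambda>x. f x * pd i g x + pd i f x * g x)"
    by (auto simp: fun_eq_iff pd_mult smooth_fun_differentiable)
  then show ?case
    using product by (simp add: sum_of_smooth_products.intros smooth_fun_pd)
next
  case (sum f g)
  then have "pd i (\<lambda>x. f x + g x) = (\<lambda>x. pd i f x + pd i g x)"
    by (auto simp: fun_eq_iff pd_add sum_of_smooth_products_differentiable)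
  then show ?case using sum by (simp add: sum_of_smooth_products.intros)
qed

lemma smooth_fun_mult:
  assumes "smooth_fun f" "smooth_fun g"
  shows "smooth_fun (\<lambda>x. f x * g x)"
  using sum_of_smooth_products.product[OF assms] sum_of_smooth_products_differentiable
    sum_of_smooth_products_pd by (rule smooth_fun_coinduct)

lemma smooth_fun_const: "smooth_fun (\<lambda>x. c)"
proof (rule smooth_fun_coinduct[where P = "\<lambda>\<eta>. \<exists>c. \<eta> = (\<lambda>x. c)"])
  fix \<psi> :: "real^'a \<Rightarrow> real" and i
  assume "\<exists>c. \<psi> = (\<lambda>x. c)"
  then obtain c where "\<psi> = (\<lambda>x. c)" by blast
  then have "pd i \<psi> = (\<lambda>x. 0)"
    by (intro ext) (simp only: pd_eqI[OF has_derivative_const])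
  then show "\<exists>c. pd i \<psi> = (\<lambda>x. c)" by blast
qed auto

lemma smooth_fun_prod:
  "finite I \<Longrightarrow> (\<And>i. i \<in> I \<Longrightarrow> smooth_fun (f i)) \<Longrightarrow> smooth_fun (\<lambda>x. \<Prod>i\<in>I. f i x)"
  by (induction I rule: finite_induct) (auto simp: smooth_fun_const smooth_fun_mult)

section \<open>Smooth bumps that approximate boxes\<close>

definition flat_exp :: "real poly \<Rightarrow> real \<Rightarrow> real" where
  "flat_exp p t = (if 0 < t then poly p (1 / t) * exp (- (1 / t)) else 0)"

lemma poly_div_exp_tendsto_0: "((\<lambda>y::real. poly p y / exp y) \<longlongrightarrow> 0) at_top"
proof -
  have "((\<lambda>y::real. \<Sum>i\<le>degree p. coeff p i * (y ^ i / exp y)) \<longlongrightarrow> (\<Sum>i\<le>degree p. coeff p i * 0)) at_top"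
    by (intro tendsto_sum tendsto_mult tendsto_const tendsto_power_div_exp_0)
  then show ?thesis by (simp add: poly_altdef sum_divide_distrib)
qed

text \<open>With y = 1/t, differentiating p(y) exp(-y) gives y^2 (p(y) - p'(y)) exp(-y);
  \<open>[:0, 0, 1:]\<close> is the factor y^2. The polynomial coefficient thus keeps the family
  closed under differentiation, and at 0 the exponential beats every polynomial.\<close>

lemma flat_exp_has_derivative:
  "(flat_exp p has_real_derivative flat_exp ([:0, 0, 1:] * (p - pderiv p)) t) (at t)"
proof -
  consider "t > 0" | "t < 0" | "t = 0" by linarith
  then show ?thesis
  proof cases
    case 1
    have "((\<lambda>t. poly p (1 / t) * exp (- (1 / t))) has_real_derivative
        flat_exp ([:0, 0, 1:] * (p - pderiv p)) t) (at t)"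
      using 1 by (auto intro!: derivative_eq_intros DERIV_chain2[OF poly_DERIV]
          simp: flat_exp_def field_simps power2_eq_square)
    then show ?thesis
      by (rule DERIV_cong_ev[THEN iffD1, rotated -1])
        (use 1 eventually_nhds_in_open[of "{0<..}" t] in \<open>auto simp: flat_exp_def elim: eventually_mono\<close>)
  next
    case 2
    have "((\<lambda>t. 0) has_real_derivative flat_exp ([:0, 0, 1:] * (p - pderiv p)) t) (at t)"
      using 2 by (simp add: flat_exp_def)
    then show ?thesis
      by (rule DERIV_cong_ev[THEN iffD1, rotated -1])
        (use 2 eventually_nhds_in_open[of "{..<0}" t] in \<open>auto simp: flat_exp_def elim: eventually_mono\<close>)
  next
    case 3
    \<comment> \<open>With y = 1/h the quotient is y p(y) / exp y; the factor
      \<open>[:0, 1:]\<close> is the y that comes from dividing by h.\<close>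
    have "((\<lambda>h. flat_exp p h / h) \<longlongrightarrow> 0) (at_right 0)"
    proof (rule Lim_transform_eventually)
      show "((\<lambda>h. poly ([:0, 1:] * p) (inverse h) / exp (inverse h)) \<longlongrightarrow> 0) (at_right 0)"
        by (rule filterlim_compose[OF poly_div_exp_tendsto_0 filterlim_inverse_at_top_right])
      show "\<forall>\<^sub>F h in at_right 0. poly ([:0, 1:] * p) (inverse h) / exp (inverse h) = flat_exp p h / h"
        by (rule eventually_at_right_less[THEN eventually_mono])
          (auto simp: flat_exp_def exp_minus field_simps)
    qed
    moreover have "((\<lambda>h. flat_exp p h / h) \<longlongrightarrow> 0) (at_left 0)"
    proof (rule Lim_transform_eventually)
      show "\<forall>\<^sub>F h in at_left 0. 0 = flat_exp p h / h"
        by (rule eventually_at_leftI[of "-1"]) (auto simp: flat_exp_def)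
    qed simp
    ultimately have "((\<lambda>h. flat_exp p h / h) \<longlongrightarrow> 0) (at 0)"
      by (simp add: filterlim_split_at)
    then show ?thesis
      using 3 by (simp add: DERIV_def flat_exp_def)
  qed
qed

text \<open>In the invariant the scalar \<open>s\<close> absorbs the components of \<open>e\<close>
  that the chain rule produces.\<close>

lemma smooth_fun_flat_exp: "smooth_fun (\<lambda>x. flat_exp p (inner e x + c))"
proof (rule smooth_fun_coinduct[where P = "\<lambda>\<eta>. \<exists>p s. \<eta> = (\<lambda>x. s * flat_exp p (inner e x + c))"])
  show "\<exists>p' s. (\<lambda>x. flat_exp p (inner e x + c)) = (\<lambda>x. s * flat_exp p' (inner e x + c))"
    by (rule exI[of _ p], rule exI[of _ 1]) simp
  have der: "((\<lambda>x. s * flat_exp p (inner e x + c)) has_derivative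
      (\<lambda>h. s * (flat_exp ([:0, 0, 1:] * (p - pderiv p)) (inner e x + c) * inner e h))) (at x)" for p s x
  proof -
    have "((\<lambda>x. inner e x + c) has_derivative (\<lambda>h. inner e h)) (at x)"
      by (auto intro!: derivative_eq_intros)
    from has_derivative_compose[OF this, of "flat_exp p"]
    have "((\<lambda>x. flat_exp p (inner e x + c)) has_derivative
      (\<lambda>h. flat_exp ([:0, 0, 1:] * (p - pderiv p)) (inner e x + c) * inner e h)) (at x)"
      using flat_exp_has_derivative[of p "inner e x + c"] unfolding has_field_derivative_def by blast
    then show ?thesis by (rule has_derivative_mult_right)
  qed
  show "\<psi> differentiable (at x)" if "\<exists>p s. \<psi> = (\<lambda>x. s * flat_exp p (inner e x + c))" for \<psi> x
    using that der unfolding differentiable_def by blast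
  show "\<exists>p s. pd i \<psi> = (\<lambda>x. s * flat_exp p (inner e x + c))"
    if ex: "\<exists>p s. \<psi> = (\<lambda>x. s * flat_exp p (inner e x + c))" for \<psi> i
  proof -
    obtain p s where \<psi>: "\<psi> = (\<lambda>x. s * flat_exp p (inner e x + c))" using ex by blast
    have "pd i \<psi> = (\<lambda>x. (s * e $ i) * flat_exp ([:0, 0, 1:] * (p - pderiv p)) (inner e x + c))"
      unfolding \<psi> by (rule ext, subst pd_eqI[OF der]) (simp add: inner_axis)
    then show ?thesis by blast
  qed
qed

text \<open>Each factor has the form exp(-1/((n+1) t)), which tends to 1 for t > 0 and is replaced
  by 0 for t \<le> 0. Letting n grow recovers the indicator of the open box pointwise, bounded by 1
  throughout, so dominated convergence takes the place of mollification.\<close>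

definition box_bump :: "real^'d::finite \<Rightarrow> real^'d \<Rightarrow> nat \<Rightarrow> real^'d \<Rightarrow> real" where
  "box_bump a b n x = (\<Prod>i\<in>UNIV. flat_exp 1 (real (Suc n) * (x $ i - a $ i)) * flat_exp 1 (real (Suc n) * (b $ i - x $ i)))"

lemma smooth_fun_box_bump: "smooth_fun (box_bump a b n)"
proof -
  have eq: "box_bump a b n = (\<lambda>x. \<Prod>i\<in>UNIV.
      flat_exp 1 (inner (real (Suc n) *\<^sub>R axis i 1) x + - real (Suc n) * a $ i)
    * flat_exp 1 (inner (- real (Suc n) *\<^sub>R axis i 1) x + real (Suc n) * b $ i))"
    by (auto simp: box_bump_def fun_eq_iff inner_axis' algebra_simps)
  show ?thesis
    unfolding eq by (intro smooth_fun_prod smooth_fun_mult smooth_fun_flat_exp) simp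
qed

lemma box_bump_bounds: "0 \<le> box_bump a b n x" "box_bump a b n x \<le> 1"
  unfolding box_bump_def
  by (auto simp: flat_exp_def intro!: prod_nonneg prod_le_1 mult_le_one)

lemma box_bump_eq_0: "x \<notin> box a b \<Longrightarrow> box_bump a b n x = 0"
proof -
  assume "x \<notin> box a b"
  then obtain i where "\<not> a $ i < x $ i \<or> \<not> x $ i < b $ i" by (auto simp: mem_box_cart)
  then have "flat_exp 1 (real (Suc n) * (x $ i - a $ i)) * flat_exp 1 (real (Suc n) * (b $ i - x $ i)) = 0"
    by (auto simp: flat_exp_def zero_less_mult_iff)
  then show ?thesis unfolding box_bump_def by (meson UNIV_I finite prod_zero)
qed

lemma box_bump_tendsto: "(\<lambda>n. box_bump a b n x) \<longlonglongrightarrow> indicator (box a b) x"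
proof (cases "x \<in> box a b")
  case False
  then show ?thesis by (simp add: box_bump_eq_0)
next
  case True
  have 1: "(\<lambda>n. flat_exp 1 (real (Suc n) * t)) \<longlonglongrightarrow> 1" if "t > 0" for t
  proof -
    have "(\<lambda>n. exp (- (inverse (real (Suc n)) * (1 / t)))) \<longlonglongrightarrow> exp (- (0 * (1 / t)))"
      by (intro tendsto_intros LIMSEQ_inverse_real_of_nat)
    moreover have "exp (- (inverse (real (Suc n)) * (1 / t))) = flat_exp 1 (real (Suc n) * t)" for n
      using that by (simp add: flat_exp_def divide_inverse del: of_nat_Suc)
    ultimately show ?thesis by simp
  qed
  have "(\<lambda>n. box_bump a b n x) \<longlonglongrightarrow> (\<Prod>i\<in>(UNIV::'a set). 1 * 1)"
    unfolding box_bump_def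
    by (intro tendsto_prod tendsto_mult 1) (use True in \<open>auto simp: mem_box_cart\<close>)
  then show ?thesis using True by simp
qed

lemma test_fun_box_bump:
  assumes "cbox a b \<subseteq> \<Omega>"
  shows "test_fun \<Omega> (box_bump a b n)"
proof -
  have "{x. box_bump a b n x \<noteq> 0} \<subseteq> cbox a b"
    using box_bump_eq_0[of _ a b n] box_subset_cbox[of a b] by blast
  then have c: "closure {x. box_bump a b n x \<noteq> 0} \<subseteq> cbox a b"
    by (rule closure_minimal) (rule closed_cbox)
  then have "bounded (closure {x. box_bump a b n x \<noteq> 0})"
    using bounded_cbox bounded_subset by blast
  then show ?thesis
    using c assms by (auto simp: test_fun_def smooth_fun_box_bump compact_eq_bounded_closed)
qed

section \<open>The fundamental lemma of the calculus of variations\<close>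

lemma lebesgue_eq_0_if_box_integrals_0:
  fixes h :: "real^'d::finite \<Rightarrow> real"
  assumes h: "integrable lebesgue h" and box: "\<And>a b. (LINT x|lebesgue. indicator (box a b) x * h x) = 0"
    and UNIV0: "(LINT x|lebesgue. h x) = 0"
  shows "AE x in lebesgue. h x = 0"
proof -
  \<comment> \<open>A Borel representative, because the sets generated by boxes are Borel and not
    merely Lebesgue measurable.\<close>
  obtain h' where h': "h' \<in> borel_measurable lborel" "AE x in lborel. h x = h' x"
    using completion_ex_borel_measurable_real[of h lborel] h by auto
  have AE': "AE x in lebesgue. h x = h' x"
    using h'(2) by (rule AE_completion)
  have int': "integrable lebesgue h'"
    using h'(1) by (intro integrable_cong_AE_imp[OF h _ AE'] measurable_completion) simp
  then have int'': "integrable lborel h'" using h'(1) by (simp add: integrable_completion)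
  have eq: "(LINT x:A|lborel. h' x) = (LINT x|lebesgue. indicator A x * h x)" if "A \<in> sets borel" for A
  proof -
    have "(LINT x:A|lborel. h' x) = (LINT x|lebesgue. indicator A x * h' x)"
      unfolding set_lebesgue_integral_def using that h'(1) by (subst integral_completion) auto
    also have "\<dots> = (LINT x|lebesgue. indicator A x * h x)"
    proof (rule integral_cong_AE)
      have [measurable]: "A \<in> sets lebesgue" using that by simp
      show "(\<lambda>x. indicator A x * h' x) \<in> borel_measurable lebesgue"
        using int' by measurable
      show "(\<lambda>x. indicator A x * h x) \<in> borel_measurable lebesgue"
        using h by measurable
      show "AE x in lebesgue. indicator A x * h' x = indicator A x * h x"
        using AE' by eventually_elim simp
    qed
    finally show ?thesis .
  qed
  have si: "set_integrable lborel A h'" if "A \<in> sets borel" for A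
    using that int'' unfolding set_integrable_def by (intro integrable_mult_indicator) auto
  have "(LINT x:A|lborel. h' x) = 0" if "A \<in> sets borel" for A
  proof -
    \<comment> \<open>Dynkin argument: open boxes form an intersection-stable generator, and the
      sets over which \<open>h'\<close> integrates to 0 are closed under disjoint unions and, thanks
      to \<open>UNIV0\<close>, under complements.\<close>
    let ?G = "range (\<lambda>(a, b). box a b) :: (real^'d) set set"
    have "sets (borel :: (real^'d) measure) = sigma_sets UNIV ?G"
      by (subst borel_eq_box) (simp add: sets_measure_of)
    moreover have "Int_stable ?G"
    proof (rule Int_stableI)
      fix X Y assume "X \<in> ?G" "Y \<in> ?G"
      then obtain a b c d where "X = box a b" "Y = box c d" by auto
      then show "X \<inter> Y \<in> ?G"
        by (auto simp: box_Int_box image_iff)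
    qed
    ultimately show ?thesis
    proof (rule_tac sigma_sets_induct_disjoint[of ?G UNIV A])
      show "A \<in> sigma_sets UNIV ?G"
        if "sets (borel :: (real^'d) measure) = sigma_sets UNIV ?G" using that \<open>A \<in> sets borel\<close> by simp
    next
      fix X assume "X \<in> ?G"
      then show "(LINT x:X|lborel. h' x) = 0" by (auto simp: eq box)
    next
      show "(LINT x:{}|lborel. h' x) = 0" by (simp add: set_lebesgue_integral_def)
    next
      fix X assume s: "sets (borel :: (real^'d) measure) = sigma_sets UNIV ?G"
        and X: "X \<in> sigma_sets UNIV ?G" "(LINT x:X|lborel. h' x) = 0"
      then have Xb: "X \<in> sets borel" by simp
      have "(LINT x:UNIV|lborel. h' x) = (LINT x:X|lborel. h' x) + (LINT x:UNIV - X|lborel. h' x)"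
        by (subst set_integral_Un[symmetric]) (use Xb si in auto)
      moreover have "(LINT x:UNIV|lborel. h' x) = 0" by (subst eq) (auto simp: UNIV0)
      ultimately show "(LINT x:UNIV - X|lborel. h' x) = 0" using X by simp
    next
      fix X :: "nat \<Rightarrow> (real^'d) set"
      assume s: "sets (borel :: (real^'d) measure) = sigma_sets UNIV ?G" and d: "disjoint_family X"
        and X: "range X \<subseteq> sigma_sets UNIV ?G" "\<And>i. (LINT x:X i|lborel. h' x) = 0"
      have Xb: "X i \<in> sets borel" for i using s X by auto
      have "(LINT x:(\<Union>i. X i)|lborel. h' x) = (\<Sum>i. LINT x:X i|lborel. h' x)"
        by (rule lebesgue_integral_countable_add) (use Xb d si in \<open>auto simp: disjoint_family_on_def\<close>)
      then show "(LINT x:(\<Union>i. X i)|lborel. h' x) = 0" using X by simp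
    qed auto
  qed
  then have "AE x in lborel. h' x = 0"
    by (intro sigma_finite_measure.density_zero[OF sigma_finite_lborel int'']) auto
  then have "AE x in lborel. h x = 0" using h'(2) by eventually_elim simp
  then show ?thesis by (rule AE_completion)
qed

text \<open>Bumps reduce the claim to indicators of boxes whose closure lies in the domain. The
  result is then local, one closed box at a time, and countably many closed boxes cover the open
  set.\<close>

lemma fundamental_lemma:
  fixes g :: "real^'d::finite \<Rightarrow> real"
  assumes \<Omega>: "open \<Omega>" and g: "integrable (lebesgue_on \<Omega>) g"
    and test: "\<And>\<phi>. test_fun \<Omega> \<phi> \<Longrightarrow> (LINT x|lebesgue_on \<Omega>. g x * \<phi> x) = 0"
  shows "AE x in lebesgue_on \<Omega>. g x = 0"
proof -
  have \<Omega>m [measurable]: "\<Omega> \<in> sets lebesgue" using \<Omega> by (simp add: borel_open)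
  have gm [measurable]: "g \<in> borel_measurable (lebesgue_on \<Omega>)" using g by auto
  have box0: "(LINT x|lebesgue_on \<Omega>. g x * indicator (box a b) x) = 0" if "cbox a b \<subseteq> \<Omega>" for a b
  proof (rule LIMSEQ_unique)
    show "(\<lambda>n. LINT x|lebesgue_on \<Omega>. g x * box_bump a b n x) \<longlonglongrightarrow> (LINT x|lebesgue_on \<Omega>. g x * indicator (box a b) x)"
    proof (rule integral_dominated_convergence)
      show "integrable (lebesgue_on \<Omega>) (\<lambda>x. \<bar>g x\<bar>)" using g by simp
      have bm: "box_bump a b n \<in> borel_measurable (lebesgue_on \<Omega>)" for n
        by (intro continuous_imp_measurable_on_sets_lebesgue smooth_fun_continuous smooth_fun_box_bump \<Omega>m)
      then show "(\<lambda>x. g x * box_bump a b n x) \<in> borel_measurable (lebesgue_on \<Omega>)" for n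
        by measurable
      have "(indicator (box a b) :: real^'d \<Rightarrow> real) \<in> borel_measurable (lebesgue_on \<Omega>)"
        by (intro measurable_restrict_space1 borel_measurable_indicator) auto
      then show "(\<lambda>x. g x * indicator (box a b) x) \<in> borel_measurable (lebesgue_on \<Omega>)"
        by measurable
      show "AE x in lebesgue_on \<Omega>. (\<lambda>n. g x * box_bump a b n x) \<longlonglongrightarrow> g x * indicator (box a b) x"
        by (intro AE_I2 tendsto_mult tendsto_const box_bump_tendsto)
      show "AE x in lebesgue_on \<Omega>. norm (g x * box_bump a b n x) \<le> \<bar>g x\<bar>" for n
        using box_bump_bounds[of a b n] by (intro AE_I2) (simp add: abs_mult mult_left_le)
    qed
    show "(\<lambda>n. LINT x|lebesgue_on \<Omega>. g x * box_bump a b n x) \<longlonglongrightarrow> 0"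
      by (simp add: test test_fun_box_bump that)
  qed
  have cbox0: "AE x in lebesgue. x \<in> cbox c d \<longrightarrow> g x = 0" if cd: "cbox c d \<subseteq> \<Omega>" for c d
  proof -
    \<comment> \<open>The cutoff confines every test box to (c, d), where \<open>box0\<close>
      applies, while \<open>h\<close> itself lives on the whole space as the Dynkin argument
      demands.\<close>
    define h where "h x = (if x \<in> \<Omega> then indicator (box c d) x * g x else 0)" for x
    have "integrable (lebesgue_on \<Omega>) (\<lambda>x. indicator (box c d) x *\<^sub>R g x)"
      using g cd box_subset_cbox[of c d] by (intro integrable_mult_indicator) (auto simp: sets_restrict_space_iff)
    then have "integrable lebesgue h"
      unfolding h_def by (subst Lebesgue_Measure.integrable_restrict_UNIV) auto
    moreover have z: "(LINT x|lebesgue. indicator (box a b) x * h x) = 0" for a b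
    proof -
      \<comment> \<open>The closed box with the corners of the intersection is sure to lie in
        \<open>cbox c d\<close> only if the intersection is nonempty; the empty one gets the
        reversed corners 1 and 0.\<close>
      obtain u v where uv: "box a b \<inter> box c d = box u v" "cbox u v \<subseteq> cbox c d \<or> box u v = {}"
      proof (cases "box a b \<inter> box c d = {}")
        case True
        moreover have "box 1 (0 :: real^'d) = {}" by (simp add: interval_eq_empty_cart)
        ultimately show ?thesis by (intro that[of 1 0]) simp_all
      next
        case False
        obtain u v where uv: "box a b \<inter> box c d = box u v"
          unfolding box_Int_box by blast
        then have "closure (box u v) \<subseteq> closure (box c d)"
          by (metis Int_lower2 closure_mono)
        then have "cbox u v \<subseteq> cbox c d" using False uv
          by (metis Int_empty_right closure_box)
        then show ?thesis using uv that by blast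
      qed
      have "(LINT x|lebesgue. indicator (box a b) x * h x)
          = (LINT x|lebesgue. (if x \<in> \<Omega> then g x * indicator (box u v) x else 0))"
        unfolding h_def uv(1)[symmetric] by (intro Bochner_Integration.integral_cong) (auto simp: indicator_def)
      also have "\<dots> = (LINT x|lebesgue_on \<Omega>. g x * indicator (box u v) x)"
        by (rule Lebesgue_Measure.integral_restrict_UNIV) simp
      also have "\<dots> = 0" using box0[of u v] uv(2) cd by auto
      finally show ?thesis .
    qed
    moreover have "(LINT x|lebesgue. h x) = 0"
    proof -
      have "(LINT x|lebesgue. h x) = (LINT x|lebesgue. indicator (box c d) x * h x)"
        unfolding h_def by (intro Bochner_Integration.integral_cong) (auto simp: indicator_def)
      then show ?thesis by (simp add: z)
    qed
    ultimately have "AE x in lebesgue. h x = 0" by (rule lebesgue_eq_0_if_box_integrals_0)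
    \<comment> \<open>The integrals only see the open box; its faces form a null set.\<close>
    moreover have "AE x in lebesgue. x \<notin> cbox c d - box c d"
      using negligible_frontier_interval[of c d] by (intro AE_not_in) (simp add: negligible_iff_null_sets)
    ultimately show ?thesis
      by eventually_elim (use cd in \<open>auto simp: h_def split: if_splits\<close>)
  qed
  obtain \<D> where D: "countable \<D>" "\<D> \<subseteq> Pow \<Omega>" "\<And>X. X \<in> \<D> \<Longrightarrow> \<exists>a b. X = cbox a b" "\<Union>\<D> = \<Omega>"
    using open_countable_Union_open_cbox[OF \<Omega>] by metis
  have "AE x in lebesgue. \<forall>X\<in>\<D>. x \<in> X \<longrightarrow> g x = 0"
    unfolding AE_ball_countable[OF D(1)] using D(2,3) cbox0 by blast
  then have "AE x in lebesgue. x \<in> \<Omega> \<longrightarrow> g x = 0"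
    by eventually_elim (use D(4) in blast)
  then show ?thesis by (simp add: AE_restrict_space_iff)
qed

section \<open>Integration by parts\<close>

lemma smooth_fun_directional_derivative:
  assumes "smooth_fun \<phi>"
  shows "((\<lambda>s. \<phi> (x + s *\<^sub>R axis i 1)) has_real_derivative pd i \<phi> (x + s *\<^sub>R axis i 1)) (at s)"
proof -
  have "((\<lambda>s. x + s *\<^sub>R axis i 1) has_derivative (\<lambda>h. h *\<^sub>R axis i 1)) (at s)"
    by (auto intro!: derivative_eq_intros)
  from has_derivative_compose[OF this has_derivative_frechet[OF smooth_fun_differentiable[OF assms]]]
  show ?thesis
    unfolding has_field_derivative_def pd_def
    using linear_frechet_derivative[OF smooth_fun_differentiable[OF assms], of "x + s *\<^sub>R axis i 1"]
    by (simp add: linear_cmul mult_commute_abs)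
qed

lemma eq_0_outside_support: "x \<notin> closure {x. \<phi> x \<noteq> 0} \<Longrightarrow> \<phi> x = 0"
  using closure_subset[of "{x. \<phi> x \<noteq> 0}"] by auto

lemma pd_eq_0_outside_support:
  assumes "x \<notin> closure {x. \<phi> x \<noteq> 0}"
  shows "pd i \<phi> x = 0"
proof -
  have "(\<phi> has_derivative (\<lambda>h. 0)) (at x)"
  proof (rule has_derivative_transform_within_open[OF has_derivative_const])
    show "open (- closure {x. \<phi> x \<noteq> 0})" "x \<in> - closure {x. \<phi> x \<noteq> 0}"
      using assms by auto
    show "0 = \<phi> y" if "y \<in> - closure {x. \<phi> x \<noteq> 0}" for y
      using that eq_0_outside_support[of y \<phi>] by simp
  qed
  then show ?thesis by (simp add: pd_eqI)
qed

lemma pd_support: "closure {x. pd i \<phi> x \<noteq> 0} \<subseteq> closure {x. \<phi> x \<noteq> 0}"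
  by (rule closure_minimal) (auto intro: ccontr dest: pd_eq_0_outside_support)

lemma compact_support_bounded:
  fixes f :: "'a::topological_space \<Rightarrow> real"
  assumes "continuous_on UNIV f" "compact K" "\<And>x. x \<notin> K \<Longrightarrow> f x = 0"
  obtains B where "0 < B" "\<And>x. \<bar>f x\<bar> \<le> B"
proof -
  have "bounded (f ` K)"
    by (intro compact_imp_bounded compact_continuous_image continuous_on_subset[OF assms(1)] assms) simp
  then obtain B where B: "0 < B" "\<And>x. x \<in> K \<Longrightarrow> \<bar>f x\<bar> \<le> B"
    unfolding bounded_pos by auto
  then have "\<bar>f x\<bar> \<le> B" for x using assms(3)[of x] by (cases "x \<in> K") auto
  then show ?thesis using B(1) that by blast
qed

lemma lborel_integral_shift:
  fixes f :: "'a::euclidean_space \<Rightarrow> real"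
  assumes "f \<in> borel_measurable borel"
  shows "(LINT x|lborel. f (x + c)) = (LINT x|lborel. f x)"
proof -
  have "(LINT x|lborel. f x) = (LINT x|distr lborel borel ((+) c). f x)"
    by (simp add: lborel_distr_plus)
  also have "\<dots> = (LINT x|lborel. f (c + x))"
    by (rule integral_distr) (use assms in auto)
  finally show ?thesis by (simp add: add.commute)
qed

text \<open>The difference quotients of \<open>\<phi>\<close> have integral zero by translation invariance of Lebesgue measure.\<close>

lemma integral_pd_eq_0:
  assumes \<phi>: "smooth_fun \<phi>" and K: "compact (closure {x. \<phi> x \<noteq> 0})"
  shows "(LINT x|lborel. pd i \<phi> x) = 0"
proof -
  let ?e = "axis i 1 :: real^'a"
  have cont: "continuous_on UNIV (pd i \<phi>)" "continuous_on UNIV \<phi>"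
    using \<phi> by (auto intro: smooth_fun_continuous smooth_fun_pd)
  obtain B where B: "0 < B" "\<And>x. \<bar>pd i \<phi> x\<bar> \<le> B"
    by (rule compact_support_bounded[OF cont(1) K]) (auto intro: pd_eq_0_outside_support)
  obtain r where r: "\<And>x. x \<in> closure {x. \<phi> x \<noteq> 0} \<Longrightarrow> norm x \<le> r"
    using compact_imp_bounded[OF K] unfolding bounded_iff by blast
  have out: "\<phi> x = 0" if "norm x > r" for x
    using r[of x] that by (intro eq_0_outside_support[of x \<phi>]) auto
  define q where "q n x = real (Suc n) * (\<phi> (x + inverse (real (Suc n)) *\<^sub>R ?e) - \<phi> x)" for n x
  have [measurable]: "\<phi> \<in> borel_measurable borel" "pd i \<phi> \<in> borel_measurable borel"
    using cont by (auto intro: borel_measurable_continuous_onI)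
  obtain B' where B': "0 < B'" "\<And>x. \<bar>\<phi> x\<bar> \<le> B'"
    by (rule compact_support_bounded[OF cont(2) K]) (auto intro: eq_0_outside_support[of _ \<phi>])
  have int_bound: "integrable lborel f" if "f \<in> borel_measurable borel" "\<And>x. \<bar>f x\<bar> \<le> C" "\<And>x. norm x > s \<Longrightarrow> f x = 0"
    for f :: "real^'a \<Rightarrow> real" and C s
  proof (rule Bochner_Integration.integrable_bound)
    show "integrable lborel (\<lambda>x::real^'a. C * indicator (cball 0 s) x)"
      by (intro integrable_mult_right integrable_real_indicator) (simp_all add: emeasure_bounded_finite[OF bounded_cball, unfolded infinity_ennreal_def])
    show "AE x in lborel. norm (f x) \<le> norm (C * indicator (cball 0 s) x)"
      using that(2,3) by (intro AE_I2) (auto simp: indicator_def not_le intro: order_trans[OF _ abs_ge_self])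
  qed (use that in simp)
  have int\<phi>: "integrable lborel \<phi>" by (rule int_bound[OF _ B'(2) out]) simp
  have int\<phi>s: "integrable lborel (\<lambda>x. \<phi> (x + c))" for c
  proof (rule int_bound[of _ B' "r + norm c"])
    fix x :: "real^'a" assume "norm x > r + norm c"
    then show "\<phi> (x + c) = 0" using norm_triangle_ineq4[of "x + c" c] by (intro out) simp
  qed (use B' in auto)
  have "(LINT x|lborel. q n x) = 0" for n
    unfolding q_def using int\<phi> int\<phi>s lborel_integral_shift[of \<phi>] by simp
  moreover have "(\<lambda>n. LINT x|lborel. q n x) \<longlonglongrightarrow> (LINT x|lborel. pd i \<phi> x)"
  proof (rule integral_dominated_convergence)
    \<comment> \<open>The quotients vanish outside the ball of radius r + 1, since the shift has
      length at most 1; their size is bounded by the mean value theorem.\<close>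
    show "integrable lborel (\<lambda>x::real^'a. B * indicator (cball 0 (r + 1)) x)"
      by (intro integrable_mult_right integrable_real_indicator) (simp_all add: emeasure_bounded_finite[OF bounded_cball, unfolded infinity_ennreal_def])
    show "q n \<in> borel_measurable lborel" for n unfolding q_def by measurable
    show "pd i \<phi> \<in> borel_measurable lborel" by simp
    have "(\<lambda>n. q n x) \<longlonglongrightarrow> pd i \<phi> x" for x
    proof -
      have "((\<lambda>h. (\<phi> (x + (0 + h) *\<^sub>R ?e) - \<phi> (x + 0 *\<^sub>R ?e)) / h) \<longlongrightarrow> pd i \<phi> (x + 0 *\<^sub>R ?e)) (at 0)"
        using smooth_fun_directional_derivative[OF \<phi>, of x i 0] unfolding DERIV_def .
      moreover have "filterlim (\<lambda>n. inverse (real (Suc n))) (at 0) sequentially"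
        unfolding filterlim_at using LIMSEQ_inverse_real_of_nat by auto
      ultimately have "(\<lambda>n. (\<phi> (x + (0 + inverse (real (Suc n))) *\<^sub>R ?e) - \<phi> (x + 0 *\<^sub>R ?e)) / inverse (real (Suc n)))
          \<longlonglongrightarrow> pd i \<phi> (x + 0 *\<^sub>R ?e)"
        by (rule filterlim_compose)
      then show ?thesis by (simp add: q_def divide_inverse mult.commute)
    qed
    then show "AE x in lborel. (\<lambda>n. q n x) \<longlonglongrightarrow> pd i \<phi> x" by simp
    show "AE x in lborel. norm (q n x) \<le> B * indicator (cball 0 (r + 1)) x" for n
    proof (rule AE_I2)
      fix x :: "real^'a"
      define h where "h = inverse (real (Suc n))"
      have h: "0 < h" "h \<le> 1" by (auto simp: h_def inverse_le_1_iff)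
      have "\<exists>z. 0 < z \<and> z < h \<and> \<phi> (x + h *\<^sub>R ?e) - \<phi> (x + 0 *\<^sub>R ?e) = (h - 0) * pd i \<phi> (x + z *\<^sub>R ?e)"
        using h by (intro MVT2 smooth_fun_directional_derivative \<phi>)
      then obtain z where z: "\<phi> (x + h *\<^sub>R ?e) - \<phi> x = h * pd i \<phi> (x + z *\<^sub>R ?e)" by auto
      have "q n x = pd i \<phi> (x + z *\<^sub>R ?e)"
        unfolding q_def h_def[symmetric] z using h by (simp add: h_def)
      then have le: "\<bar>q n x\<bar> \<le> B" using B by simp
      show "norm (q n x) \<le> B * indicator (cball 0 (r + 1)) x"
      proof (cases "norm x \<le> r + 1")
        case True then show ?thesis using le by simp
      next
        case False
        have "norm x \<le> norm (x + h *\<^sub>R ?e) + norm (h *\<^sub>R ?e)"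
          using norm_triangle_ineq4[of "x + h *\<^sub>R ?e" "h *\<^sub>R ?e"] by simp
        then have "norm (x + h *\<^sub>R ?e) > r" using False h by (simp add: norm_axis_1)
        then have "\<phi> (x + h *\<^sub>R ?e) = 0" "\<phi> x = 0" using False by (auto intro: out)
        then show ?thesis using False B by (simp add: q_def h_def)
      qed
    qed
  qed
  ultimately show ?thesis by (simp add: LIMSEQ_const_iff)
qed

lemma test_fun_smooth: "test_fun \<Omega> \<phi> \<Longrightarrow> smooth_fun \<phi>"
  by (simp add: test_fun_def)

lemma test_fun_zero_outside: "test_fun \<Omega> \<phi> \<Longrightarrow> x \<notin> \<Omega> \<Longrightarrow> \<phi> x = 0"
  unfolding test_fun_def by (intro eq_0_outside_support[of x \<phi>]) auto

lemma test_fun_mult: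
  assumes "test_fun \<Omega> \<phi>" "smooth_fun \<psi>"
  shows "test_fun \<Omega> (\<lambda>x. \<phi> x * \<psi> x)"
proof -
  have sub: "closure {x. \<phi> x * \<psi> x \<noteq> 0} \<subseteq> closure {x. \<phi> x \<noteq> 0}"
    by (intro closure_mono) auto
  then have "compact (closure {x. \<phi> x * \<psi> x \<noteq> 0})"
    using assms(1) unfolding test_fun_def compact_eq_bounded_closed by (auto intro: bounded_subset)
  then show ?thesis using assms sub unfolding test_fun_def by (auto intro: smooth_fun_mult)
qed

lemma test_fun_bounded:
  assumes "test_fun \<Omega> \<phi>"
  obtains B where "0 < B" "\<And>x. \<bar>\<phi> x\<bar> \<le> B"
proof (rule compact_support_bounded)
  show "continuous_on UNIV \<phi>" by (intro smooth_fun_continuous test_fun_smooth[OF assms])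
  show "compact (closure {x. \<phi> x \<noteq> 0})" using assms by (simp add: test_fun_def)
  show "\<phi> x = 0" if "x \<notin> closure {x. \<phi> x \<noteq> 0}" for x by (rule eq_0_outside_support[OF that])
qed (rule that)

lemma test_fun_pd:
  assumes "test_fun \<Omega> \<phi>"
  shows "test_fun \<Omega> (pd i \<phi>)"
proof -
  have "compact (closure {x. pd i \<phi> x \<noteq> 0})"
    using assms pd_support[of i \<phi>] unfolding test_fun_def compact_eq_bounded_closed
    by (auto intro: bounded_subset)
  then show ?thesis
    using assms pd_support[of i \<phi>] unfolding test_fun_def by (auto intro: smooth_fun_pd)
qed

text \<open>The integrand is a partial derivative of the product, which inherits compact support
  from \<phi> alone. Extension by 0 turns the integral into one over the whole space.\<close>

lemma test_fun_integration_by_parts: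
  assumes \<Omega>: "open \<Omega>" and \<phi>: "test_fun \<Omega> \<phi>" and \<psi>: "smooth_fun \<psi>"
  shows "(LINT x|lebesgue_on \<Omega>. \<phi> x * pd i \<psi> x + pd i \<phi> x * \<psi> x) = 0"
proof -
  let ?f = "\<lambda>x. \<phi> x * \<psi> x"
  have t: "test_fun \<Omega> ?f" by (rule test_fun_mult[OF \<phi> \<psi>])
  have eq: "pd i ?f = (\<lambda>x. \<phi> x * pd i \<psi> x + pd i \<phi> x * \<psi> x)"
    using test_fun_smooth[OF \<phi>] \<psi> by (intro ext pd_mult smooth_fun_differentiable)
  have "(LINT x|lebesgue_on \<Omega>. pd i ?f x) = (LINT x|lebesgue. (if x \<in> \<Omega> then pd i ?f x else 0))"
    using \<Omega> by (subst Lebesgue_Measure.integral_restrict_UNIV) (auto simp: borel_open)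
  also have "(\<lambda>x. if x \<in> \<Omega> then pd i ?f x else 0) = pd i ?f"
    using test_fun_zero_outside[OF test_fun_pd[OF t]] by auto
  also have "(LINT x|lebesgue. pd i ?f x) = (LINT x|lborel. pd i ?f x)"
    by (intro integral_completion) (simp add: borel_measurable_continuous_onI smooth_fun_continuous smooth_fun_pd test_fun_smooth[OF t])
  also have "\<dots> = 0"
    using t by (intro integral_pd_eq_0) (auto simp: test_fun_def)
  finally show ?thesis unfolding eq .
qed

section \<open>Weak derivatives\<close>

lemma l2n_tendsto_0_mono:
  assumes "b \<longlonglongrightarrow> 0" "\<And>n. l2n \<Omega> (f n) \<le> b n"
  shows "(\<lambda>n. l2n \<Omega> (f n)) \<longlonglongrightarrow> 0"
proof (rule tendsto_sandwich[OF _ _ tendsto_const assms(1)])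
  show "\<forall>\<^sub>F n in sequentially. 0 \<le> l2n \<Omega> (f n)" by simp
  show "\<forall>\<^sub>F n in sequentially. l2n \<Omega> (f n) \<le> b n" using assms(2) by simp
qed

lemma Linf_bound:
  assumes "Linf \<Omega> f"
  obtains C where "0 < C" "AE x in lebesgue_on \<Omega>. norm (f x) \<le> C"
proof -
  obtain C where C: "AE x in lebesgue_on \<Omega>. norm (f x) \<le> C" using assms by (auto simp: Linf_def)
  then have "AE x in lebesgue_on \<Omega>. norm (f x) \<le> \<bar>C\<bar> + 1" by eventually_elim auto
  then show ?thesis by (intro that[of "\<bar>C\<bar> + 1"]) auto
qed

lemma Linf_mult_bound:
  fixes g f :: "real^'d::finite \<Rightarrow> real"
  assumes "AE x in lebesgue_on \<Omega>. norm (g x) \<le> C"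
  shows "AE x in lebesgue_on \<Omega>. norm (g x * f x) \<le> C * norm (f x)"
  using assms by eventually_elim (simp add: abs_mult mult_right_mono)

lemma Linf_inner_bound:
  fixes \<beta> f :: "real^'d::finite \<Rightarrow> real^'d"
  assumes "AE x in lebesgue_on \<Omega>. norm (\<beta> x) \<le> C"
  shows "AE x in lebesgue_on \<Omega>. norm (inner (\<beta> x) (f x)) \<le> C * norm (f x)"
  using assms
proof eventually_elim
  case (elim x)
  then show ?case
    using Cauchy_Schwarz_ineq2[of "\<beta> x" "f x"] mult_right_mono[OF elim, of "norm (f x)"] by simp
qed

lemma L2_Linf_mult:
  fixes g f :: "real^'d::finite \<Rightarrow> real"
  assumes g: "Linf \<Omega> g" and f: "L2 \<Omega> f"
  shows "L2 \<Omega> (\<lambda>x. g x * f x)"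
proof -
  obtain C where C: "AE x in lebesgue_on \<Omega>. norm (g x) \<le> C" using Linf_bound[OF g] .
  have "(\<lambda>x. g x * f x) \<in> borel_measurable (lebesgue_on \<Omega>)"
    using g f by (intro borel_measurable_times) (auto simp: Linf_def L2_def)
  then show ?thesis by (rule L2_dominated[OF f _ Linf_mult_bound[OF C]])
qed

lemma L2_Linf_inner:
  fixes \<beta> f :: "real^'d::finite \<Rightarrow> real^'d"
  assumes b: "Linf \<Omega> \<beta>" and f: "L2 \<Omega> f"
  shows "L2 \<Omega> (\<lambda>x. inner (\<beta> x) (f x))"
proof -
  obtain C where C: "AE x in lebesgue_on \<Omega>. norm (\<beta> x) \<le> C" using Linf_bound[OF b] .
  have "(\<lambda>x. inner (\<beta> x) (f x)) \<in> borel_measurable (lebesgue_on \<Omega>)"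
    using b f by (intro borel_measurable_inner) (auto simp: Linf_def L2_def)
  then show ?thesis by (rule L2_dominated[OF f _ Linf_inner_bound[OF C]])
qed

lemma l2n_Linf_mult_tendsto:
  fixes g u :: "real^'d::finite \<Rightarrow> real"
  assumes g: "Linf \<Omega> g" and L: "\<And>n. L2 \<Omega> (f n)" "L2 \<Omega> u" and lim: "(\<lambda>n. l2n \<Omega> (\<lambda>x. f n x - u x)) \<longlonglongrightarrow> 0"
  shows "(\<lambda>n. l2n \<Omega> (\<lambda>x. g x * f n x - g x * u x)) \<longlonglongrightarrow> 0"
proof -
  obtain C where C: "0 < C" "AE x in lebesgue_on \<Omega>. norm (g x) \<le> C" using Linf_bound[OF g] .
  have d: "L2 \<Omega> (\<lambda>x. f n x - u x)" for n by (intro L2_diff L)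
  have "l2n \<Omega> (\<lambda>x. g x * (f n x - u x)) \<le> C * l2n \<Omega> (\<lambda>x. f n x - u x)" for n
    by (rule l2n_dominated[OF d L2_Linf_mult[OF g d] less_imp_le[OF C(1)] Linf_mult_bound[OF C(2)]])
  then have le: "l2n \<Omega> (\<lambda>x. g x * f n x - g x * u x) \<le> C * l2n \<Omega> (\<lambda>x. f n x - u x)" for n
    by (simp add: right_diff_distrib)
  have "(\<lambda>n. C * l2n \<Omega> (\<lambda>x. f n x - u x)) \<longlonglongrightarrow> 0"
    using tendsto_mult[OF tendsto_const lim, of C] by simp
  then show ?thesis by (rule l2n_tendsto_0_mono) (rule le)
qed

lemma l2n_Linf_inner_tendsto:
  fixes \<beta> u :: "real^'d::finite \<Rightarrow> real^'d"
  assumes g: "Linf \<Omega> \<beta>" and L: "\<And>n. L2 \<Omega> (f n)" "L2 \<Omega> u" and lim: "(\<lambda>n. l2n \<Omega> (\<lambda>x. f n x - u x)) \<longlonglongrightarrow> 0"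
  shows "(\<lambda>n. l2n \<Omega> (\<lambda>x. inner (\<beta> x) (f n x) - inner (\<beta> x) (u x))) \<longlonglongrightarrow> 0"
proof -
  obtain C where C: "0 < C" "AE x in lebesgue_on \<Omega>. norm (\<beta> x) \<le> C" using Linf_bound[OF g] .
  have d: "L2 \<Omega> (\<lambda>x. f n x - u x)" for n by (intro L2_diff L)
  have "l2n \<Omega> (\<lambda>x. inner (\<beta> x) (f n x - u x)) \<le> C * l2n \<Omega> (\<lambda>x. f n x - u x)" for n
    by (rule l2n_dominated[OF d L2_Linf_inner[OF g d] less_imp_le[OF C(1)] Linf_inner_bound[OF C(2)]])
  then have le: "l2n \<Omega> (\<lambda>x. inner (\<beta> x) (f n x) - inner (\<beta> x) (u x)) \<le> C * l2n \<Omega> (\<lambda>x. f n x - u x)" for n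
    by (simp add: inner_diff_right)
  have "(\<lambda>n. C * l2n \<Omega> (\<lambda>x. f n x - u x)) \<longlonglongrightarrow> 0"
    using tendsto_mult[OF tendsto_const lim, of C] by simp
  then show ?thesis by (rule l2n_tendsto_0_mono) (rule le)
qed

lemma L2_component:
  fixes G :: "real^'d::finite \<Rightarrow> real^'d"
  assumes "L2 \<Omega> G"
  shows "L2 \<Omega> (\<lambda>x. G x $ i)"
proof (rule L2_dominated[OF assms, where C = 1])
  have "(\<lambda>y::real^'d. y $ i) \<in> borel_measurable borel"
    by (intro borel_measurable_continuous_onI continuous_on_component continuous_on_id)
  then show "(\<lambda>x. G x $ i) \<in> borel_measurable (lebesgue_on \<Omega>)"
    by (rule measurable_compose[OF L2_measurable[OF assms]])
  show "AE x in lebesgue_on \<Omega>. norm (G x $ i) \<le> 1 * norm (G x)"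
    by (simp add: component_le_norm_cart)
qed

lemma is_weak_grad_l2ip:
  "is_weak_grad \<Omega> u G \<longleftrightarrow> (\<forall>\<phi>. test_fun \<Omega> \<phi> \<longrightarrow> (\<forall>i. l2ip \<Omega> u (pd i \<phi>) = - l2ip \<Omega> (\<lambda>x. G x $ i) \<phi>))"
  by (simp add: is_weak_grad_def l2ip_def)

lemma is_weak_div_l2ip:
  "is_weak_div \<Omega> \<sigma> q \<longleftrightarrow> (\<forall>\<phi>. test_fun \<Omega> \<phi> \<longrightarrow> l2ip \<Omega> \<sigma> (cgrad \<phi>) = - l2ip \<Omega> q \<phi>)"
  by (simp add: is_weak_div_def l2ip_def)

section \<open>Weak gradient and divergence on a bounded open set\<close>

locale bounded_open =
  fixes \<Omega> :: "(real^'d::finite) set"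
  assumes op: "open \<Omega>" and bdd: "bounded \<Omega>"
begin

text \<open>The place where boundedness of the domain enters: finite measure makes L2 functions
  integrable and bounded measurable functions, in particular test functions, square
  integrable.\<close>

lemma finite_measure_domain: "finite_measure (lebesgue_on \<Omega>)"
  using op bdd by (simp add: finite_measure_lebesgue_on lmeasurable_open)

lemma L2_integrable:
  fixes f :: "real^'d \<Rightarrow> real"
  assumes "L2 \<Omega> f"
  shows "integrable (lebesgue_on \<Omega>) f"
proof (rule finite_measure.square_integrable_imp_integrable[OF finite_measure_domain])
  show "f \<in> borel_measurable (lebesgue_on \<Omega>)" by (rule L2_measurable[OF assms])
  show "integrable (lebesgue_on \<Omega>) (\<lambda>x. (f x)\<^sup>2)" using assms by (simp add: L2_def)
qed

lemma L2_bounded: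
  assumes "f \<in> borel_measurable (lebesgue_on \<Omega>)" "\<And>x. norm (f x) \<le> C"
  shows "L2 \<Omega> f"
  unfolding L2_def
proof
  show "integrable (lebesgue_on \<Omega>) (\<lambda>x. (norm (f x))\<^sup>2)"
    using assms by (intro finite_measure.integrable_const_bound[OF finite_measure_domain, of _ "C\<^sup>2"])
      (auto simp: power_mono)
qed fact

lemma L2_test_fun:
  assumes "test_fun \<Omega> \<phi>"
  shows "L2 \<Omega> \<phi>"
proof -
  obtain B where "\<And>x. \<bar>\<phi> x\<bar> \<le> B" using test_fun_bounded[OF assms] by blast
  moreover have "\<phi> \<in> borel_measurable (lebesgue_on \<Omega>)"
    using op by (intro continuous_imp_measurable_on_sets_lebesgue smooth_fun_continuous test_fun_smooth[OF assms])
      (auto simp: borel_open)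
  ultimately show ?thesis by (intro L2_bounded) auto
qed

lemma L2_pd: "test_fun \<Omega> \<phi> \<Longrightarrow> L2 \<Omega> (pd i \<phi>)"
  by (intro L2_test_fun test_fun_pd)

lemma L2_cgrad:
  assumes "test_fun \<Omega> \<phi>"
  shows "L2 \<Omega> (cgrad \<phi>)"
proof -
  have "\<exists>B. \<forall>x. \<bar>pd i \<phi> x\<bar> \<le> B" for i using test_fun_bounded[OF test_fun_pd[OF assms, of i]] by blast
  then obtain B where B: "\<And>i x. \<bar>pd i \<phi> x\<bar> \<le> B i" by metis
  have "norm (cgrad \<phi> x) \<le> (\<Sum>i\<in>UNIV. B i)" for x
    by (rule order_trans[OF norm_le_l1_cart sum_mono]) (simp add: cgrad_def B)
  moreover have "cgrad \<phi> \<in> borel_measurable (lebesgue_on \<Omega>)"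
    unfolding cgrad_def using op
    by (intro continuous_imp_measurable_on_sets_lebesgue continuous_on_vec_lambda smooth_fun_continuous
        smooth_fun_pd test_fun_smooth[OF assms]) (auto simp: borel_open)
  ultimately show ?thesis by (intro L2_bounded)
qed

lemma L2_test_eq_imp_AE_eq:
  assumes "L2 \<Omega> f" "L2 \<Omega> g" "\<And>\<phi>. test_fun \<Omega> \<phi> \<Longrightarrow> l2ip \<Omega> f \<phi> = l2ip \<Omega> g \<phi>"
  shows "AE x in lebesgue_on \<Omega>. f x = g x"
proof -
  have "AE x in lebesgue_on \<Omega>. f x - g x = 0"
  proof (rule fundamental_lemma[OF op])
    show "integrable (lebesgue_on \<Omega>) (\<lambda>x. f x - g x)" by (intro L2_integrable L2_diff assms)
    show "(LINT x|lebesgue_on \<Omega>. (f x - g x) * \<phi> x) = 0" if "test_fun \<Omega> \<phi>" for \<phi>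
      using l2ip_diff_left[OF assms(1,2) L2_test_fun[OF that]] assms(3)[OF that] by (simp add: l2ip_def)
  qed
  then show ?thesis by eventually_elim simp
qed

lemma weak_grad_unique:
  assumes "L2 \<Omega> G" "L2 \<Omega> G'" "is_weak_grad \<Omega> u G" "is_weak_grad \<Omega> u G'"
  shows "AE x in lebesgue_on \<Omega>. G x = G' x"
proof -
  have "AE x in lebesgue_on \<Omega>. G x $ i = G' x $ i" for i
    using assms by (intro L2_test_eq_imp_AE_eq L2_component) (force simp: is_weak_grad_l2ip)+
  then have "AE x in lebesgue_on \<Omega>. \<forall>i\<in>UNIV. G x $ i = G' x $ i"
    by (intro AE_finite_allI) auto
  then show ?thesis by eventually_elim (simp add: vec_eq_iff)
qed

lemma weak_div_unique:
  assumes "L2 \<Omega> q" "L2 \<Omega> q'" "is_weak_div \<Omega> \<sigma> q" "is_weak_div \<Omega> \<sigma> q'"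
  shows "AE x in lebesgue_on \<Omega>. q x = q' x"
  using assms by (intro L2_test_eq_imp_AE_eq) (force simp: is_weak_div_l2ip)+

lemma wgrad_weak: "H1 \<Omega> u \<Longrightarrow> L2 \<Omega> (wgrad \<Omega> u) \<and> is_weak_grad \<Omega> u (wgrad \<Omega> u)"
  unfolding H1_def wgrad_def by (rule someI_ex[of "\<lambda>G. L2 \<Omega> G \<and> is_weak_grad \<Omega> u G"]) blast

lemma wdiv_weak: "Hdiv \<Omega> \<sigma> \<Longrightarrow> L2 \<Omega> (wdiv \<Omega> \<sigma>) \<and> is_weak_div \<Omega> \<sigma> (wdiv \<Omega> \<sigma>)"
  unfolding Hdiv_def wdiv_def by (rule someI_ex[of "\<lambda>q. L2 \<Omega> q \<and> is_weak_div \<Omega> \<sigma> q"]) blast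

text \<open>\<open>wgrad\<close> picks some representative, and uniqueness allows any explicitly
  known weak gradient to be used in its place up to a null set. \<open>wdiv_AE_eq\<close> does the
  same for the divergence.\<close>

lemma wgrad_AE_eq:
  assumes "L2 \<Omega> u" "L2 \<Omega> G" "is_weak_grad \<Omega> u G"
  shows "H1 \<Omega> u" "AE x in lebesgue_on \<Omega>. wgrad \<Omega> u x = G x"
proof -
  show "H1 \<Omega> u" using assms by (auto simp: H1_def)
  then show "AE x in lebesgue_on \<Omega>. wgrad \<Omega> u x = G x"
    using wgrad_weak assms by (intro weak_grad_unique) auto
qed

lemma wdiv_AE_eq:
  assumes "L2 \<Omega> \<sigma>" "L2 \<Omega> q" "is_weak_div \<Omega> \<sigma> q"
  shows "Hdiv \<Omega> \<sigma>" "AE x in lebesgue_on \<Omega>. wdiv \<Omega> \<sigma> x = q x"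
proof -
  show "Hdiv \<Omega> \<sigma>" using assms by (auto simp: Hdiv_def)
  then show "AE x in lebesgue_on \<Omega>. wdiv \<Omega> \<sigma> x = q x"
    using wdiv_weak assms by (intro weak_div_unique) auto
qed

lemma is_weak_grad_add_scaleR:
  assumes "L2 \<Omega> u" "L2 \<Omega> v" "L2 \<Omega> G" "L2 \<Omega> H" "is_weak_grad \<Omega> u G" "is_weak_grad \<Omega> v H"
  shows "is_weak_grad \<Omega> (\<lambda>x. u x + c * v x) (\<lambda>x. G x + c *\<^sub>R H x)"
  unfolding is_weak_grad_l2ip
proof (intro allI impI)
  fix \<phi> i assume \<phi>: "test_fun \<Omega> \<phi>"
  have "l2ip \<Omega> (\<lambda>x. u x + c *\<^sub>R v x) (pd i \<phi>) = l2ip \<Omega> u (pd i \<phi>) + c * l2ip \<Omega> v (pd i \<phi>)"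
    using assms \<phi> by (subst l2ip_add_left) (auto intro: L2_scaleR L2_pd simp: l2ip_scaleR_left simp del: real_scaleR_def)
  moreover have "l2ip \<Omega> (\<lambda>x. G x $ i + c *\<^sub>R (H x $ i)) \<phi> = l2ip \<Omega> (\<lambda>x. G x $ i) \<phi> + c * l2ip \<Omega> (\<lambda>x. H x $ i) \<phi>"
    using assms \<phi> by (subst l2ip_add_left) (auto intro: L2_scaleR[OF L2_component] L2_component L2_test_fun[OF \<phi>] simp: l2ip_scaleR_left simp del: real_scaleR_def)
  ultimately show "l2ip \<Omega> (\<lambda>x. u x + c * v x) (pd i \<phi>) = - l2ip \<Omega> (\<lambda>x. (G x + c *\<^sub>R H x) $ i) \<phi>"
    using assms(5,6) \<phi> by (simp add: is_weak_grad_l2ip)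
qed

lemma is_weak_div_add_scaleR:
  assumes "L2 \<Omega> \<sigma>" "L2 \<Omega> \<tau>" "L2 \<Omega> p" "L2 \<Omega> q" "is_weak_div \<Omega> \<sigma> p" "is_weak_div \<Omega> \<tau> q"
  shows "is_weak_div \<Omega> (\<lambda>x. \<sigma> x + c *\<^sub>R \<tau> x) (\<lambda>x. p x + c * q x)"
  unfolding is_weak_div_l2ip
proof (intro allI impI)
  fix \<phi> assume \<phi>: "test_fun \<Omega> \<phi>"
  have "l2ip \<Omega> (\<lambda>x. \<sigma> x + c *\<^sub>R \<tau> x) (cgrad \<phi>) = l2ip \<Omega> \<sigma> (cgrad \<phi>) + c * l2ip \<Omega> \<tau> (cgrad \<phi>)"
    using assms \<phi> by (subst l2ip_add_left) (auto intro: L2_scaleR L2_cgrad simp: l2ip_scaleR_left)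
  moreover have "l2ip \<Omega> (\<lambda>x. p x + c *\<^sub>R q x) \<phi> = l2ip \<Omega> p \<phi> + c * l2ip \<Omega> q \<phi>"
    using assms \<phi> by (subst l2ip_add_left) (auto intro: L2_scaleR L2_test_fun[OF \<phi>] simp: l2ip_scaleR_left simp del: real_scaleR_def)
  ultimately show "l2ip \<Omega> (\<lambda>x. \<sigma> x + c *\<^sub>R \<tau> x) (cgrad \<phi>) = - l2ip \<Omega> (\<lambda>x. p x + c * q x) \<phi>"
    using assms(5,6) \<phi> by (simp add: is_weak_div_l2ip)
qed

lemma test_fun_weak_grad:
  assumes "test_fun \<Omega> \<psi>"
  shows "is_weak_grad \<Omega> \<psi> (cgrad \<psi>)"
  unfolding is_weak_grad_l2ip
proof (intro allI impI)
  fix \<phi> i assume \<phi>: "test_fun \<Omega> \<phi>"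
  have i: "integrable (lebesgue_on \<Omega>) (\<lambda>x. \<psi> x * pd i \<phi> x)" "integrable (lebesgue_on \<Omega>) (\<lambda>x. pd i \<psi> x * \<phi> x)"
    using L2_integrable_inner[OF L2_test_fun[OF assms] L2_pd[OF \<phi>]]
      L2_integrable_inner[OF L2_pd[OF assms] L2_test_fun[OF \<phi>]] by auto
  show "l2ip \<Omega> \<psi> (pd i \<phi>) = - l2ip \<Omega> (\<lambda>x. cgrad \<psi> x $ i) \<phi>"
    using test_fun_integration_by_parts[OF op assms test_fun_smooth[OF \<phi>], of i] i
    by (simp add: l2ip_def cgrad_def)
qed

text \<open>For a fixed test function both sides of the defining identity are continuous in L2; the
  weak gradient is a closed operator.\<close>

lemma is_weak_grad_limit:
  assumes L: "\<And>n. L2 \<Omega> (u n)" "L2 \<Omega> u'" "\<And>n. L2 \<Omega> (G n)" "L2 \<Omega> G'"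
    and w: "\<And>n. is_weak_grad \<Omega> (u n) (G n)"
    and u: "(\<lambda>n. l2n \<Omega> (\<lambda>x. u n x - u' x)) \<longlonglongrightarrow> 0" and G: "(\<lambda>n. l2n \<Omega> (\<lambda>x. G n x - G' x)) \<longlonglongrightarrow> 0"
  shows "is_weak_grad \<Omega> u' G'"
  unfolding is_weak_grad_l2ip
proof (intro allI impI)
  fix \<phi> i assume \<phi>: "test_fun \<Omega> \<phi>"
  have const: "(\<lambda>n. l2n \<Omega> (\<lambda>x. f x - f x :: real)) \<longlonglongrightarrow> 0" for f by (simp add: l2n_def l2ip_def)
  have Gi: "(\<lambda>n. l2n \<Omega> (\<lambda>x. G n x $ i - G' x $ i)) \<longlonglongrightarrow> 0"
  proof (rule l2n_tendsto_0_mono[OF G])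
    fix n
    have d: "L2 \<Omega> (\<lambda>x. G n x - G' x)" by (intro L2_diff L)
    have "l2n \<Omega> (\<lambda>x. (G n x - G' x) $ i) \<le> 1 * l2n \<Omega> (\<lambda>x. G n x - G' x)"
      by (rule l2n_dominated[OF d L2_component[OF d]])
        (simp_all add: component_le_norm_cart del: vector_minus_component)
    then show "l2n \<Omega> (\<lambda>x. G n x $ i - G' x $ i) \<le> l2n \<Omega> (\<lambda>x. G n x - G' x)" by simp
  qed
  have "(\<lambda>n. l2ip \<Omega> (u n) (pd i \<phi>)) \<longlonglongrightarrow> l2ip \<Omega> u' (pd i \<phi>)"
    by (rule l2ip_tendsto[OF L(1,2) _ _ u const]) (auto intro: L2_pd \<phi>)
  moreover have "(\<lambda>n. - l2ip \<Omega> (\<lambda>x. G n x $ i) \<phi>) \<longlonglongrightarrow> - l2ip \<Omega> (\<lambda>x. G' x $ i) \<phi>"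
    by (intro tendsto_minus l2ip_tendsto Gi const L2_component L L2_test_fun \<phi>)
  ultimately show "l2ip \<Omega> u' (pd i \<phi>) = - l2ip \<Omega> (\<lambda>x. G' x $ i) \<phi>"
    using w \<phi> by (simp add: is_weak_grad_l2ip LIMSEQ_unique)
qed

lemma is_weak_div_limit:
  assumes L: "\<And>n. L2 \<Omega> (\<sigma> n)" "L2 \<Omega> \<sigma>'" "\<And>n. L2 \<Omega> (q n)" "L2 \<Omega> q'"
    and w: "\<And>n. is_weak_div \<Omega> (\<sigma> n) (q n)"
    and s: "(\<lambda>n. l2n \<Omega> (\<lambda>x. \<sigma> n x - \<sigma>' x)) \<longlonglongrightarrow> 0" and q: "(\<lambda>n. l2n \<Omega> (\<lambda>x. q n x - q' x)) \<longlonglongrightarrow> 0"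
  shows "is_weak_div \<Omega> \<sigma>' q'"
  unfolding is_weak_div_l2ip
proof (intro allI impI)
  fix \<phi> assume \<phi>: "test_fun \<Omega> \<phi>"
  have const: "(\<lambda>n. l2n \<Omega> (\<lambda>x. f x - f x)) \<longlonglongrightarrow> 0" for f :: "_ \<Rightarrow> 'c::euclidean_space"
    by (simp add: l2n_def l2ip_def)
  have "(\<lambda>n. l2ip \<Omega> (\<sigma> n) (cgrad \<phi>)) \<longlonglongrightarrow> l2ip \<Omega> \<sigma>' (cgrad \<phi>)"
    by (rule l2ip_tendsto[OF L(1,2) _ _ s]) (auto intro: L2_cgrad \<phi> simp: l2n_def l2ip_def)
  moreover have "(\<lambda>n. - l2ip \<Omega> (q n) \<phi>) \<longlonglongrightarrow> - l2ip \<Omega> q' \<phi>"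
    by (intro tendsto_minus l2ip_tendsto q const L L2_test_fun \<phi>)
  ultimately show "l2ip \<Omega> \<sigma>' (cgrad \<phi>) = - l2ip \<Omega> q' \<phi>"
    using w \<phi> by (simp add: is_weak_div_l2ip LIMSEQ_unique)
qed

text \<open>The definition of \<open>H10\<close> involves the chosen gradient of a difference. This
  formula splits it into L2 distances of the functions and of the gradients.\<close>

lemma H1_norm_diff_test:
  assumes u: "L2 \<Omega> u" "L2 \<Omega> G" "is_weak_grad \<Omega> u G" and \<phi>: "test_fun \<Omega> \<phi>"
  shows "H1_norm \<Omega> (\<lambda>x. u x - \<phi> x) = sqrt ((l2n \<Omega> (\<lambda>x. u x - \<phi> x))\<^sup>2 + (l2n \<Omega> (\<lambda>x. G x - cgrad \<phi> x))\<^sup>2)"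
proof -
  have "is_weak_grad \<Omega> (\<lambda>x. u x - \<phi> x) (\<lambda>x. G x - cgrad \<phi> x)"
    using is_weak_grad_add_scaleR[OF u(1) L2_test_fun[OF \<phi>] u(2) L2_cgrad[OF \<phi>] u(3) test_fun_weak_grad[OF \<phi>], of "-1"]
    by simp
  note w = wgrad_AE_eq[OF L2_diff[OF u(1) L2_test_fun[OF \<phi>]] L2_diff[OF u(2) L2_cgrad[OF \<phi>]] this]
  have "l2n \<Omega> (wgrad \<Omega> (\<lambda>x. u x - \<phi> x)) = l2n \<Omega> (\<lambda>x. G x - cgrad \<phi> x)"
    using w wgrad_weak by (intro l2n_cong_AE L2_diff u L2_cgrad \<phi>) auto
  then show ?thesis by (simp add: H1_norm_def l2n_square[symmetric])
qed

lemma H10_approx: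
  assumes "H10 \<Omega> u"
  obtains \<phi> where "\<And>j. test_fun \<Omega> (\<phi> j)" "(\<lambda>j. l2n \<Omega> (\<lambda>x. \<phi> j x - u x)) \<longlonglongrightarrow> 0"
    "(\<lambda>j. l2n \<Omega> (\<lambda>x. cgrad (\<phi> j) x - wgrad \<Omega> u x)) \<longlonglongrightarrow> 0"
proof -
  obtain \<phi> where \<phi>: "\<And>j. test_fun \<Omega> (\<phi> j)" and lim: "(\<lambda>j. H1_norm \<Omega> (\<lambda>x. u x - \<phi> j x)) \<longlonglongrightarrow> 0"
    using assms unfolding H10_def by auto
  have u: "L2 \<Omega> u" "L2 \<Omega> (wgrad \<Omega> u)" "is_weak_grad \<Omega> u (wgrad \<Omega> u)"
    using assms wgrad_weak by (auto simp: H10_def H1_def)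
  have n: "H1_norm \<Omega> (\<lambda>x. u x - \<phi> j x)
      = sqrt ((l2n \<Omega> (\<lambda>x. \<phi> j x - u x))\<^sup>2 + (l2n \<Omega> (\<lambda>x. cgrad (\<phi> j) x - wgrad \<Omega> u x))\<^sup>2)" for j
    by (subst H1_norm_diff_test[OF u \<phi>]) (simp add: l2n_minus_commute[of \<Omega> u] l2n_minus_commute[of \<Omega> "wgrad \<Omega> u"])
  show ?thesis
  proof (rule that[OF \<phi>])
    show "(\<lambda>j. l2n \<Omega> (\<lambda>x. \<phi> j x - u x)) \<longlonglongrightarrow> 0"
      by (rule l2n_tendsto_0_mono[OF lim]) (simp add: n real_le_rsqrt)
    show "(\<lambda>j. l2n \<Omega> (\<lambda>x. cgrad (\<phi> j) x - wgrad \<Omega> u x)) \<longlonglongrightarrow> 0"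
      by (rule l2n_tendsto_0_mono[OF lim]) (simp add: n real_le_rsqrt)
  qed
qed

text \<open>Diagonal choice: for each n a test function within 1/(n+1) of \<open>u n\<close>, both
  in value and in gradient, so that these test functions approximate the limit.\<close>

lemma H10_limit:
  assumes H: "\<And>n. H10 \<Omega> (u n)" and L: "L2 \<Omega> u'" "L2 \<Omega> G'"
    and u: "(\<lambda>n. l2n \<Omega> (\<lambda>x. u n x - u' x)) \<longlonglongrightarrow> 0"
    and G: "(\<lambda>n. l2n \<Omega> (\<lambda>x. wgrad \<Omega> (u n) x - G' x)) \<longlonglongrightarrow> 0"
  shows "H10 \<Omega> u'" "AE x in lebesgue_on \<Omega>. wgrad \<Omega> u' x = G' x"
proof -
  have un: "L2 \<Omega> (u n)" "L2 \<Omega> (wgrad \<Omega> (u n))" "is_weak_grad \<Omega> (u n) (wgrad \<Omega> (u n))" for n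
    using H wgrad_weak by (auto simp: H10_def H1_def)
  have w: "is_weak_grad \<Omega> u' G'" by (rule is_weak_grad_limit[OF un(1) L(1) un(2) L(2) un(3) u G])
  note g = wgrad_AE_eq[OF L w]
  then show "AE x in lebesgue_on \<Omega>. wgrad \<Omega> u' x = G' x" by simp
  have "\<exists>\<phi>. test_fun \<Omega> \<phi> \<and> l2n \<Omega> (\<lambda>x. \<phi> x - u n x) < inverse (real (Suc n))
      \<and> l2n \<Omega> (\<lambda>x. cgrad \<phi> x - wgrad \<Omega> (u n) x) < inverse (real (Suc n))" for n
  proof -
    obtain \<phi> where \<phi>: "\<And>j. test_fun \<Omega> (\<phi> j)" "(\<lambda>j. l2n \<Omega> (\<lambda>x. \<phi> j x - u n x)) \<longlonglongrightarrow> 0"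
      "(\<lambda>j. l2n \<Omega> (\<lambda>x. cgrad (\<phi> j) x - wgrad \<Omega> (u n) x)) \<longlonglongrightarrow> 0"
      using H10_approx[OF H] by blast
    have "0 < inverse (real (Suc n))" by simp
    then have "\<forall>\<^sub>F j in sequentially. l2n \<Omega> (\<lambda>x. \<phi> j x - u n x) < inverse (real (Suc n))
      \<and> l2n \<Omega> (\<lambda>x. cgrad (\<phi> j) x - wgrad \<Omega> (u n) x) < inverse (real (Suc n))"
      by (intro eventually_conj order_tendstoD(2)[OF \<phi>(2)] order_tendstoD(2)[OF \<phi>(3)])
    then obtain j where "l2n \<Omega> (\<lambda>x. \<phi> j x - u n x) < inverse (real (Suc n))
      \<and> l2n \<Omega> (\<lambda>x. cgrad (\<phi> j) x - wgrad \<Omega> (u n) x) < inverse (real (Suc n))"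
      using eventually_happens'[OF sequentially_bot] by blast
    then show ?thesis using \<phi>(1) by blast
  qed
  then obtain \<phi> where \<phi>: "\<And>n. test_fun \<Omega> (\<phi> n)"
    "\<And>n. l2n \<Omega> (\<lambda>x. \<phi> n x - u n x) < inverse (real (Suc n))"
    "\<And>n. l2n \<Omega> (\<lambda>x. cgrad (\<phi> n) x - wgrad \<Omega> (u n) x) < inverse (real (Suc n))"
    by metis
  have l1: "(\<lambda>n. l2n \<Omega> (\<lambda>x. u' x - \<phi> n x)) \<longlonglongrightarrow> 0"
  proof (rule l2n_tendsto_0_mono)
    show "l2n \<Omega> (\<lambda>x. u' x - \<phi> n x) \<le> l2n \<Omega> (\<lambda>x. u n x - u' x) + inverse (real (Suc n))" for n
      using l2n_triangle_via[OF L(1) un(1)[of n] L2_test_fun[OF \<phi>(1)[of n]]] \<phi>(2)[of n]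
        l2n_minus_commute[of \<Omega> u' "u n"] l2n_minus_commute[of \<Omega> "u n" "\<phi> n"] by linarith
    show "(\<lambda>n. l2n \<Omega> (\<lambda>x. u n x - u' x) + inverse (real (Suc n))) \<longlonglongrightarrow> 0"
      using tendsto_add[OF u LIMSEQ_inverse_real_of_nat] by simp
  qed
  have l2: "(\<lambda>n. l2n \<Omega> (\<lambda>x. G' x - cgrad (\<phi> n) x)) \<longlonglongrightarrow> 0"
  proof (rule l2n_tendsto_0_mono)
    show "l2n \<Omega> (\<lambda>x. G' x - cgrad (\<phi> n) x) \<le> l2n \<Omega> (\<lambda>x. wgrad \<Omega> (u n) x - G' x) + inverse (real (Suc n))" for n
      using l2n_triangle_via[OF L(2) un(2)[of n] L2_cgrad[OF \<phi>(1)[of n]]] \<phi>(3)[of n]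
        l2n_minus_commute[of \<Omega> G' "wgrad \<Omega> (u n)"] l2n_minus_commute[of \<Omega> "wgrad \<Omega> (u n)" "cgrad (\<phi> n)"]
      by linarith
    show "(\<lambda>n. l2n \<Omega> (\<lambda>x. wgrad \<Omega> (u n) x - G' x) + inverse (real (Suc n))) \<longlonglongrightarrow> 0"
      using tendsto_add[OF G LIMSEQ_inverse_real_of_nat] by simp
  qed
  have "(\<lambda>n. H1_norm \<Omega> (\<lambda>x. u' x - \<phi> n x)) \<longlonglongrightarrow> 0"
    using tendsto_real_sqrt[OF tendsto_add[OF tendsto_power[OF l1, of 2] tendsto_power[OF l2, of 2]]]
    by (simp add: H1_norm_diff_test[OF L w \<phi>(1)])
  then show "H10 \<Omega> u'" unfolding H10_def using g(1) \<phi>(1) by blast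
qed

text \<open>For test functions this is the definition of the weak divergence. It extends to u by
  density, and no boundary term appears since u is a limit of compactly supported functions.\<close>

lemma wdiv_green:
  assumes "H10 \<Omega> u" "Hdiv \<Omega> \<sigma>"
  shows "l2ip \<Omega> (wdiv \<Omega> \<sigma>) u = - l2ip \<Omega> \<sigma> (wgrad \<Omega> u)"
proof -
  obtain \<phi> where \<phi>: "\<And>j. test_fun \<Omega> (\<phi> j)" and l: "(\<lambda>j. l2n \<Omega> (\<lambda>x. \<phi> j x - u x)) \<longlonglongrightarrow> 0"
    "(\<lambda>j. l2n \<Omega> (\<lambda>x. cgrad (\<phi> j) x - wgrad \<Omega> u x)) \<longlonglongrightarrow> 0"
    using H10_approx[OF assms(1)] by blast
  have u: "L2 \<Omega> u" "L2 \<Omega> (wgrad \<Omega> u)" using assms wgrad_weak by (auto simp: H10_def H1_def)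
  have s: "L2 \<Omega> \<sigma>" "L2 \<Omega> (wdiv \<Omega> \<sigma>)" "is_weak_div \<Omega> \<sigma> (wdiv \<Omega> \<sigma>)"
    using assms wdiv_weak by (auto simp: Hdiv_def)
  have "(\<lambda>j. l2ip \<Omega> \<sigma> (cgrad (\<phi> j))) \<longlonglongrightarrow> l2ip \<Omega> \<sigma> (wgrad \<Omega> u)"
    by (rule l2ip_tendsto[OF _ _ L2_cgrad[OF \<phi>] u(2) _ l(2)]) (auto simp: s l2n_def l2ip_def)
  moreover have "(\<lambda>j. - l2ip \<Omega> (wdiv \<Omega> \<sigma>) (\<phi> j)) \<longlonglongrightarrow> - l2ip \<Omega> (wdiv \<Omega> \<sigma>) u"
    by (rule tendsto_minus[OF l2ip_tendsto[OF _ _ L2_test_fun[OF \<phi>] u(1) _ l(1)]]) (auto simp: s l2n_def l2ip_def)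
  ultimately have "l2ip \<Omega> \<sigma> (wgrad \<Omega> u) = - l2ip \<Omega> (wdiv \<Omega> \<sigma>) u"
    using s(3) \<phi> by (simp add: is_weak_div_l2ip LIMSEQ_unique)
  then show ?thesis by simp
qed

text \<open>Weak divergence tested with \<open>\<phi>\<^sup>2\<close>, then density of test functions.\<close>

lemma convection_green:
  assumes u10: "H10 \<Omega> u" and b: "Linf \<Omega> \<beta>" and q: "Linf \<Omega> q" and w: "is_weak_div \<Omega> \<beta> q"
  shows "2 * l2ip \<Omega> (\<lambda>x. inner (\<beta> x) (wgrad \<Omega> u x)) u = - l2ip \<Omega> (\<lambda>x. q x * u x) u"
proof -
  obtain \<phi> where \<phi>: "\<And>j. test_fun \<Omega> (\<phi> j)" and l: "(\<lambda>j. l2n \<Omega> (\<lambda>x. \<phi> j x - u x)) \<longlonglongrightarrow> 0"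
    "(\<lambda>j. l2n \<Omega> (\<lambda>x. cgrad (\<phi> j) x - wgrad \<Omega> u x)) \<longlonglongrightarrow> 0"
    using H10_approx[OF u10] by blast
  have u: "L2 \<Omega> u" "L2 \<Omega> (wgrad \<Omega> u)" using u10 wgrad_weak by (auto simp: H10_def H1_def)
  have "2 * l2ip \<Omega> (\<lambda>x. inner (\<beta> x) (cgrad (\<phi> j) x)) (\<phi> j) = - l2ip \<Omega> (\<lambda>x. q x * \<phi> j x) (\<phi> j)" for j
  proof -
    \<comment> \<open>The gradient of \<phi>^2 is 2 \<phi> times the gradient of \<phi>; this is the
      origin of the factor 2 in the statement.\<close>
    have cg: "cgrad (\<lambda>x. \<phi> j x * \<phi> j x) x = (2 * \<phi> j x) *\<^sub>R cgrad (\<phi> j) x" for x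
      by (simp add: cgrad_def vec_eq_iff pd_mult smooth_fun_differentiable[OF test_fun_smooth[OF \<phi>]])
    have "l2ip \<Omega> \<beta> (cgrad (\<lambda>x. \<phi> j x * \<phi> j x)) = - l2ip \<Omega> q (\<lambda>x. \<phi> j x * \<phi> j x)"
      using w test_fun_mult[OF \<phi> test_fun_smooth[OF \<phi>]] by (simp add: is_weak_div_l2ip)
    moreover have "l2ip \<Omega> \<beta> (cgrad (\<lambda>x. \<phi> j x * \<phi> j x)) = (LINT x|lebesgue_on \<Omega>. 2 * (inner (\<beta> x) (cgrad (\<phi> j) x) * \<phi> j x))"
      unfolding l2ip_def by (rule Bochner_Integration.integral_cong) (auto simp: cg)
    ultimately show ?thesis by (simp add: l2ip_def mult.assoc)
  qed
  moreover have "(\<lambda>j. 2 * l2ip \<Omega> (\<lambda>x. inner (\<beta> x) (cgrad (\<phi> j) x)) (\<phi> j)) \<longlonglongrightarrow> 2 * l2ip \<Omega> (\<lambda>x. inner (\<beta> x) (wgrad \<Omega> u x)) u"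
    by (intro tendsto_mult tendsto_const l2ip_tendsto l2n_Linf_inner_tendsto L2_Linf_inner b u l L2_cgrad L2_test_fun \<phi>)
  moreover have "(\<lambda>j. - l2ip \<Omega> (\<lambda>x. q x * \<phi> j x) (\<phi> j)) \<longlonglongrightarrow> - l2ip \<Omega> (\<lambda>x. q x * u x) u"
    by (intro tendsto_minus l2ip_tendsto l2n_Linf_mult_tendsto L2_Linf_mult q u l L2_test_fun \<phi>)
  ultimately show ?thesis by (simp add: LIMSEQ_unique)
qed

end

section \<open>The least-squares problem\<close>

text \<open>Lebesgue measure is complete, so a preimage that differs from a measurable set by a null
  set is measurable.\<close>

lemma borel_measurable_lebesgue_on_AE_eq:
  fixes f g :: "real^'d::finite \<Rightarrow> 'b::euclidean_space"
  assumes S: "S \<in> sets lebesgue" and f: "f \<in> borel_measurable (lebesgue_on S)"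
    and eq: "AE x in lebesgue_on S. f x = g x"
  shows "g \<in> borel_measurable (lebesgue_on S)"
  unfolding borel_measurable_vimage_borel
proof (intro allI impI)
  fix T :: "'b set" assume T: "T \<in> sets borel"
  have fT: "{x \<in> S. f x \<in> T} \<in> sets lebesgue"
    using f T S unfolding borel_measurable_vimage_borel by (simp add: sets_restrict_space_iff)
  have "AE x in lebesgue. x \<in> S \<longrightarrow> f x = g x"
    using eq S by (simp add: AE_restrict_space_iff)
  then have "AE x in lebesgue. x \<in> {x \<in> S. f x \<in> T} \<longleftrightarrow> x \<in> {x \<in> S. g x \<in> T}"
    by eventually_elim auto
  then have "{x \<in> S. g x \<in> T} \<in> sets lebesgue"
    by (rule completion.in_sets_AE[OF _ fT]) simp
  then show "{x \<in> S. g x \<in> T} \<in> sets (lebesgue_on S)"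
    using S by (simp add: sets_restrict_space_iff)
qed

text \<open>\<open>h\<close> is only known to be continuous on the closed set \<open>K\<close>; its
  extension by 0 is Borel, and the modification is invisible because \<open>A x\<close> lies in
  \<open>K\<close> almost everywhere.\<close>

lemma borel_measurable_matrix_fun_vec:
  fixes A :: "real^'d::finite \<Rightarrow> real^'d^'d" and f :: "real^'d \<Rightarrow> real^'d"
    and h :: "real^'d^'d \<Rightarrow> real^'d^'d"
  assumes S: "S \<in> sets lebesgue" and A: "A \<in> borel_measurable (lebesgue_on S)"
    and K: "closed K" "continuous_on K h" and AK: "AE x in lebesgue_on S. A x \<in> K"
    and f: "f \<in> borel_measurable (lebesgue_on S)"
  shows "(\<lambda>x. h (A x) *v f x) \<in> borel_measurable (lebesgue_on S)"
proof (rule borel_measurable_lebesgue_on_AE_eq[OF S])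
  have "(\<lambda>M. indicator K M *\<^sub>R h M) \<in> borel_measurable borel"
    by (rule borel_measurable_continuous_on_indicator[OF borel_closed[OF K(1)] K(2)])
  then have "(\<lambda>x. indicator K (A x) *\<^sub>R h (A x)) \<in> borel_measurable (lebesgue_on S)"
    by (rule measurable_compose[OF A])
  then show "(\<lambda>x. (indicator K (A x) *\<^sub>R h (A x)) *v f x) \<in> borel_measurable (lebesgue_on S)"
    by (rule borel_measurable_matrix_vector_mult[OF _ f])
  show "AE x in lebesgue_on S. (indicator K (A x) *\<^sub>R h (A x)) *v f x = h (A x) *v f x"
    using AK by eventually_elim simp
qed

definition U_comb :: "('d::finite) Uelem \<Rightarrow> real \<Rightarrow> 'd Uelem \<Rightarrow> 'd Uelem" where
  "U_comb v c w = ((\<lambda>x. fst v x + c * fst w x), (\<lambda>x. snd v x + c *\<^sub>R snd w x))"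

lemma U_diff_eq_comb: "U_diff v w = U_comb v (-1) w"
  by (simp add: U_diff_def U_comb_def)

lemma closed_subspace_U_comb:
  assumes V: "closed_subspace_U \<Omega> V" and v: "v \<in> V" and w: "w \<in> V"
  shows "U_comb v c w \<in> V"
proof -
  have "((\<lambda>x. c * fst w x), (\<lambda>x. c *\<^sub>R snd w x)) \<in> V"
    using V w unfolding closed_subspace_U_def by blast
  moreover have "\<And>v w. v \<in> V \<Longrightarrow> w \<in> V \<Longrightarrow> ((\<lambda>x. fst v x + fst w x), (\<lambda>x. snd v x + snd w x)) \<in> V"
    using V unfolding closed_subspace_U_def by blast
  ultimately show ?thesis using v by (fastforce simp: U_comb_def)
qed

text \<open>The graph embedding of U into a product of L2 spaces. \<open>U_norm\<close> is the L2
  norm of this tuple, so completeness and convergence in U reduce to L2.\<close>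

definition graph_vec ::
  "(real^'d) set \<Rightarrow> ('d::finite) Uelem \<Rightarrow> real^'d \<Rightarrow> real \<times> (real^'d) \<times> (real^'d) \<times> real" where
  "graph_vec \<Omega> v x = (fst v x, wgrad \<Omega> (fst v) x, snd v x, wdiv \<Omega> (snd v) x)"

definition residual ::
  "(real^'d) set \<Rightarrow> (real^'d \<Rightarrow> real^'d^'d) \<Rightarrow> (real^'d \<Rightarrow> real^'d) \<Rightarrow> (real^'d \<Rightarrow> real)
    \<Rightarrow> real \<Rightarrow> ('d::finite) Uelem \<Rightarrow> real^'d \<Rightarrow> real \<times> (real^'d)" where
  "residual \<Omega> A \<beta> \<gamma> k v x = (sqrt k * (fst v x / k + Lop \<Omega> \<beta> \<gamma> v x), flux \<Omega> A v x)"

text \<open>The residual is this pointwise linear map applied to \<open>graph_vec\<close>. Linearity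
  and bounds are proved for the map, where the choice of representatives for weak derivatives does
  not interfere.\<close>

definition residual_symbol ::
  "(real^'d \<Rightarrow> real^'d^'d) \<Rightarrow> (real^'d \<Rightarrow> real^'d) \<Rightarrow> (real^'d \<Rightarrow> real)
    \<Rightarrow> real \<Rightarrow> real^'d \<Rightarrow> real \<times> (real^'d) \<times> (real^'d) \<times> real \<Rightarrow> real \<times> (real^'d::finite)" where
  "residual_symbol A \<beta> \<gamma> k x = (\<lambda>(u, G, s, d).
     (sqrt k * (u / k + (- d - inner (\<beta> x) G + \<gamma> x * u)),
      mat_sqrt (A x) *v G - matrix_inv (mat_sqrt (A x)) *v s))"

lemma residual_eq_symbol:
  "residual \<Omega> A \<beta> \<gamma> k v x = residual_symbol A \<beta> \<gamma> k x (graph_vec \<Omega> v x)"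
  by (simp add: residual_def residual_symbol_def graph_vec_def Lop_def flux_def)

lemma residual_symbol_linear:
  "residual_symbol A \<beta> \<gamma> k x (e + c *\<^sub>R f) = residual_symbol A \<beta> \<gamma> k x e + c *\<^sub>R residual_symbol A \<beta> \<gamma> k x f"
proof -
  obtain u G s d where e: "e = (u, G, s, d)" by (cases e)
  obtain u' G' s' d' where f: "f = (u', G', s', d')" by (cases f)
  show ?thesis
    by (simp add: e f residual_symbol_def matrix_vector_right_distrib matrix_vector_mult_scaleR
        inner_add_right add_divide_distrib algebra_simps)
qed

lemma norm_Pair_le_sum: "norm (a, b) \<le> norm a + norm b"
  by (simp add: norm_Pair sqrt_sum_squares_le_sum)

text \<open>If x is the larger of a and b, then x^2 \<le> r (a + b) \<le> 2 r x, and x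
  cancels.\<close>

lemma sum_squares_le_imp_bounds:
  fixes a b r :: real
  assumes "0 \<le> a" "0 \<le> b" "0 \<le> r" "a\<^sup>2 + b\<^sup>2 \<le> r * (a + b)"
  shows "a \<le> 2 * r" "b \<le> 2 * r"
proof -
  have *: "x \<le> 2 * r" if "0 \<le> y" "y \<le> x" "x\<^sup>2 + y\<^sup>2 \<le> r * (x + y)" for x y
  proof (cases "x = 0")
    case False
    have "x * x \<le> r * (x + y)" using that(3) by (simp add: power2_eq_square) (smt (verit) zero_le_square)
    also have "\<dots> \<le> r * (x + x)" using that assms(3) by (intro mult_left_mono) auto
    finally have "x * x \<le> x * (2 * r)" by (simp add: algebra_simps)
    then show ?thesis using False that by simp
  qed (use assms in simp)
  show "a \<le> 2 * r" "b \<le> 2 * r"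
    using *[of b a] *[of a b] assms by (cases "a \<le> b"; force simp: add.commute)+
qed

section \<open>The residual map: boundedness, coercivity, closed range\<close>

locale least_squares = bounded_open \<Omega> for \<Omega> :: "(real^'d::finite) set" +
  fixes A :: "real^'d \<Rightarrow> real^'d^'d" and \<beta> :: "real^'d \<Rightarrow> real^'d" and \<gamma> q :: "real^'d \<Rightarrow> real" and a0 :: real
  assumes A_Linf: "Linf \<Omega> A" and a0: "0 < a0" and A_spd: "AE x in lebesgue_on \<Omega>. spd a0 (A x)"
    and b_Linf: "Linf \<Omega> \<beta>" and g_Linf: "Linf \<Omega> \<gamma>" and q_Linf: "Linf \<Omega> q"
    and div_b: "is_weak_div \<Omega> \<beta> q" and nonneg: "AE x in lebesgue_on \<Omega>. 0 \<le> q x / 2 + \<gamma> x"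
begin

abbreviation "E \<equiv> graph_vec \<Omega>"
abbreviation "Rs \<equiv> residual \<Omega> A \<beta> \<gamma>"

lemma \<Omega>_sets: "\<Omega> \<in> sets lebesgue"
  using op by (simp add: borel_open)

lemma U_space_L2:
  assumes "v \<in> U_space \<Omega>"
  shows "H10 \<Omega> (fst v)" "Hdiv \<Omega> (snd v)" "L2 \<Omega> (fst v)" "L2 \<Omega> (wgrad \<Omega> (fst v))" "L2 \<Omega> (snd v)" "L2 \<Omega> (wdiv \<Omega> (snd v))"
    "is_weak_grad \<Omega> (fst v) (wgrad \<Omega> (fst v))" "is_weak_div \<Omega> (snd v) (wdiv \<Omega> (snd v))"
proof -
  show 1: "H10 \<Omega> (fst v)" "Hdiv \<Omega> (snd v)" using assms by (auto simp: U_space_def)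
  then show "L2 \<Omega> (fst v)" "L2 \<Omega> (snd v)" by (auto simp: H10_def H1_def Hdiv_def)
  show "L2 \<Omega> (wgrad \<Omega> (fst v))" "is_weak_grad \<Omega> (fst v) (wgrad \<Omega> (fst v))"
    using 1 wgrad_weak by (auto simp: H10_def)
  show "L2 \<Omega> (wdiv \<Omega> (snd v))" "is_weak_div \<Omega> (snd v) (wdiv \<Omega> (snd v))"
    using 1 wdiv_weak by auto
qed

lemma L2_graph_vec: "v \<in> U_space \<Omega> \<Longrightarrow> L2 \<Omega> (E v)"
  using U_space_L2 unfolding graph_vec_def by (intro L2_Pair) auto

text \<open>Equality holds only almost everywhere, because the representatives selected by
  \<open>wgrad\<close> and \<open>wdiv\<close> need not depend linearly on their arguments.\<close>

lemma graph_vec_comb: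
  assumes "v \<in> U_space \<Omega>" "w \<in> U_space \<Omega>"
  shows "AE x in lebesgue_on \<Omega>. E (U_comb v c w) x = E v x + c *\<^sub>R E w x"
proof -
  note v = U_space_L2[OF assms(1)] and w = U_space_L2[OF assms(2)]
  have "AE x in lebesgue_on \<Omega>. wgrad \<Omega> (fst (U_comb v c w)) x = wgrad \<Omega> (fst v) x + c *\<^sub>R wgrad \<Omega> (fst w) x"
    unfolding U_comb_def fst_conv
    by (intro wgrad_AE_eq is_weak_grad_add_scaleR L2_add L2_scaleR L2_mult v w)
  moreover have "AE x in lebesgue_on \<Omega>. wdiv \<Omega> (snd (U_comb v c w)) x = wdiv \<Omega> (snd v) x + c * wdiv \<Omega> (snd w) x"
    unfolding U_comb_def snd_conv
    by (intro wdiv_AE_eq is_weak_div_add_scaleR L2_add L2_scaleR L2_mult v w)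
  ultimately show ?thesis
    by eventually_elim (simp add: graph_vec_def U_comb_def)
qed

lemma residual_comb:
  assumes "v \<in> U_space \<Omega>" "w \<in> U_space \<Omega>"
  shows "AE x in lebesgue_on \<Omega>. Rs k (U_comb v c w) x = Rs k v x + c *\<^sub>R Rs k w x"
  using graph_vec_comb[OF assms, of c]
  by eventually_elim (simp add: residual_eq_symbol residual_symbol_linear)

lemma U_norm_graph_vec:
  assumes "H1 \<Omega> (fst v)" "Hdiv \<Omega> (snd v)"
  shows "L2 \<Omega> (E v)" "U_norm \<Omega> v = l2n \<Omega> (E v)"
proof -
  have L: "L2 \<Omega> (fst v)" "L2 \<Omega> (wgrad \<Omega> (fst v))" "L2 \<Omega> (snd v)" "L2 \<Omega> (wdiv \<Omega> (snd v))"
    using assms wgrad_weak wdiv_weak by (auto simp: H1_def Hdiv_def)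
  show "L2 \<Omega> (E v)" unfolding graph_vec_def by (intro L2_Pair L)
  show "U_norm \<Omega> v = l2n \<Omega> (E v)"
    using L2_integrable_inner[OF L(1,1)] L2_integrable_inner[OF L(2,2)]
      L2_integrable_inner[OF L(3,3)] L2_integrable_inner[OF L(4,4)]
    by (simp add: U_norm_def l2n_def l2ip_def graph_vec_def)
qed

lemma U_norm_eq: "v \<in> U_space \<Omega> \<Longrightarrow> U_norm \<Omega> v = l2n \<Omega> (E v)"
  using U_space_L2(1,2) by (intro U_norm_graph_vec) (auto simp: H10_def)

text \<open>Only a weak gradient and a weak divergence of the difference enter, so stability of
  \<open>H10\<close> under subtraction is not an issue here.\<close>

lemma U_norm_diff:
  assumes v: "v \<in> U_space \<Omega>" and w: "w \<in> U_space \<Omega>"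
  shows "U_norm \<Omega> (U_diff v w) = l2n \<Omega> (\<lambda>x. E v x - E w x)"
proof -
  note v' = U_space_L2[OF v] and w' = U_space_L2[OF w]
  have "H1 \<Omega> (fst (U_diff v w))"
    unfolding U_diff_eq_comb U_comb_def fst_conv
    by (rule wgrad_AE_eq[OF _ _ is_weak_grad_add_scaleR[OF v'(3) w'(3) v'(4) w'(4) v'(7) w'(7)]])
      (intro L2_add L2_scaleR L2_mult v' w')+
  moreover have "Hdiv \<Omega> (snd (U_diff v w))"
    unfolding U_diff_eq_comb U_comb_def snd_conv
    by (rule wdiv_AE_eq[OF _ _ is_weak_div_add_scaleR[OF v'(5) w'(5) v'(6) w'(6) v'(8) w'(8)]])
      (intro L2_add L2_scaleR L2_mult v' w')+
  ultimately have n: "L2 \<Omega> (E (U_diff v w))" "U_norm \<Omega> (U_diff v w) = l2n \<Omega> (E (U_diff v w))"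
    by (rule U_norm_graph_vec)+
  have "l2n \<Omega> (E (U_diff v w)) = l2n \<Omega> (\<lambda>x. E v x - E w x)"
    using graph_vec_comb[OF v w, of "-1"]
    by (intro l2n_cong_AE n(1) L2_diff L2_graph_vec v w) (simp add: U_diff_eq_comb)
  then show ?thesis using n(2) by simp
qed

lemma mat_sqrt_bound:
  obtains C where "0 < C" "AE x in lebesgue_on \<Omega>. \<forall>y. norm (mat_sqrt (A x) *v y) \<le> C * norm y"
proof -
  obtain C where C: "0 < C" "AE x in lebesgue_on \<Omega>. norm (A x) \<le> C" using Linf_bound[OF A_Linf] .
  have "AE x in lebesgue_on \<Omega>. \<forall>y. norm (mat_sqrt (A x) *v y) \<le> (real CARD('d) * sqrt C) * norm y"
    using C(2) A_spd by eventually_elim (use mat_sqrt_norm_le a0 in blast)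
  then show ?thesis using C(1) by (intro that[of "real CARD('d) * sqrt C"]) auto
qed

lemma mat_sqrt_inv_bound:
  "AE x in lebesgue_on \<Omega>. \<forall>y. norm (matrix_inv (mat_sqrt (A x)) *v y) \<le> 1 / sqrt a0 * norm y"
  using A_spd by eventually_elim (use spd_matrix_inv(3)[OF mat_sqrt_spd(2)[OF _ a0]] a0 in auto)

lemma residual_symbol_bound:
  assumes k: "0 < k"
  obtains C where "0 < C" "AE x in lebesgue_on \<Omega>. \<forall>e. norm (residual_symbol A \<beta> \<gamma> k x e) \<le> C * norm e"
proof -
  obtain Cs where Cs: "0 < Cs" "AE x in lebesgue_on \<Omega>. \<forall>y. norm (mat_sqrt (A x) *v y) \<le> Cs * norm y"
    using mat_sqrt_bound .
  obtain Cb where Cb: "0 < Cb" "AE x in lebesgue_on \<Omega>. norm (\<beta> x) \<le> Cb" using Linf_bound[OF b_Linf] .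
  obtain Cg where Cg: "0 < Cg" "AE x in lebesgue_on \<Omega>. norm (\<gamma> x) \<le> Cg" using Linf_bound[OF g_Linf] .
  let ?C = "sqrt k * (1 / k + 1 + Cb + Cg) + (Cs + 1 / sqrt a0)"
  have "AE x in lebesgue_on \<Omega>. \<forall>e. norm (residual_symbol A \<beta> \<gamma> k x e) \<le> ?C * norm e"
    using Cs(2) Cb(2) Cg(2) mat_sqrt_inv_bound
  proof eventually_elim
    case (elim x)
    show ?case
    proof
      fix e :: "real \<times> (real^'d) \<times> (real^'d) \<times> real"
      obtain u G s d where e: "e = (u, G, s, d)" by (cases e)
      let ?n = "norm e"
      have n: "\<bar>u\<bar> \<le> ?n" "norm G \<le> ?n" "norm s \<le> ?n" "\<bar>d\<bar> \<le> ?n"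
        using norm_fst_le[of u "(G, s, d)"] norm_snd_le[of "(G, s, d)" u] norm_fst_le[of G "(s, d)"]
          norm_snd_le[of "(s, d)" G] norm_fst_le[of s d] norm_snd_le[of d s] by (auto simp: e)
      have "\<bar>inner (\<beta> x) G\<bar> \<le> norm (\<beta> x) * norm G" by (rule Cauchy_Schwarz_ineq2)
      also have "\<dots> \<le> Cb * ?n" using elim n Cb by (intro mult_mono) auto
      finally have 1: "\<bar>inner (\<beta> x) G\<bar> \<le> Cb * ?n" .
      have 2: "\<bar>\<gamma> x * u\<bar> \<le> Cg * ?n" unfolding abs_mult using elim n Cg by (intro mult_mono) auto
      have 3: "\<bar>u / k\<bar> \<le> 1 / k * ?n" using n k by (simp add: field_simps abs_divide)
      have "\<bar>u / k + (- d - inner (\<beta> x) G + \<gamma> x * u)\<bar> \<le> (1 / k + 1 + Cb + Cg) * ?n"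
        using 1 2 3 n(4) unfolding distrib_right by linarith
      then have f: "\<bar>sqrt k * (u / k + (- d - inner (\<beta> x) G + \<gamma> x * u))\<bar> \<le> sqrt k * (1 / k + 1 + Cb + Cg) * ?n"
        using k by (simp add: abs_mult mult.assoc mult_left_mono)
      have "norm (mat_sqrt (A x) *v G) \<le> Cs * ?n" "norm (matrix_inv (mat_sqrt (A x)) *v s) \<le> 1 / sqrt a0 * ?n"
        using elim n Cs a0 by (meson mult_left_mono order_trans less_imp_le, meson mult_left_mono order_trans divide_nonneg_nonneg real_sqrt_ge_zero less_imp_le zero_le_one)
      then have "norm (mat_sqrt (A x) *v G - matrix_inv (mat_sqrt (A x)) *v s) \<le> (Cs + 1 / sqrt a0) * ?n"
        using norm_triangle_ineq4[of "mat_sqrt (A x) *v G" "matrix_inv (mat_sqrt (A x)) *v s"]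
        by (simp add: distrib_right)
      with f show "norm (residual_symbol A \<beta> \<gamma> k x e) \<le> ?C * ?n"
        using norm_Pair_le_sum[of "sqrt k * (u / k + (- d - inner (\<beta> x) G + \<gamma> x * u))"
            "mat_sqrt (A x) *v G - matrix_inv (mat_sqrt (A x)) *v s"]
        by (simp add: e residual_symbol_def distrib_right)
    qed
  qed
  moreover have "0 < ?C" using k Cs Cb Cg a0 by (intro add_pos_pos mult_pos_pos) auto
  ultimately show ?thesis using that by blast
qed

lemma L2_Lop:
  assumes "v \<in> U_space \<Omega>"
  shows "L2 \<Omega> (Lop \<Omega> \<beta> \<gamma> v)"
proof -
  note v = U_space_L2[OF assms]
  have "L2 \<Omega> (\<lambda>x. \<gamma> x * fst v x - (wdiv \<Omega> (snd v) x + inner (\<beta> x) (wgrad \<Omega> (fst v) x)))"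
    by (intro L2_diff L2_add L2_Linf_mult L2_Linf_inner v b_Linf g_Linf)
  then show ?thesis by (simp add: Lop_def algebra_simps)
qed

lemma measurable_mat_sqrt_mult:
  assumes "f \<in> borel_measurable (lebesgue_on \<Omega>)"
  shows "(\<lambda>x. mat_sqrt (A x) *v f x) \<in> borel_measurable (lebesgue_on \<Omega>)"
    "(\<lambda>x. matrix_inv (mat_sqrt (A x)) *v f x) \<in> borel_measurable (lebesgue_on \<Omega>)"
proof -
  have A: "A \<in> borel_measurable (lebesgue_on \<Omega>)" using A_Linf by (simp add: Linf_def)
  have AK: "AE x in lebesgue_on \<Omega>. A x \<in> {M. spd a0 M}" using A_spd by simp
  show "(\<lambda>x. mat_sqrt (A x) *v f x) \<in> borel_measurable (lebesgue_on \<Omega>)"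
    by (rule borel_measurable_matrix_fun_vec[OF \<Omega>_sets A closed_spd continuous_on_mat_sqrt[OF a0] AK assms])
  show "(\<lambda>x. matrix_inv (mat_sqrt (A x)) *v f x) \<in> borel_measurable (lebesgue_on \<Omega>)"
    by (rule borel_measurable_matrix_fun_vec[OF \<Omega>_sets A closed_spd continuous_on_matrix_inv_mat_sqrt[OF a0] AK assms])
qed

lemma L2_mat_sqrt_mult:
  assumes "L2 \<Omega> f"
  shows "L2 \<Omega> (\<lambda>x. mat_sqrt (A x) *v f x)" "L2 \<Omega> (\<lambda>x. matrix_inv (mat_sqrt (A x)) *v f x)"
proof -
  obtain C where C: "AE x in lebesgue_on \<Omega>. \<forall>y. norm (mat_sqrt (A x) *v y) \<le> C * norm y"
    using mat_sqrt_bound .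
  note m = measurable_mat_sqrt_mult[OF L2_measurable[OF assms]]
  show "L2 \<Omega> (\<lambda>x. mat_sqrt (A x) *v f x)"
    using C by (intro L2_dominated[OF assms m(1), of C]) auto
  show "L2 \<Omega> (\<lambda>x. matrix_inv (mat_sqrt (A x)) *v f x)"
    using mat_sqrt_inv_bound by (intro L2_dominated[OF assms m(2), of "1 / sqrt a0"]) auto
qed

lemma L2_flux:
  assumes "v \<in> U_space \<Omega>"
  shows "L2 \<Omega> (flux \<Omega> A v)"
  unfolding flux_def by (intro L2_diff L2_mat_sqrt_mult U_space_L2 assms)

lemma L2_residual:
  assumes "v \<in> U_space \<Omega>"
  shows "L2 \<Omega> (Rs k v)"
proof -
  have "L2 \<Omega> (\<lambda>x. fst v x / k + Lop \<Omega> \<beta> \<gamma> v x)"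
    using L2_add[OF L2_mult[OF U_space_L2(3)[OF assms], of "1/k"] L2_Lop[OF assms]] by simp
  then show ?thesis
    unfolding residual_def by (intro L2_Pair L2_mult L2_flux[OF assms])
qed

lemma residual_diff_le:
  assumes k: "0 < k"
  shows "\<exists>C. \<forall>v\<in>U_space \<Omega>. \<forall>w\<in>U_space \<Omega>.
    l2n \<Omega> (\<lambda>x. Rs k v x - Rs k w x) \<le> C * l2n \<Omega> (\<lambda>x. E v x - E w x)"
proof -
  obtain C where C: "0 < C" "AE x in lebesgue_on \<Omega>. \<forall>e. norm (residual_symbol A \<beta> \<gamma> k x e) \<le> C * norm e"
    using residual_symbol_bound[OF k] .
  have "l2n \<Omega> (\<lambda>x. Rs k v x - Rs k w x) \<le> C * l2n \<Omega> (\<lambda>x. E v x - E w x)"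
    if v: "v \<in> U_space \<Omega>" and w: "w \<in> U_space \<Omega>" for v w
  proof (rule l2n_dominated)
    have eq: "Rs k v x - Rs k w x = residual_symbol A \<beta> \<gamma> k x (E v x - E w x)" for x
      using residual_symbol_linear[of A \<beta> \<gamma> k x "E v x" "-1" "E w x"] by (simp add: residual_eq_symbol)
    show "AE x in lebesgue_on \<Omega>. norm (Rs k v x - Rs k w x) \<le> C * norm (E v x - E w x)"
      unfolding eq using C(2) by eventually_elim blast
  qed (use C v w in \<open>auto intro!: L2_diff L2_graph_vec L2_residual\<close>)
  then show ?thesis by blast
qed

lemma B_form_eq:
  assumes k: "0 < k" and w: "w \<in> U_space \<Omega>" and v: "v \<in> U_space \<Omega>"
  shows "B_form \<Omega> A \<beta> \<gamma> k w v = l2ip \<Omega> (Rs k w) (Rs k v)"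
proof -
  let ?a = "fst w" and ?b = "fst v" and ?La = "Lop \<Omega> \<beta> \<gamma> w" and ?Lb = "Lop \<Omega> \<beta> \<gamma> v"
  let ?f = "flux \<Omega> A w" and ?g = "flux \<Omega> A v"
  note L = U_space_L2(3)[OF w] U_space_L2(3)[OF v] L2_Lop[OF w] L2_Lop[OF v] L2_flux[OF w] L2_flux[OF v]
  have i: "integrable (lebesgue_on \<Omega>) (\<lambda>x. ?a x * ?b x)" "integrable (lebesgue_on \<Omega>) (\<lambda>x. ?a x * ?Lb x)"
    "integrable (lebesgue_on \<Omega>) (\<lambda>x. ?La x * ?b x)" "integrable (lebesgue_on \<Omega>) (\<lambda>x. ?La x * ?Lb x)"
    "integrable (lebesgue_on \<Omega>) (\<lambda>x. inner (?f x) (?g x))"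
    using L2_integrable_inner[OF L(1,2)] L2_integrable_inner[OF L(1,4)] L2_integrable_inner[OF L(3,2)]
      L2_integrable_inner[OF L(3,4)] L2_integrable_inner[OF L(5,6)] by auto
  have sk: "sqrt k * sqrt k = k" using k by simp
  have pt: "inner (Rs k w x) (Rs k v x) = 1 / k * (?a x * ?b x)
      + (?a x * ?Lb x + (?La x * ?b x + k * (?La x * ?Lb x) + inner (?f x) (?g x)))" for x
  proof -
    have "inner (Rs k w x) (Rs k v x)
        = (sqrt k * sqrt k) * ((?a x / k + ?La x) * (?b x / k + ?Lb x)) + inner (?f x) (?g x)"
      by (simp add: residual_def mult_ac)
    also have "(sqrt k * sqrt k) * ((?a x / k + ?La x) * (?b x / k + ?Lb x))
        = 1 / k * (?a x * ?b x) + (?a x * ?Lb x + (?La x * ?b x + k * (?La x * ?Lb x)))"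
      unfolding sk using k by (simp add: field_simps)
    finally show ?thesis by simp
  qed
  show ?thesis
    unfolding l2ip_def[of \<Omega> "Rs k w"] pt B_form_def b_form_def b_tilde_def
    using i by (simp add: l2ip_def)
qed

lemma F_form_eq:
  assumes k: "0 < k"
  shows "F_form \<Omega> \<beta> \<gamma> k v g w = l2ip \<Omega> (\<lambda>x. (sqrt k * (g x + w x / k), 0)) (Rs k v)"
proof -
  have "l2ip \<Omega> (\<lambda>x. (sqrt k * (g x + w x / k), 0)) (Rs k v)
      = (LINT x|lebesgue_on \<Omega>. k * ((g x + w x / k) * (fst v x / k + Lop \<Omega> \<beta> \<gamma> v x)))"
    unfolding l2ip_def
  proof (rule Bochner_Integration.integral_cong[OF refl])
    fix x
    have "inner (sqrt k * (g x + w x / k), 0) (Rs k v x)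
       = (sqrt k * sqrt k) * ((g x + w x / k) * (fst v x / k + Lop \<Omega> \<beta> \<gamma> v x))"
      by (simp add: residual_def mult_ac)
    then show "inner (sqrt k * (g x + w x / k), 0) (Rs k v x)
       = k * ((g x + w x / k) * (fst v x / k + Lop \<Omega> \<beta> \<gamma> v x))" using k by simp
  qed
  then show ?thesis by (simp add: F_form_def l2ip_def)
qed

text \<open>With S the root of A, (\<sigma>, \<nabla>u) = (S^(-1) \<sigma>, S \<nabla>u) = |S
  \<nabla>u|^2 - (flux, S \<nabla>u), and Green's formula turns -(div \<sigma>, u) into this
  quantity. Convection and reaction combine to ((q/2 + \<gamma>) u, u) \<ge> 0; dropping this term
  turns the identity into an inequality.\<close>

lemma energy_identity:
  assumes k: "0 < k" and v: "v \<in> U_space \<Omega>"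
  defines "SG \<equiv> \<lambda>x. mat_sqrt (A x) *v wgrad \<Omega> (fst v) x"
  shows "l2ip \<Omega> (fst v) (fst v) / k + l2ip \<Omega> SG SG
    \<le> l2ip \<Omega> (\<lambda>x. fst v x / k + Lop \<Omega> \<beta> \<gamma> v x) (fst v) + l2ip \<Omega> (flux \<Omega> A v) SG"
proof -
  let ?u = "fst v" and ?G = "wgrad \<Omega> (fst v)" and ?s = "snd v" and ?d = "wdiv \<Omega> (snd v)"
  note U = U_space_L2[OF v]
  have SG: "L2 \<Omega> SG" unfolding SG_def by (intro L2_mat_sqrt_mult U)
  have bG: "L2 \<Omega> (\<lambda>x. inner (\<beta> x) (?G x))" by (intro L2_Linf_inner b_Linf U)
  have gu: "L2 \<Omega> (\<lambda>x. \<gamma> x * ?u x)" by (intro L2_Linf_mult g_Linf U)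
  have qu: "L2 \<Omega> (\<lambda>x. q x * ?u x)" by (intro L2_Linf_mult q_Linf U)
  have uk: "L2 \<Omega> (\<lambda>x. (1/k) *\<^sub>R ?u x)" by (intro L2_scaleR U)
  have "l2ip \<Omega> (\<lambda>x. (1/k) *\<^sub>R ?u x + ((\<gamma> x * ?u x - ?d x) - inner (\<beta> x) (?G x))) ?u
      = l2ip \<Omega> ?u ?u / k + l2ip \<Omega> (\<lambda>x. \<gamma> x * ?u x) ?u - l2ip \<Omega> ?d ?u - l2ip \<Omega> (\<lambda>x. inner (\<beta> x) (?G x)) ?u"
    by (simp add: l2ip_add_left[OF uk] l2ip_diff_left L2_diff gu bG U l2ip_scaleR_left del: real_scaleR_def)
  moreover have "(\<lambda>x. (1/k) *\<^sub>R ?u x + ((\<gamma> x * ?u x - ?d x) - inner (\<beta> x) (?G x))) = (\<lambda>x. ?u x / k + Lop \<Omega> \<beta> \<gamma> v x)"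
    by (simp add: Lop_def fun_eq_iff)
  ultimately have M: "l2ip \<Omega> (\<lambda>x. ?u x / k + Lop \<Omega> \<beta> \<gamma> v x) ?u
      = l2ip \<Omega> ?u ?u / k + l2ip \<Omega> (\<lambda>x. \<gamma> x * ?u x) ?u - l2ip \<Omega> ?d ?u - l2ip \<Omega> (\<lambda>x. inner (\<beta> x) (?G x)) ?u"
    by simp
  have "0 \<le> (LINT x|lebesgue_on \<Omega>. (q x / 2 + \<gamma> x) * (?u x)\<^sup>2)"
    using nonneg by (intro integral_nonneg_AE) (auto elim!: eventually_mono)
  also have "\<dots> = (LINT x|lebesgue_on \<Omega>. inner (q x * ?u x) (?u x) / 2 + inner (\<gamma> x * ?u x) (?u x))"
    by (rule Bochner_Integration.integral_cong) (auto simp: power2_eq_square algebra_simps)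
  also have "\<dots> = l2ip \<Omega> (\<lambda>x. q x * ?u x) ?u / 2 + l2ip \<Omega> (\<lambda>x. \<gamma> x * ?u x) ?u"
    using L2_integrable_inner[OF qu U(3)] L2_integrable_inner[OF gu U(3)] by (simp add: l2ip_def)
  finally have pos: "0 \<le> l2ip \<Omega> (\<lambda>x. q x * ?u x) ?u / 2 + l2ip \<Omega> (\<lambda>x. \<gamma> x * ?u x) ?u" .
  have "l2ip \<Omega> ?s ?G = (LINT x|lebesgue_on \<Omega>. inner (SG x) (SG x) - inner (flux \<Omega> A v x) (SG x))"
    unfolding l2ip_def
  proof (rule integral_cong_AE)
    show "AE x in lebesgue_on \<Omega>. inner (?s x) (?G x) = inner (SG x) (SG x) - inner (flux \<Omega> A v x) (SG x)"
      using A_spd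
    proof eventually_elim
      case (elim x)
      let ?S = "mat_sqrt (A x)"
      have S: "spd (sqrt a0) ?S" by (rule mat_sqrt_spd(2)[OF elim a0])
      have sym: "transpose ?S = ?S" using S by (simp add: spd_def)
      have "inner (SG x) (SG x) - inner (flux \<Omega> A v x) (SG x) = inner (matrix_inv ?S *v ?s x) (?S *v ?G x)"
        by (simp add: SG_def flux_def inner_diff_left)
      also have "\<dots> = inner (?S *v (matrix_inv ?S *v ?s x)) (?G x)"
        by (simp add: symmetric_matrix_inner[OF sym])
      also have "?S *v (matrix_inv ?S *v ?s x) = ?s x"
        using spd_matrix_inv(1)[OF S] a0 by simp
      finally show ?case by simp
    qed
  qed (use L2_integrable_inner[OF U(5,4)] L2_integrable_inner[OF SG SG] L2_integrable_inner[OF L2_flux[OF v] SG] in auto)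
  also have "\<dots> = l2ip \<Omega> SG SG - l2ip \<Omega> (flux \<Omega> A v) SG"
    using L2_integrable_inner[OF SG SG] L2_integrable_inner[OF L2_flux[OF v] SG] by (simp add: l2ip_def)
  finally have sG: "l2ip \<Omega> ?s ?G = l2ip \<Omega> SG SG - l2ip \<Omega> (flux \<Omega> A v) SG" .
  show ?thesis
    using M pos sG wdiv_green[OF U(1,2)] convection_green[OF U(1) b_Linf q_Linf div_b] by linarith
qed

lemma coercivity:
  assumes k: "0 < k"
  shows "\<exists>C>0. \<forall>v\<in>U_space \<Omega>. l2n \<Omega> (E v) \<le> C * l2n \<Omega> (Rs k v)"
proof -
  obtain Cs where Cs: "0 < Cs" "AE x in lebesgue_on \<Omega>. \<forall>y. norm (mat_sqrt (A x) *v y) \<le> Cs * norm y"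
    using mat_sqrt_bound .
  obtain Cb where Cb: "0 < Cb" "AE x in lebesgue_on \<Omega>. norm (\<beta> x) \<le> Cb" using Linf_bound[OF b_Linf] .
  obtain Cg where Cg: "0 < Cg" "AE x in lebesgue_on \<Omega>. norm (\<gamma> x) \<le> Cg" using Linf_bound[OF g_Linf] .
  have sk: "0 < sqrt k" and sa: "0 < sqrt a0" using k a0 by auto
  \<comment> \<open>With r the norm of the residual: \<open>cu\<close> and \<open>cG\<close> come
    from |u| / sqrt k \<le> 2 r and |A^(1/2) \<nabla>u| \<le> 2 r. \<open>cs\<close> comes from
    \<sigma> = A^(1/2) (A^(1/2) \<nabla>u - flux), of size 2 r + r before the factor
    \<open>Cs\<close>. \<open>cd\<close> collects the four terms of div \<sigma> = u/k - (u/k + L u)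
    - \<beta> \<cdot> \<nabla>u + \<gamma> u.\<close>
  define cu where "cu = 2 * sqrt k"
  define cG where "cG = 1 / sqrt a0 * 2"
  define cs where "cs = Cs * 3"
  define cd where "cd = 1 / k * cu + 1 / sqrt k + Cb * cG + Cg * cu"
  have pos: "0 < cu" "0 < cG" "0 < cs" "0 < cd"
    using k sk sa Cs Cb Cg by (auto simp: cu_def cG_def cs_def cd_def intro!: add_pos_pos)
  have "l2n \<Omega> (E v) \<le> (cu + cG + cs + cd) * l2n \<Omega> (Rs k v)" if v: "v \<in> U_space \<Omega>" for v
  proof -
    let ?u = "fst v" and ?G = "wgrad \<Omega> (fst v)" and ?s = "snd v" and ?d = "wdiv \<Omega> (snd v)"
    let ?f = "flux \<Omega> A v" and ?M = "\<lambda>x. fst v x / k + Lop \<Omega> \<beta> \<gamma> v x"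
    define SG where "SG x = mat_sqrt (A x) *v ?G x" for x
    define r where "r = l2n \<Omega> (Rs k v)"
    note U = U_space_L2[OF v]
    have r0: "0 \<le> r" by (simp add: r_def)
    have SG: "L2 \<Omega> SG" unfolding SG_def by (intro L2_mat_sqrt_mult U)
    have f: "L2 \<Omega> ?f" by (rule L2_flux[OF v])
    have M: "L2 \<Omega> ?M"
      using L2_add[OF L2_mult[OF U(3), of "1/k"] L2_Lop[OF v]] by simp
    have bG: "L2 \<Omega> (\<lambda>x. inner (\<beta> x) (?G x))" by (intro L2_Linf_inner b_Linf U)
    have gu: "L2 \<Omega> (\<lambda>x. \<gamma> x * ?u x)" by (intro L2_Linf_mult g_Linf U)
    have "l2n \<Omega> (\<lambda>x. sqrt k *\<^sub>R ?M x) \<le> 1 * l2n \<Omega> (Rs k v)"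
    proof (rule l2n_dominated[OF L2_residual[OF v] L2_scaleR[OF M]])
      show "AE x in lebesgue_on \<Omega>. norm (sqrt k *\<^sub>R ?M x) \<le> 1 * norm (Rs k v x)"
        unfolding residual_def real_scaleR_def mult_1 by (intro AE_I2 norm_fst_le)
    qed simp
    then have rM: "l2n \<Omega> ?M \<le> 1 / sqrt k * r"
      using sk k by (simp only: l2n_scaleR) (simp add: r_def field_simps)
    have "l2n \<Omega> ?f \<le> 1 * l2n \<Omega> (Rs k v)"
    proof (rule l2n_dominated[OF L2_residual[OF v] f])
      show "AE x in lebesgue_on \<Omega>. norm (?f x) \<le> 1 * norm (Rs k v x)"
        unfolding residual_def mult_1 by (intro AE_I2 norm_snd_le)
    qed simp
    then have rf: "l2n \<Omega> ?f \<le> r" by (simp add: r_def)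
    have "(l2n \<Omega> ?u)\<^sup>2 / k + (l2n \<Omega> SG)\<^sup>2 \<le> l2ip \<Omega> ?M ?u + l2ip \<Omega> ?f SG"
      using energy_identity[OF k v] unfolding l2n_square SG_def[abs_def] .
    also have "\<dots> \<le> l2n \<Omega> ?M * l2n \<Omega> ?u + l2n \<Omega> ?f * l2n \<Omega> SG"
      using l2ip_Cauchy_Schwarz[OF M U(3)] l2ip_Cauchy_Schwarz[OF f SG] by linarith
    also have "\<dots> \<le> (1 / sqrt k * r) * l2n \<Omega> ?u + r * l2n \<Omega> SG"
      using rM rf by (intro add_mono mult_right_mono) auto
    \<comment> \<open>Scaling u by 1 / sqrt k gives both squares weight 1 and both linear terms the
      common factor r, because the first residual component carries the factor sqrt k.\<close>
    finally have "(l2n \<Omega> ?u / sqrt k)\<^sup>2 + (l2n \<Omega> SG)\<^sup>2 \<le> r * (l2n \<Omega> ?u / sqrt k + l2n \<Omega> SG)"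
      using k by (simp add: power_divide algebra_simps)
    then have ab: "l2n \<Omega> ?u / sqrt k \<le> 2 * r" "l2n \<Omega> SG \<le> 2 * r"
      using sum_squares_le_imp_bounds[of "l2n \<Omega> ?u / sqrt k" "l2n \<Omega> SG" r] r0 sk by simp_all
    have u: "l2n \<Omega> ?u \<le> cu * r" using ab(1) sk by (simp add: cu_def field_simps)
    have "l2n \<Omega> ?G \<le> 1 / sqrt a0 * l2n \<Omega> SG"
    proof (rule l2n_dominated[OF SG U(4)])
      show "AE x in lebesgue_on \<Omega>. norm (?G x) \<le> 1 / sqrt a0 * norm (SG x)"
        using A_spd
      proof eventually_elim
        case (elim x)
        show ?case
          using spd_norm_ge[OF mat_sqrt_spd(2)[OF elim a0], of "?G x"] sa by (simp add: SG_def field_simps)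
      qed
    qed (use sa in simp)
    also have "\<dots> \<le> 1 / sqrt a0 * (2 * r)" using ab(2) sa by (intro mult_left_mono) auto
    finally have G: "l2n \<Omega> ?G \<le> cG * r" by (simp add: cG_def)
    have "l2n \<Omega> ?s \<le> Cs * l2n \<Omega> (\<lambda>x. SG x - ?f x)"
    proof (rule l2n_dominated[OF L2_diff[OF SG f] U(5)])
      show "AE x in lebesgue_on \<Omega>. norm (?s x) \<le> Cs * norm (SG x - ?f x)"
        using A_spd Cs(2)
      proof eventually_elim
        case (elim x)
        have "?s x = mat_sqrt (A x) *v (SG x - ?f x)"
          using spd_matrix_inv(1)[OF mat_sqrt_spd(2)[OF elim(1) a0] sa] by (simp add: SG_def flux_def)
        then show ?case using elim(2) by metis
      qed
    qed (use Cs in simp)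
    also have "\<dots> \<le> Cs * (2 * r + r)"
      using l2n_triangle_diff[OF SG f] ab(2) rf Cs by (intro mult_left_mono) auto
    finally have s: "l2n \<Omega> ?s \<le> cs * r" by (simp add: cs_def)
    have "?d = (\<lambda>x. ((1 / k) *\<^sub>R ?u x - ?M x) - (inner (\<beta> x) (?G x) - \<gamma> x * ?u x))"
      by (simp add: Lop_def fun_eq_iff)
    then have "l2n \<Omega> ?d \<le> l2n \<Omega> (\<lambda>x. (1 / k) *\<^sub>R ?u x - ?M x) + l2n \<Omega> (\<lambda>x. inner (\<beta> x) (?G x) - \<gamma> x * ?u x)"
      using l2n_triangle_diff[OF L2_diff[OF L2_scaleR[OF U(3)] M] L2_diff[OF bG gu], of "1/k"] by metis
    also have "\<dots> \<le> (l2n \<Omega> (\<lambda>x. (1 / k) *\<^sub>R ?u x) + l2n \<Omega> ?M)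
        + (l2n \<Omega> (\<lambda>x. inner (\<beta> x) (?G x)) + l2n \<Omega> (\<lambda>x. \<gamma> x * ?u x))"
      by (intro add_mono l2n_triangle_diff L2_scaleR U M bG gu)
    also have "\<dots> \<le> (1 / k * l2n \<Omega> ?u + 1 / sqrt k * r) + (Cb * l2n \<Omega> ?G + Cg * l2n \<Omega> ?u)"
    proof (intro add_mono rM)
      show "l2n \<Omega> (\<lambda>x. (1 / k) *\<^sub>R ?u x) \<le> 1 / k * l2n \<Omega> ?u"
        using k by (simp only: l2n_scaleR) simp
      show "l2n \<Omega> (\<lambda>x. inner (\<beta> x) (?G x)) \<le> Cb * l2n \<Omega> ?G"
        by (rule l2n_dominated[OF U(4) bG less_imp_le[OF Cb(1)] Linf_inner_bound[OF Cb(2)]])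
      show "l2n \<Omega> (\<lambda>x. \<gamma> x * ?u x) \<le> Cg * l2n \<Omega> ?u"
        by (rule l2n_dominated[OF U(3) gu less_imp_le[OF Cg(1)] Linf_mult_bound[OF Cg(2)]])
    qed
    also have "\<dots> \<le> (1 / k * (cu * r) + 1 / sqrt k * r) + (Cb * (cG * r) + Cg * (cu * r))"
      using u G k Cb Cg by (intro add_mono mult_left_mono order_refl) auto
    finally have d: "l2n \<Omega> ?d \<le> cd * r" by (simp add: cd_def algebra_simps)
    have "l2n \<Omega> (E v) = sqrt ((l2n \<Omega> ?u)\<^sup>2 + (l2n \<Omega> ?G)\<^sup>2 + (l2n \<Omega> ?s)\<^sup>2 + (l2n \<Omega> ?d)\<^sup>2)"
      by (simp add: U_norm_eq[OF v, symmetric] U_norm_def l2n_square)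
    also have "\<dots> \<le> l2n \<Omega> ?u + l2n \<Omega> ?G + l2n \<Omega> ?s + l2n \<Omega> ?d"
    proof (rule real_le_lsqrt)
      have "0 \<le> l2n \<Omega> ?u * l2n \<Omega> ?G" "0 \<le> l2n \<Omega> ?u * l2n \<Omega> ?s" "0 \<le> l2n \<Omega> ?u * l2n \<Omega> ?d"
        "0 \<le> l2n \<Omega> ?G * l2n \<Omega> ?s" "0 \<le> l2n \<Omega> ?G * l2n \<Omega> ?d" "0 \<le> l2n \<Omega> ?s * l2n \<Omega> ?d" by simp_all
      then show "(l2n \<Omega> ?u)\<^sup>2 + (l2n \<Omega> ?G)\<^sup>2 + (l2n \<Omega> ?s)\<^sup>2 + (l2n \<Omega> ?d)\<^sup>2
          \<le> (l2n \<Omega> ?u + l2n \<Omega> ?G + l2n \<Omega> ?s + l2n \<Omega> ?d)\<^sup>2"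
        by (simp add: power2_eq_square algebra_simps)
    qed simp
    finally show ?thesis using u G s d by (simp add: r_def distrib_right)
  qed
  then show ?thesis using pos by (intro exI[of _ "cu + cG + cs + cd"]) auto
qed

text \<open>The graph vectors have a limit in the product of L2 spaces. It is again a graph vector
  because weak derivatives are closed operators and \<open>H10\<close> is closed in the H1
  sense.\<close>

lemma U_space_complete:
  assumes vs: "\<And>n. vs n \<in> U_space \<Omega>" and Cau: "L2_Cauchy \<Omega> (\<lambda>n. E (vs n))"
  shows "\<exists>w\<in>U_space \<Omega>. (\<lambda>n. l2n \<Omega> (\<lambda>x. E (vs n) x - E w x)) \<longlonglongrightarrow> 0"
proof -
  obtain e where e: "L2 \<Omega> e" "(\<lambda>n. l2n \<Omega> (\<lambda>x. E (vs n) x - e x)) \<longlonglongrightarrow> 0"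
    using L2_complete[OF L2_graph_vec[OF vs] Cau] by auto
  define u' where "u' x = fst (e x)" for x
  define G' where "G' x = fst (snd (e x))" for x
  define s' where "s' x = fst (snd (snd (e x)))" for x
  define d' where "d' x = snd (snd (snd (e x)))" for x
  have L: "L2 \<Omega> u'" "L2 \<Omega> G'" "L2 \<Omega> s'" "L2 \<Omega> d'"
    unfolding u'_def G'_def s'_def d'_def by (intro L2_fst L2_snd e)+
  have ee: "e x = (u' x, G' x, s' x, d' x)" for x by (simp add: u'_def G'_def s'_def d'_def)
  note U = U_space_L2[OF vs]
  have dE: "L2 \<Omega> (\<lambda>x. E (vs n) x - e x)" for n by (intro L2_diff L2_graph_vec vs e)
  have comp: "norm (E (vs n) x - e x) = norm (fst (vs n) x - u' x, wgrad \<Omega> (fst (vs n)) x - G' x,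
      snd (vs n) x - s' x, wdiv \<Omega> (snd (vs n)) x - d' x)" for n x
    by (simp add: graph_vec_def ee)
  have "l2n \<Omega> (\<lambda>x. fst (vs n) x - u' x) \<le> 1 * l2n \<Omega> (\<lambda>x. E (vs n) x - e x)" for n
    by (rule l2n_dominated[OF dE L2_diff[OF U(3) L(1)] zero_le_one AE_I2])
      (simp only: comp mult_1 norm_fst_le)
  then have l1: "(\<lambda>n. l2n \<Omega> (\<lambda>x. fst (vs n) x - u' x)) \<longlonglongrightarrow> 0"
    by (intro l2n_tendsto_0_mono[OF e(2)]) simp
  have "l2n \<Omega> (\<lambda>x. wgrad \<Omega> (fst (vs n)) x - G' x) \<le> 1 * l2n \<Omega> (\<lambda>x. E (vs n) x - e x)" for n
    by (rule l2n_dominated[OF dE L2_diff[OF U(4) L(2)] zero_le_one AE_I2])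
      (simp only: comp mult_1 order_trans[OF norm_fst_le norm_snd_le])
  then have l2: "(\<lambda>n. l2n \<Omega> (\<lambda>x. wgrad \<Omega> (fst (vs n)) x - G' x)) \<longlonglongrightarrow> 0"
    by (intro l2n_tendsto_0_mono[OF e(2)]) simp
  have "l2n \<Omega> (\<lambda>x. snd (vs n) x - s' x) \<le> 1 * l2n \<Omega> (\<lambda>x. E (vs n) x - e x)" for n
    by (rule l2n_dominated[OF dE L2_diff[OF U(5) L(3)] zero_le_one AE_I2])
      (simp only: comp mult_1 order_trans[OF order_trans[OF norm_fst_le norm_snd_le] norm_snd_le])
  then have l3: "(\<lambda>n. l2n \<Omega> (\<lambda>x. snd (vs n) x - s' x)) \<longlonglongrightarrow> 0"
    by (intro l2n_tendsto_0_mono[OF e(2)]) simp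
  have "l2n \<Omega> (\<lambda>x. wdiv \<Omega> (snd (vs n)) x - d' x) \<le> 1 * l2n \<Omega> (\<lambda>x. E (vs n) x - e x)" for n
    by (rule l2n_dominated[OF dE L2_diff[OF U(6) L(4)] zero_le_one AE_I2])
      (simp only: comp mult_1 order_trans[OF order_trans[OF norm_snd_le norm_snd_le] norm_snd_le])
  then have l4: "(\<lambda>n. l2n \<Omega> (\<lambda>x. wdiv \<Omega> (snd (vs n)) x - d' x)) \<longlonglongrightarrow> 0"
    by (intro l2n_tendsto_0_mono[OF e(2)]) simp
  note hu = H10_limit[OF U(1) L(1,2) l1 l2]
  note hs = wdiv_AE_eq[OF L(3,4) is_weak_div_limit[OF U(5) L(3) U(6) L(4) U(8) l3 l4]]
  have w: "(u', s') \<in> U_space \<Omega>" using hu(1) hs(1) by (simp add: U_space_def)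
  \<comment> \<open>The limit tuple agrees with the graph vector of its own first and third entries,
    but only almost everywhere, as \<open>wgrad\<close> and \<open>wdiv\<close> are chosen anew for
    the limit.\<close>
  have Ew: "AE x in lebesgue_on \<Omega>. E (u', s') x = e x"
    using hu(2) hs(2) by eventually_elim (simp add: graph_vec_def ee)
  have "l2n \<Omega> (\<lambda>x. E (vs n) x - E (u', s') x) = l2n \<Omega> (\<lambda>x. E (vs n) x - e x)" for n
  proof (rule l2n_cong_AE)
    show "AE x in lebesgue_on \<Omega>. E (vs n) x - E (u', s') x = E (vs n) x - e x"
      using Ew by eventually_elim simp
  qed (intro L2_diff L2_graph_vec vs w e)+
  then show ?thesis using e(2) by (intro bexI[OF _ w]) simp
qed

lemma solution_exists_unique:
  assumes k: "0 < k" and V: "closed_subspace_U \<Omega> V" and g: "L2 \<Omega> g" and w: "L2 \<Omega> w"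
  shows "\<exists>u\<in>V. (\<forall>v\<in>V. B_form \<Omega> A \<beta> \<gamma> k u v = F_form \<Omega> \<beta> \<gamma> k v g w) \<and>
    (\<forall>u'\<in>V. (\<forall>v\<in>V. B_form \<Omega> A \<beta> \<gamma> k u' v = F_form \<Omega> \<beta> \<gamma> k v g w) \<longrightarrow> U_eq \<Omega> u' u)"
proof -
  have VU: "v \<in> U_space \<Omega>" if "v \<in> V" for v using V that by (auto simp: closed_subspace_U_def)
  have comb: "U_comb v c v' \<in> V" if "v \<in> V" "v' \<in> V" for v v' c
    by (rule closed_subspace_U_comb[OF V that])
  obtain C where C: "0 < C" "\<And>v. v \<in> U_space \<Omega> \<Longrightarrow> l2n \<Omega> (E v) \<le> C * l2n \<Omega> (Rs k v)"
    using coercivity[OF k] by blast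
  obtain C' where C': "\<And>v w. v \<in> U_space \<Omega> \<Longrightarrow> w \<in> U_space \<Omega> \<Longrightarrow>
    l2n \<Omega> (\<lambda>x. Rs k v x - Rs k w x) \<le> C' * l2n \<Omega> (\<lambda>x. E v x - E w x)"
    using residual_diff_le[OF k] by blast
  have R_diff: "l2n \<Omega> (Rs k (U_diff v v')) = l2n \<Omega> (\<lambda>x. Rs k v x - Rs k v' x)"
    if "v \<in> U_space \<Omega>" "v' \<in> U_space \<Omega>" "U_diff v v' \<in> U_space \<Omega>" for v v'
    using residual_comb[OF that(1,2), of k "-1"] that
    by (intro l2n_cong_AE L2_diff L2_residual) (simp_all add: U_diff_eq_comb)
  \<comment> \<open>The range of \<open>Rs k\<close> on V, closed up under almost everywhere
    equality: the bare range need not contain the linear combinations of its members, as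
    \<open>residual_comb\<close> holds only up to null sets.\<close>
  define W where "W = {f. L2 \<Omega> f \<and> (\<exists>v\<in>V. AE x in lebesgue_on \<Omega>. f x = Rs k v x)}"
  define H where "H x = (sqrt k * (g x + w x / k), 0 :: real^'d)" for x
  have "L2 \<Omega> (\<lambda>x. g x + w x / k)" using L2_add[OF g L2_mult[OF w, of "1/k"]] by simp
  then have H: "L2 \<Omega> H" unfolding H_def by (intro L2_Pair L2_mult L2_zero)
  have RW: "Rs k v \<in> W" if "v \<in> V" for v
    using that by (auto simp: W_def intro: L2_residual VU)
  have "\<exists>p\<in>W. \<forall>f\<in>W. l2ip \<Omega> p f = l2ip \<Omega> H f"
  proof (rule L2_projection)
    show "L2 \<Omega> f" if "f \<in> W" for f using that by (simp add: W_def)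
    have "((\<lambda>x. 0), (\<lambda>x. 0)) \<in> V" using V by (simp add: closed_subspace_U_def)
    then show "W \<noteq> {}" using RW by blast
    show "(\<lambda>x. f x + c *\<^sub>R f' x) \<in> W" if "f \<in> W" "f' \<in> W" for f f' c
    proof -
      obtain v v' where v: "v \<in> V" "AE x in lebesgue_on \<Omega>. f x = Rs k v x"
        and v': "v' \<in> V" "AE x in lebesgue_on \<Omega>. f' x = Rs k v' x" using \<open>f \<in> W\<close> \<open>f' \<in> W\<close> by (auto simp: W_def)
      have "AE x in lebesgue_on \<Omega>. f x + c *\<^sub>R f' x = Rs k (U_comb v c v') x"
        using v(2) v'(2) residual_comb[OF VU[OF v(1)] VU[OF v'(1)], of k c] by eventually_elim simp
      then show ?thesis
        using that comb[OF v(1) v'(1), of c] by (auto simp: W_def intro: L2_add L2_scaleR)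
    qed
    show "f \<in> W" if fs: "\<And>n. fs n \<in> W" and f: "L2 \<Omega> f" and lim: "(\<lambda>n. l2n \<Omega> (\<lambda>x. fs n x - f x)) \<longlonglongrightarrow> 0" for fs f
    proof -
      have "\<exists>v\<in>V. AE x in lebesgue_on \<Omega>. fs n x = Rs k v x" for n using fs[of n] by (simp add: W_def)
      then obtain vs where vs: "\<And>n. vs n \<in> V" "\<And>n. AE x in lebesgue_on \<Omega>. fs n x = Rs k (vs n) x"
        by metis
      note vU = VU[OF vs(1)]
      have "l2n \<Omega> (\<lambda>x. Rs k (vs n) x - f x) = l2n \<Omega> (\<lambda>x. fs n x - f x)" for n
      proof (rule l2n_cong_AE)
        show "AE x in lebesgue_on \<Omega>. Rs k (vs n) x - f x = fs n x - f x"
          using vs(2)[of n] by eventually_elim simp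
      qed (use fs[of n] f vU in \<open>auto simp: W_def intro!: L2_diff L2_residual\<close>)
      then have limR: "(\<lambda>n. l2n \<Omega> (\<lambda>x. Rs k (vs n) x - f x)) \<longlonglongrightarrow> 0" using lim by simp
      have CR: "L2_Cauchy \<Omega> (\<lambda>n. Rs k (vs n))"
        by (rule L2_Cauchy_if_convergent[OF L2_residual[OF vU] f limR])
      \<comment> \<open>Coercivity applied to the difference, which lies in U because V is a
        subspace. It transfers the Cauchy property from residuals to graph vectors.\<close>
      have EC: "l2n \<Omega> (\<lambda>x. E (vs m) x - E (vs n) x) \<le> C * l2n \<Omega> (\<lambda>x. Rs k (vs m) x - Rs k (vs n) x)" for m n
      proof -
        have d: "U_diff (vs m) (vs n) \<in> U_space \<Omega>"
          unfolding U_diff_eq_comb by (intro VU comb vs)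
        show ?thesis
          using C(2)[OF d] U_norm_diff[OF vU[of m] vU[of n]] U_norm_eq[OF d] R_diff[OF vU vU d] by simp
      qed
      have "L2_Cauchy \<Omega> (\<lambda>n. E (vs n))"
        unfolding L2_Cauchy_def
      proof (intro allI impI)
        fix e :: real assume "e > 0"
        then obtain N where N: "\<And>m n. m \<ge> N \<Longrightarrow> n \<ge> N \<Longrightarrow> l2n \<Omega> (\<lambda>x. Rs k (vs m) x - Rs k (vs n) x) < e / C"
          using CR C(1) unfolding L2_Cauchy_def by (metis divide_pos_pos)
        have "l2n \<Omega> (\<lambda>x. E (vs m) x - E (vs n) x) < e" if "m \<ge> N" "n \<ge> N" for m n
          using EC[of m n] N[OF that] C(1) by (simp add: field_simps)
        then show "\<exists>N. \<forall>m\<ge>N. \<forall>n\<ge>N. l2n \<Omega> (\<lambda>x. E (vs m) x - E (vs n) x) < e" by blast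
      qed
      then obtain z where z: "z \<in> U_space \<Omega>" "(\<lambda>n. l2n \<Omega> (\<lambda>x. E (vs n) x - E z x)) \<longlonglongrightarrow> 0"
        using U_space_complete[of vs] vU by blast
      have "(\<lambda>n. U_norm \<Omega> (U_diff (vs n) z)) \<longlonglongrightarrow> 0"
        using z by (simp add: U_norm_diff[OF vU z(1)])
      then have zV: "z \<in> V"
        using V[unfolded closed_subspace_U_def] vs(1) z(1) by blast
      \<comment> \<open>The residual map is also bounded above, so the residuals of
        \<open>vs n\<close> converge to that of \<open>z\<close> as well as to \<open>f\<close>; the
        two limits agree almost everywhere.\<close>
      have "(\<lambda>n. l2n \<Omega> (\<lambda>x. Rs k (vs n) x - f x) + C' * l2n \<Omega> (\<lambda>x. E (vs n) x - E z x)) \<longlonglongrightarrow> 0 + C' * 0"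
        by (intro tendsto_add tendsto_mult tendsto_const limR z(2))
      then have "l2n \<Omega> (\<lambda>x. f x - Rs k z x) \<le> 0 + C' * 0"
      proof (rule LIMSEQ_le_const)
        have "l2n \<Omega> (\<lambda>x. f x - Rs k z x) \<le> l2n \<Omega> (\<lambda>x. Rs k (vs n) x - f x) + C' * l2n \<Omega> (\<lambda>x. E (vs n) x - E z x)" for n
          using l2n_triangle_via[OF f L2_residual[OF vU, of k n] L2_residual[OF z(1), of k]] C'[OF vU[of n] z(1)]
            l2n_minus_commute[of \<Omega> f "Rs k (vs n)"] by linarith
        then show "\<exists>N. \<forall>n\<ge>N. l2n \<Omega> (\<lambda>x. f x - Rs k z x)
            \<le> l2n \<Omega> (\<lambda>x. Rs k (vs n) x - f x) + C' * l2n \<Omega> (\<lambda>x. E (vs n) x - E z x)" by blast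
      qed
      then have "l2n \<Omega> (\<lambda>x. f x - Rs k z x) = 0" using l2n_nonneg[of \<Omega> "\<lambda>x. f x - Rs k z x"] by simp
      then have "AE x in lebesgue_on \<Omega>. f x - Rs k z x = 0"
        by (rule l2n_eq_0_AE[OF L2_diff[OF f L2_residual[OF z(1)]]])
      then have "AE x in lebesgue_on \<Omega>. f x = Rs k z x" by eventually_elim simp
      then show ?thesis using f zV by (auto simp: W_def)
    qed
  qed (rule H)
  then obtain p where p: "p \<in> W" "\<And>f. f \<in> W \<Longrightarrow> l2ip \<Omega> p f = l2ip \<Omega> H f" by blast
  then obtain u where u: "u \<in> V" "AE x in lebesgue_on \<Omega>. p x = Rs k u x" and Lp: "L2 \<Omega> p" by (auto simp: W_def)
  have sol: "l2ip \<Omega> (Rs k u) (Rs k v) = l2ip \<Omega> H (Rs k v)" if "v \<in> V" for v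
  proof -
    have "l2ip \<Omega> p (Rs k v) = l2ip \<Omega> (Rs k u) (Rs k v)"
      using u that by (intro l2ip_cong_AE Lp L2_residual VU) auto
    then show ?thesis using p(2)[OF RW[OF that]] by simp
  qed
  have F: "F_form \<Omega> \<beta> \<gamma> k v g w = l2ip \<Omega> H (Rs k v)" for v
    unfolding H_def by (rule F_form_eq[OF k])
  show ?thesis
  proof (intro bexI[OF _ u(1)] conjI ballI impI)
    show "B_form \<Omega> A \<beta> \<gamma> k u v = F_form \<Omega> \<beta> \<gamma> k v g w" if "v \<in> V" for v
      using sol[OF that] by (simp add: B_form_eq[OF k VU[OF u(1)] VU[OF that]] F)
    fix u' assume u': "u' \<in> V" and eq: "\<forall>v\<in>V. B_form \<Omega> A \<beta> \<gamma> k u' v = F_form \<Omega> \<beta> \<gamma> k v g w"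
    \<comment> \<open>The difference of two solutions is itself an admissible test function. Its
      residual is then orthogonal to itself, and coercivity annihilates the whole graph
      vector.\<close>
    have zV: "U_diff u' u \<in> V" unfolding U_diff_eq_comb by (rule comb[OF u' u(1)])
    let ?z = "U_diff u' u"
    note Uz = VU[OF zV] and Uu = VU[OF u(1)] and Uu' = VU[OF u']
    have "l2ip \<Omega> (Rs k u') (Rs k ?z) = l2ip \<Omega> (Rs k u) (Rs k ?z)"
      using eq[rule_format, OF zV] sol[OF zV] B_form_eq[OF k Uu' Uz] F by simp
    then have "l2ip \<Omega> (\<lambda>x. Rs k u' x - Rs k u x) (Rs k ?z) = 0"
      by (simp add: l2ip_diff_left L2_residual Uu Uu' Uz)
    moreover have "l2ip \<Omega> (Rs k ?z) (Rs k ?z) = l2ip \<Omega> (\<lambda>x. Rs k u' x - Rs k u x) (Rs k ?z)"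
      using residual_comb[OF Uu' Uu, of k "-1"]
      by (intro l2ip_cong_AE L2_residual L2_diff Uu Uu' Uz) (simp_all add: U_diff_eq_comb)
    ultimately have "l2n \<Omega> (Rs k ?z) = 0" by (simp add: l2n_def)
    then have "l2n \<Omega> (E ?z) = 0" using C(2)[OF Uz] l2n_nonneg[of \<Omega> "E ?z"] by simp
    then have "AE x in lebesgue_on \<Omega>. E ?z x = 0" by (rule l2n_eq_0_AE[OF L2_graph_vec[OF Uz]])
    then show "U_eq \<Omega> u' u"
      unfolding U_eq_def by eventually_elim (simp add: graph_vec_def U_diff_def zero_prod_def)
  qed
qed

end

section \<open>Recursion over the time steps\<close>

theorem theorem2p1:
  fixes \<Omega> :: "(real^'d::finite) set"
    and A :: "real^'d \<Rightarrow> real^'d^'d" and \<beta> :: "real^'d \<Rightarrow> real^'d" and \<gamma> :: "real^'d \<Rightarrow> real"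
    and \<alpha>0 :: real
    and N :: nat and T :: real and t :: "nat \<Rightarrow> real"
    and f :: "nat \<Rightarrow> real^'d \<Rightarrow> real" and u0 :: "real^'d \<Rightarrow> real"
    and Uh :: "nat \<Rightarrow> 'd Uelem set"
  assumes dom: "lipschitz_domain \<Omega>" "bounded \<Omega>" "polygonal_boundary \<Omega>"
    and A_Linf: "Linf \<Omega> A"
    and A_sym: "AE x in lebesgue_on \<Omega>. transpose (A x) = A x"
    and alpha0: "\<alpha>0 > 0"
    and A_ell: "AE x in lebesgue_on \<Omega>. \<forall>c \<in> mat_eigenvalues (A x). c \<ge> \<alpha>0"
    and beta_Linf: "Linf \<Omega> \<beta>" and gamma_Linf: "Linf \<Omega> \<gamma>"
    and div_beta: "\<exists>q. Linf \<Omega> q \<and> is_weak_div \<Omega> \<beta> q \<and>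
                     Linf \<Omega> (\<lambda>x. q x / 2 + \<gamma> x) \<and>
                     (AE x in lebesgue_on \<Omega>. q x / 2 + \<gamma> x \<ge> 0)"
    and part: "t 0 = 0" "t N = T" "\<And>n. n < N \<Longrightarrow> t n < t (Suc n)"
    and f_L2: "\<And>n. n \<in> {1..N} \<Longrightarrow> L2 \<Omega> (f n)"
    and u0_L2: "L2 \<Omega> u0"
    and Uh_cl: "\<And>n. n \<in> {1..N} \<Longrightarrow> closed_subspace_U \<Omega> (Uh n)"
  shows "\<exists>uh :: nat \<Rightarrow> 'd Uelem. fst (uh 0) = u0 \<and>
     (\<forall>n \<in> {1..N}.
        uh n \<in> Uh n \<and>
        (\<forall>vh \<in> Uh n. B_form \<Omega> A \<beta> \<gamma> (t n - t (n - 1)) (uh n) vh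
                       = F_form \<Omega> \<beta> \<gamma> (t n - t (n - 1)) vh (f n) (fst (uh (n - 1)))) \<and>
        (\<forall>wh \<in> Uh n. (\<forall>vh \<in> Uh n. B_form \<Omega> A \<beta> \<gamma> (t n - t (n - 1)) wh vh
                       = F_form \<Omega> \<beta> \<gamma> (t n - t (n - 1)) vh (f n) (fst (uh (n - 1))))
                     \<longrightarrow> U_eq \<Omega> wh (uh n)))"
proof -
  obtain q where q: "Linf \<Omega> q" "is_weak_div \<Omega> \<beta> q" "AE x in lebesgue_on \<Omega>. 0 \<le> q x / 2 + \<gamma> x"
    using div_beta by blast
  have "AE x in lebesgue_on \<Omega>. spd \<alpha>0 (A x)"
    using A_sym A_ell by eventually_elim (auto intro: spd_if_eigenvalues_ge)
  then interpret least_squares \<Omega> A \<beta> \<gamma> q \<alpha>0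
    using dom A_Linf alpha0 beta_Linf gamma_Linf q by unfold_locales (auto simp: lipschitz_domain_def)
  \<comment> \<open>Existence and uniqueness for one step, with the previous first component
    abstracted to \<open>w\<close> so that it can drive the recursion.\<close>
  define P where "P n w u \<longleftrightarrow> u \<in> Uh n \<and>
      (\<forall>v\<in>Uh n. B_form \<Omega> A \<beta> \<gamma> (t n - t (n - 1)) u v = F_form \<Omega> \<beta> \<gamma> (t n - t (n - 1)) v (f n) w) \<and>
      (\<forall>u'\<in>Uh n. (\<forall>v\<in>Uh n. B_form \<Omega> A \<beta> \<gamma> (t n - t (n - 1)) u' v = F_form \<Omega> \<beta> \<gamma> (t n - t (n - 1)) v (f n) w)
        \<longrightarrow> U_eq \<Omega> u' u)" for n w u
  have ex: "\<exists>u. P n w u" if n: "n \<in> {1..N}" and w: "L2 \<Omega> w" for n w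
  proof -
    have "0 < t n - t (n - 1)" using part(3)[of "n - 1"] n by auto
    from solution_exists_unique[OF this Uh_cl[OF n] f_L2[OF n] w] show ?thesis
      unfolding P_def by blast
  qed
  \<comment> \<open>The flux at time 0 is a placeholder, since only the first component enters the
    next step. Beyond index N the recursion selects arbitrary values, about which nothing is
    claimed.\<close>
  define uh where "uh = rec_nat (u0, (\<lambda>x. 0)) (\<lambda>n u. SOME u'. P (Suc n) (fst u) u')"
  have uh0: "uh 0 = (u0, (\<lambda>x. 0))" by (simp add: uh_def)
  have uhS: "uh (Suc n) = (SOME u'. P (Suc n) (fst (uh n)) u')" for n by (simp add: uh_def)
  have step: "P (Suc n) (fst (uh n)) (uh (Suc n))" if "Suc n \<le> N" "L2 \<Omega> (fst (uh n))" for n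
    unfolding uhS by (rule someI_ex[OF ex]) (use that in auto)
  \<comment> \<open>Each step is solvable only if its datum is square integrable. That is inherited,
    because the solution just chosen lies in \<open>Uh (Suc n)\<close> and hence in U.\<close>
  have L: "L2 \<Omega> (fst (uh n))" if "n \<le> N" for n
    using that
  proof (induction n)
    case 0
    show ?case by (simp add: uh0 u0_L2)
  next
    case (Suc n)
    then have "uh (Suc n) \<in> Uh (Suc n)" using step[of n] by (simp add: P_def)
    then have "uh (Suc n) \<in> U_space \<Omega>"
      using Uh_cl[of "Suc n"] Suc.prems by (auto simp: closed_subspace_U_def)
    then show ?case by (rule U_space_L2(3))
  qed
  have "P n (fst (uh (n - 1))) (uh n)" if "n \<in> {1..N}" for n
    using step[of "n - 1"] L[of "n - 1"] that by (cases n) auto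
  then show ?thesis
    unfolding P_def by (intro exI[of _ uh]) (simp add: uh0)
qed

end
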